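(* Assume $f\in\mathbb L^\infty(\mathbb S^1)$ and Assumption (A). Let $\kappa>32$, define for $m\in\mathcal M_n$ \[ \widehat{\mathrm{pen}}(m)=\kappa\,\frac{\|\hat G_m^{-1}\|_{op}}{2\pi}\,\frac{D_m}{n}, \] $\hat m^*=\arg\min_{m\in\mathcal M_n}\big(\zeta(\mathring f_m)+\widehat{\mathrm{pen}}(m)\big)$, and $\tilde f_{\hat m^*}=\mathring f_{\hat m^*}\mathbf 1\{\|\mathring f_{\hat m^*}\|_2^2\le n^2\}$. Then \[ \mathbb E\|\tilde f_{\hat m^*}-f\|_2^2\ \le\ K(\sigma_0)\inf_{m\in\mathcal M_n}\Big(\|f-f_m\|_2^2+\kappa\frac{D_m}{n}\Big)+\frac{\tilde K(\sigma_0,\|f\|_\infty)}{n}, \] where $f_m$ is the $\mathbb L^2$-orthogonal projection of $f$ onto $S_m$, $K(\sigma_0)$ depends only on $\sigma_0$ (and the fixed $\kappa$) and $\tilde K$ only on $\sigma_0,\|f\|_\infty$ (and the fixed $\kappa$).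
   Context: Circle convention: $\mathbb S^1\cong[0,2\pi)$, anticlockwise orientation; $[x,y]$ is the usual interval if $x\le y$ and $[x,2\pi)\cup[0,y]$ if $x>y$. Model: $X$ has density $f$ on $\mathbb S^1$; $(L,U)$ random pair in $(\mathbb S^1)^2$ independent of $X$ with $L\ne U$ a.s.; $(X_i,L_i,U_i)_{i\le n}$ i.i.d. copies; $\Delta_i=\mathbf 1\{X_i\in[L_i,U_i]\}$, $X_i'=X_i$ if $\Delta_i=1$ and $-\pi$ otherwise. $\sigma(x)=\mathbb P(x\in[L,U])$. Assumption (A): there is $\sigma_0>0$ with $\sigma\ge\sigma_0$ on $\mathbb S^1$. Trigonometric basis $\varphi_0=1/\sqrt{2\pi}$, $\varphi_{2j-1}=\pi^{-1/2}\cos(j\cdot)$, $\varphi_{2j}=\pi^{-1/2}\sin(j\cdot)$; $\mathcal M_n=\{1,\dots,\lfloor n/2\rfloor-1\}$; $\Lambda_m=\{0,\dots,2m\}$, $S_m=\mathrm{span}\{\varphi_\lambda:\lambda\in\Lambda_m\}$, $D_m=2m+1$. $\hat G_m$: $(\hat G_m)_{\lambda\lambda'}=\frac1n\sum_i\int_{[L_i,U_i]}\varphi_\lambda\varphi_{\lambda'}$ (a.s. invertible). $\|M\|_{op}$ is the square root of the largest eigenvalue of $M^TM$. $\hat U_m=(\frac1n\sum_i\Delta_i\varphi_\lambda(X_i))_\lambda$. Contrast $\zeta(t)=\frac1n\sum_{i=1}^n\big(\int_{\mathbb S^1}t^2(x)\mathbf 1\{x\in[L_i,U_i]\}dx-2\Delta_i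 t(X_i')\big)$; $\mathring f_m=\arg\min_{t\in S_m}\zeta(t)=\sum_\lambda\hat a_\lambda\varphi_\lambda$ with $(\hat a_\lambda)=\hat G_m^{-1}\hat U_m$. *)

theory Defs
  imports "HOL-Probability.Probability" "Jordan_Normal_Form.Matrix" "Jordan_Normal_Form.Char_Poly"
    "Jordan_Normal_Form.Gauss_Jordan_Elimination"
begin

definition circ :: "real set" where
  "circ = {0..<2*pi}"

text \<open>Anticlockwise arc [x,y] on the circle.\<close>
definition arc :: "real \<Rightarrow> real \<Rightarrow> real set" where
  "arc x y = (if x \<le> y then {x..y} else {x..<2*pi} \<union> {0..y})"

definition lcirc :: "real measure" where
  "lcirc = restrict_space lborel circ"

definition L2sq :: "(real \<Rightarrow> real) \<Rightarrow> real" where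
  "L2sq g = (\<integral>x\<in>circ. (g x)\<^sup>2 \<partial>lborel)"

definition Linf :: "(real \<Rightarrow> real) \<Rightarrow> real" where
  "Linf g = Inf {B. AE x in lborel. x \<in> circ \<longrightarrow> \<bar>g x\<bar> \<le> B}"

definition phi :: "nat \<Rightarrow> real \<Rightarrow> real" where
  "phi l x = (if l = 0 then 1 / sqrt (2*pi)
     else if odd l then cos (real ((l+1) div 2) * x) / sqrt pi
     else sin (real (l div 2) * x) / sqrt pi)"

definition Dim :: "nat \<Rightarrow> nat" where "Dim m = 2*m+1"

definition Mset :: "nat \<Rightarrow> nat set" where
  "Mset n = {1..n div 2 - 1}"

definition proj :: "(real \<Rightarrow> real) \<Rightarrow> nat \<Rightarrow> real \<Rightarrow> real" where
  "proj f m x = (\<Sum>l\<le>2*m. (\<integral>y\<in>circ. f y * phi l y \<partial>lborel) * phi l x)"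

definition opnorm :: "real mat \<Rightarrow> real" where
  "opnorm M = sqrt (Max {k. eigenvalue (transpose_mat M * M) k})"

text \<open>Matrix inverse (the zero matrix if singular; this happens with probability 0).\<close>
definition minv :: "real mat \<Rightarrow> real mat" where
  "minv A = (case mat_inverse A of Some B \<Rightarrow> B | None \<Rightarrow> 0\<^sub>m (dim_row A) (dim_col A))"

text \<open>One observation: (X_i, (L_i, U_i)). A sample of size n is \<omega> :: nat \<Rightarrow> obs, i < n.\<close>
type_synonym obs = "real \<times> real \<times> real"

definition Delta :: "obs \<Rightarrow> real" where
  "Delta ob = indicator (arc (fst (snd ob)) (snd (snd ob))) (fst ob)"

definition Xp :: "obs \<Rightarrow> real" where
  "Xp ob = (if Delta ob = 1 then fst ob else - pi)"

definition Ghat :: "nat \<Rightarrow> (nat \<Rightarrow> obs) \<Rightarrow> nat \<Rightarrow> real mat" where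
  "Ghat n \<omega> m = mat (Dim m) (Dim m) (\<lambda>(l, l').
     (1 / real n) * (\<Sum>i<n. \<integral>x\<in>arc (fst (snd (\<omega> i))) (snd (snd (\<omega> i))). phi l x * phi l' x \<partial>lborel))"

definition Uhat :: "nat \<Rightarrow> (nat \<Rightarrow> obs) \<Rightarrow> nat \<Rightarrow> real vec" where
  "Uhat n \<omega> m = vec (Dim m) (\<lambda>l. (1 / real n) * (\<Sum>i<n. Delta (\<omega> i) * phi l (fst (\<omega> i))))"

definition ahat :: "nat \<Rightarrow> (nat \<Rightarrow> obs) \<Rightarrow> nat \<Rightarrow> real vec" where
  "ahat n \<omega> m = minv (Ghat n \<omega> m) *\<^sub>v Uhat n \<omega> m"

definition fring :: "nat \<Rightarrow> (nat \<Rightarrow> obs) \<Rightarrow> nat \<Rightarrow> real \<Rightarrow> real" where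
  "fring n \<omega> m x = (\<Sum>l\<le>2*m. ahat n \<omega> m $ l * phi l x)"

definition zeta :: "nat \<Rightarrow> (nat \<Rightarrow> obs) \<Rightarrow> (real \<Rightarrow> real) \<Rightarrow> real" where
  "zeta n \<omega> t = (1 / real n) * (\<Sum>i<n.
      (\<integral>x\<in>circ. (t x)\<^sup>2 * indicator (arc (fst (snd (\<omega> i))) (snd (snd (\<omega> i)))) x \<partial>lborel)
      - 2 * Delta (\<omega> i) * t (Xp (\<omega> i)))"

definition pen :: "real \<Rightarrow> nat \<Rightarrow> (nat \<Rightarrow> obs) \<Rightarrow> nat \<Rightarrow> real" where
  "pen \<kappa> n \<omega> m = \<kappa> * (opnorm (minv (Ghat n \<omega> m)) / (2*pi)) * (real (Dim m) / real n)"

definition mhat :: "real \<Rightarrow> nat \<Rightarrow> (nat \<Rightarrow> obs) \<Rightarrow> nat" where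
  "mhat \<kappa> n \<omega> = (LEAST m. m \<in> Mset n \<and>
      (\<forall>m'\<in>Mset n. zeta n \<omega> (fring n \<omega> m) + pen \<kappa> n \<omega> m
                   \<le> zeta n \<omega> (fring n \<omega> m') + pen \<kappa> n \<omega> m'))"

definition ftilde :: "real \<Rightarrow> nat \<Rightarrow> (nat \<Rightarrow> obs) \<Rightarrow> real \<Rightarrow> real" where
  "ftilde \<kappa> n \<omega> x = (let g = fring n \<omega> (mhat \<kappa> n \<omega>) in
      if L2sq g \<le> (real n)\<^sup>2 then g x else 0)"

definition sigmaQ :: "(real \<times> real) measure \<Rightarrow> real \<Rightarrow> real" where
  "sigmaQ Q x = measure Q {(l, u). x \<in> arc l u}"

definition obs_law :: "(real \<Rightarrow> real) \<Rightarrow> (real \<times> real) measure \<Rightarrow> obs measure" where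
  "obs_law f Q = density lcirc (\<lambda>x. ennreal (f x)) \<Otimes>\<^sub>M Q"

definition sample_law :: "(real \<Rightarrow> real) \<Rightarrow> (real \<times> real) measure \<Rightarrow> nat \<Rightarrow> (nat \<Rightarrow> obs) measure" where
  "sample_law f Q n = PiM {..<n} (\<lambda>_. obs_law f Q)"

end

theory Submission
  imports Defs
begin

text \<open>
  Write \<open>\<sigma>\<^sub>n\<close> for the empirical coverage function and \<open>\<parallel>t\<parallel>\<^sub>n\<^sup>2 = \<integral> t\<^sup>2 \<sigma>\<^sub>n\<close>. Then
  \<open>\<zeta>(t) = \<parallel>t - f\<parallel>\<^sub>n\<^sup>2 - \<parallel>f\<parallel>\<^sub>n\<^sup>2 - 2 \<nu>(t)\<close>, where \<open>\<nu>\<close> is linear and centred given the arcs. If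
  \<open>\<sigma>\<^sub>n \<ge> \<sigma>\<^sub>0 / 2\<close>, comparing penalised contrasts gives the oracle inequality up to the positive parts of
  \<open>Z\<^sub>M - 5 D\<^sub>M / (2 \<pi> n)\<close>, where \<open>Z\<^sub>M\<close> is the squared norm of \<open>\<nu>\<close> on \<open>S\<^sub>M\<close>; the penalty absorbs the
  constant 20 = 4 * 5.

  No concentration inequality for suprema is needed: \<open>n\<^sup>2 Z\<^sub>M = |\<Sum> Y\<^sub>i|\<^sup>2\<close> is a diagonal part, at most
  \<open>4 n D\<^sub>M / (2 \<pi>)\<close>, plus the martingale \<open>2 \<Sum> Y\<^sub>i \<cdot> (Y\<^sub>1 + \<dots> + Y\<^bsub>i-1\<^esub>)\<close>. A one-step recursion
  bounds its sixth moment by a constant times \<open>n\<^sup>6 D\<^sub>M\<^sup>3\<close>, so the positive parts have mean of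
  order \<open>1 / (n D\<^sub>M\<^sup>2)\<close>, which is summable over the models. The same moment bound in dimension one
  controls finitely many empirical frequencies, and quantile brackets of the laws of \<open>L\<close> and \<open>-U\<close> turn this
  into the uniform bound \<open>\<sigma>\<^sub>n \<ge> \<sigma>\<^sub>0 / 2\<close> outside an event of probability of order \<open>n\<^sup>-\<^sup>6\<close>.
\<close>

section \<open>Coercive symmetric matrices\<close>

text \<open>Six is the first even exponent that works. A moment of order p of size
  \<open>n^p * D_M^(p/2)\<close>, compared with the threshold \<open>D_M / (2 * pi)\<close>, leaves
  a positive part of mean \<open>1 / n\<close> times \<open>D_M^(1 - p/2)\<close>: for p = 4 this is
  a harmonic series and costs a logarithm, for p = 6 it sums. The cube of \<open>D_M\<close> rests
  on the variance of the noise in a fixed direction, which is at most the bound on the density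
  whatever the dimension. In the constant 5 one unit is the room left for the martingale above the
  diagonal part; the factor 4 is the weight in Young's inequality that leaves a quarter of a squared
  empirical norm. The penalty carries the random norm of the inverse Gram matrix because this is the
  constant comparing the two norms on a model. Noise and penalty then share that factor, and the
  condition on \<open>\<kappa>\<close> is free of \<open>\<sigma>0\<close>. On exceptional samples
  the Gram matrix may be nearly singular and nothing bounds the raw estimator. The truncation caps
  the loss at order \<open>n^2\<close>, which the small probability of these samples
  outweighs.\<close>

lemma scalar_prod_self_nonneg: "0 \<le> scalar_prod x (x :: real vec)"
  unfolding scalar_prod_def by (intro sum_nonneg) auto

lemma scalar_prod_self_eq_0:
  assumes "x \<in> carrier_vec n" "scalar_prod x x = (0::real)"
  shows "x = 0\<^sub>v n"
proof -
  have "\<forall>i\<in>{0..<n}. x $ i * x $ i = 0"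
    using assms by (subst sum_nonneg_eq_0_iff[symmetric]) (auto simp: scalar_prod_def)
  thus ?thesis using assms(1) by (intro eq_vecI) auto
qed

lemma scalar_prod_self_pos:
  assumes "x \<in> carrier_vec n" "x \<noteq> 0\<^sub>v n"
  shows "0 < scalar_prod x (x :: real vec)"
  using scalar_prod_self_eq_0[of x n] scalar_prod_self_nonneg[of x] assms by force

lemma scalar_prod_Cauchy_Schwarz:
  assumes "x \<in> carrier_vec n" "y \<in> carrier_vec n"
  shows "(scalar_prod x (y :: real vec))\<^sup>2 \<le> scalar_prod x x * scalar_prod y y"
  using assms Cauchy_Schwarz_ineq_sum[of "\<lambda>i. x $ i" "\<lambda>i. y $ i" "{0..<n}"]
  by (simp add: scalar_prod_def power2_eq_square)

lemma mult_mat_vec_bounded: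
  fixes A :: "real mat"
  assumes A: "A \<in> carrier_mat n n"
  obtains C where "C > 0" "\<And>x. x \<in> carrier_vec n \<Longrightarrow> scalar_prod (A *\<^sub>v x) (A *\<^sub>v x) \<le> C * scalar_prod x x"
proof
  \<comment> \<open>One plus the squared Frobenius norm; the one keeps the constant positive for the
    zero matrix.\<close>
  let ?C = "1 + (\<Sum>i\<in>{0..<n}. scalar_prod (row A i) (row A i))"
  show "?C > 0" by (intro add_pos_nonneg sum_nonneg scalar_prod_self_nonneg) auto
  fix x :: "real vec" assume x: "x \<in> carrier_vec n"
  have "scalar_prod (A *\<^sub>v x) (A *\<^sub>v x) = (\<Sum>i\<in>{0..<n}. (scalar_prod (row A i) x)\<^sup>2)"
    using A by (simp add: scalar_prod_def[of "A *\<^sub>v x"] power2_eq_square)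
  also have "\<dots> \<le> (\<Sum>i\<in>{0..<n}. scalar_prod (row A i) (row A i) * scalar_prod x x)"
    using A x by (intro sum_mono scalar_prod_Cauchy_Schwarz[of _ n]) auto
  also have "\<dots> \<le> ?C * scalar_prod x x"
    using scalar_prod_self_nonneg[of x] by (simp add: ring_distribs flip: sum_distrib_right)
  finally show "scalar_prod (A *\<^sub>v x) (A *\<^sub>v x) \<le> ?C * scalar_prod x x" .
qed

lemma scalar_prod_2_le:
  assumes x: "x \<in> carrier_vec n" and y: "y \<in> carrier_vec n" and c: "c > 0"
  shows "2 * scalar_prod x (y :: real vec) \<le> c * scalar_prod x x + scalar_prod y y / c"
proof -
  have "2 * (x $ i * y $ i) \<le> c * (x $ i * x $ i) + y $ i * y $ i / c" for i
  proof -
    have "0 \<le> (c * x $ i - y $ i)\<^sup>2 / c" using c by simp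
    thus ?thesis using c by (simp add: power2_eq_square field_simps)
  qed
  hence "(\<Sum>i\<in>{0..<n}. 2 * (x $ i * y $ i)) \<le> (\<Sum>i\<in>{0..<n}. c * (x $ i * x $ i) + y $ i * y $ i / c)"
    by (intro sum_mono)
  thus ?thesis using x y by (simp add: scalar_prod_def sum.distrib sum_distrib_left sum_divide_distrib)
qed

text \<open>Testing positivity of \<open>H\<close> on \<open>x - H x / C\<close> replaces the spectral theorem.\<close>
lemma psd_mult_mat_vec_le:
  fixes H :: "real mat"
  assumes H: "H \<in> carrier_mat n n" and sym: "transpose_mat H = H"
    and psd: "\<And>x. x \<in> carrier_vec n \<Longrightarrow> scalar_prod x (H *\<^sub>v x) \<ge> 0"
  obtains C where "C > 0" "\<And>x. x \<in> carrier_vec n \<Longrightarrow> scalar_prod (H *\<^sub>v x) (H *\<^sub>v x) \<le> C * scalar_prod x (H *\<^sub>v x)"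
proof -
  obtain C where C: "C > 0"
    "\<And>x. x \<in> carrier_vec n \<Longrightarrow> scalar_prod (H *\<^sub>v x) (H *\<^sub>v x) \<le> C * scalar_prod x x"
    using mult_mat_vec_bounded[OF H] by blast
  \<comment> \<open>Young's inequality with weight 1 bounds twice the quadratic form of
    \<open>H\<close> by \<open>1 + C\<close> times the squared norm, hence the half.\<close>
  define C' where "C' = (1 + C) / 2"
  have C': "C' > 0" using C by (simp add: C'_def)
  have up: "scalar_prod y (H *\<^sub>v y) \<le> C' * scalar_prod y y" if y: "y \<in> carrier_vec n" for y
    using scalar_prod_2_le[of y n "H *\<^sub>v y" 1] C(2)[OF y] y H by (auto simp: C'_def field_simps)
  show ?thesis
  proof (rule that[OF C'])
    fix x :: "real vec" assume x: "x \<in> carrier_vec n"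
    let ?y = "H *\<^sub>v x"
    have y: "?y \<in> carrier_vec n" using H x by simp
    have Hy: "H *\<^sub>v ?y \<in> carrier_vec n" using H y by simp
    let ?z = "x - (1/C') \<cdot>\<^sub>v ?y"
    have z: "?z \<in> carrier_vec n" using x y by simp
    have Hz: "H *\<^sub>v ?z = ?y - (1/C') \<cdot>\<^sub>v (H *\<^sub>v ?y)"
      using H x y by (simp add: mult_minus_distrib_mat_vec mult_mat_vec)
    have sw: "scalar_prod x (H *\<^sub>v ?y) = scalar_prod ?y ?y"
      using transpose_vec_mult_scalar[OF H y x] H x y Hy sym
      by (metis comm_scalar_prod)
    have "0 \<le> scalar_prod ?z (H *\<^sub>v ?z)" by (rule psd[OF z])
    also have "\<dots> = scalar_prod x ?y - 2 / C' * scalar_prod ?y ?y + (1/C')\<^sup>2 * scalar_prod ?y (H *\<^sub>v ?y)"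
      unfolding Hz using x y Hy sw
      by (simp add: minus_scalar_prod_distrib[of _ n] scalar_prod_minus_distrib[of _ n] power2_eq_square algebra_simps)
    also have "\<dots> \<le> scalar_prod x ?y - 2 / C' * scalar_prod ?y ?y + (1/C')\<^sup>2 * (C' * scalar_prod ?y ?y)"
      by (intro add_left_mono mult_left_mono up y) auto
    finally show "scalar_prod ?y ?y \<le> C' * scalar_prod x ?y"
      using C' by (simp add: power2_eq_square field_simps)
  qed
qed

text \<open>No compactness is used. Let \<open>\<mu>\<close> be the infimum of the Rayleigh
  quotients, so that \<open>H = G - \<mu> I\<close> is positive semidefinite. If \<open>H\<close>
  were invertible, the squared norm of \<open>H x\<close> would dominate that of \<open>x\<close>,
  and by \<open>psd_mult_mat_vec_le\<close> so would the form of \<open>H\<close>; every quotient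
  would then exceed \<open>\<mu>\<close> by a fixed amount. Hence \<open>H\<close> is singular, and
  a kernel vector is the eigenvector.\<close>

lemma symmetric_min_eigenvalue:
  fixes G :: "real mat"
  assumes G: "G \<in> carrier_mat n n" and sym: "transpose_mat G = G" and n: "n > 0"
    and low: "\<And>x. x \<in> carrier_vec n \<Longrightarrow> scalar_prod x (G *\<^sub>v x) \<ge> s * scalar_prod x x"
  obtains \<mu> v where "\<mu> \<ge> s" "v \<in> carrier_vec n" "v \<noteq> 0\<^sub>v n" "G *\<^sub>v v = \<mu> \<cdot>\<^sub>v v"
    "\<And>x. x \<in> carrier_vec n \<Longrightarrow> scalar_prod x (G *\<^sub>v x) \<ge> \<mu> * scalar_prod x x"
proof -
  define R where "R = (\<lambda>x. scalar_prod x (G *\<^sub>v x) / scalar_prod x x) ` (carrier_vec n - {0\<^sub>v n})"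
  define \<mu> where "\<mu> = Inf R"
  have ne: "R \<noteq> {}"
  proof -
    have "unit_vec n 0 \<in> carrier_vec n - {0\<^sub>v n :: real vec}" using n by simp
    thus ?thesis unfolding R_def by blast
  qed
  have lb: "s \<le> r" if r: "r \<in> R" for r
  proof -
    obtain x where x: "x \<in> carrier_vec n" "x \<noteq> 0\<^sub>v n" "r = scalar_prod x (G *\<^sub>v x) / scalar_prod x x"
      using r by (auto simp: R_def)
    thus ?thesis using low[OF x(1)] scalar_prod_self_pos[OF x(1,2)] by (simp add: pos_le_divide_eq)
  qed
  hence bb: "bdd_below R" by (auto simp: bdd_below_def)
  have mu: "\<mu> \<ge> s" unfolding \<mu>_def using ne lb by (rule cInf_greatest)
  have mulow: "scalar_prod x (G *\<^sub>v x) \<ge> \<mu> * scalar_prod x x" if x: "x \<in> carrier_vec n" for x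
  proof (cases "x = 0\<^sub>v n")
    case False
    hence "\<mu> \<le> scalar_prod x (G *\<^sub>v x) / scalar_prod x x"
      unfolding \<mu>_def using x by (intro cInf_lower bb) (auto simp: R_def)
    thus ?thesis using scalar_prod_self_pos[OF x False] by (simp add: field_simps)
  qed (use G in auto)
  define H where "H = G - \<mu> \<cdot>\<^sub>m 1\<^sub>m n"
  have H: "H \<in> carrier_mat n n" unfolding H_def by (intro minus_carrier_mat) auto
  have Hv: "H *\<^sub>v x = G *\<^sub>v x - \<mu> \<cdot>\<^sub>v x" if "x \<in> carrier_vec n" for x
    using G that unfolding H_def by (subst minus_mult_distrib_mat_vec[of _ n n]) auto
  have Hq: "scalar_prod x (H *\<^sub>v x) = scalar_prod x (G *\<^sub>v x) - \<mu> * scalar_prod x x" if "x \<in> carrier_vec n" for x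
    using that G by (simp add: Hv scalar_prod_minus_distrib[of _ n])
  have Hsym: "transpose_mat H = H"
    using G sym unfolding H_def by (intro eq_matI) (auto simp: mat_eq_iff)
  obtain C where C: "C > 0" "\<And>x. x \<in> carrier_vec n \<Longrightarrow> scalar_prod (H *\<^sub>v x) (H *\<^sub>v x) \<le> C * scalar_prod x (H *\<^sub>v x)"
    using psd_mult_mat_vec_le[OF H Hsym] Hq mulow by (metis diff_ge_0_iff_ge)
  have "det H = 0"
  proof (rule ccontr)
    assume "det H \<noteq> 0"
    from det_non_zero_imp_unit[OF H this, of "()"] obtain K where
      K: "K \<in> carrier_mat n n" "K * H = 1\<^sub>m n"
      unfolding Units_def by (auto simp: ring_mat_def)
    obtain C2 where C2: "C2 > 0" "\<And>x. x \<in> carrier_vec n \<Longrightarrow> scalar_prod (K *\<^sub>v x) (K *\<^sub>v x) \<le> C2 * scalar_prod x x"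
      using mult_mat_vec_bounded[OF K(1)] by blast
    have "\<mu> + 1 / (C2 * C) \<le> r" if r: "r \<in> R" for r
    proof -
      obtain x where x: "x \<in> carrier_vec n" "x \<noteq> 0\<^sub>v n" "r = scalar_prod x (G *\<^sub>v x) / scalar_prod x x"
        using r by (auto simp: R_def)
      have "K *\<^sub>v (H *\<^sub>v x) = x"
        using K H x by (simp flip: assoc_mult_mat_vec)
      hence "scalar_prod x x \<le> C2 * scalar_prod (H *\<^sub>v x) (H *\<^sub>v x)"
        using C2(2)[of "H *\<^sub>v x"] H x by simp
      also have "\<dots> \<le> C2 * (C * scalar_prod x (H *\<^sub>v x))"
        using C2(1) C(2)[OF x(1)] by simp
      finally have "scalar_prod x x \<le> C2 * C * (scalar_prod x (G *\<^sub>v x) - \<mu> * scalar_prod x x)"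
        using Hq[OF x(1)] by simp
      hence "scalar_prod x x / (C2 * C) \<le> scalar_prod x (G *\<^sub>v x) - \<mu> * scalar_prod x x"
        using C2(1) C(1) by (simp add: field_simps)
      thus ?thesis using scalar_prod_self_pos[OF x(1,2)] x(3)
        by (simp add: pos_le_divide_eq distrib_right)
    qed
    hence "\<mu> + 1 / (C2 * C) \<le> \<mu>" unfolding \<mu>_def using ne by (intro cInf_greatest)
    moreover have "1 / (C2 * C) > 0" using C C2 by simp
    ultimately show False by linarith
  qed
  then obtain v where v: "v \<in> carrier_vec n" "v \<noteq> 0\<^sub>v n" "H *\<^sub>v v = 0\<^sub>v n"
    using det_0_iff_vec_prod_zero[OF H] by blast
  have "G *\<^sub>v v - \<mu> \<cdot>\<^sub>v v = 0\<^sub>v n" using v Hv by simp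
  hence "G *\<^sub>v v = \<mu> \<cdot>\<^sub>v v"
    using G v(1) by (intro eq_vecI) (auto simp: vec_eq_iff)
  with that[OF mu v(1,2)] mulow show ?thesis by blast
qed

section \<open>The inverse of a coercive matrix and its operator norm\<close>

context
  fixes G :: "real mat" and n :: nat and s :: real
  assumes G: "G \<in> carrier_mat n n" and sym: "transpose_mat G = G" and n: "n > 0" and s: "s > 0"
    and low: "\<And>x. x \<in> carrier_vec n \<Longrightarrow> scalar_prod x (G *\<^sub>v x) \<ge> s * scalar_prod x x"
begin

text \<open>Coercivity rules out a kernel, so the zero-matrix default of \<open>minv\<close> is
  never reached.\<close>

lemma coercive_minv:
  shows "minv G \<in> carrier_mat n n" "G * minv G = 1\<^sub>m n" "minv G * G = 1\<^sub>m n"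
proof -
  have "det G \<noteq> 0"
  proof
    assume "det G = 0"
    then obtain v where v: "v \<in> carrier_vec n" "v \<noteq> 0\<^sub>v n" "G *\<^sub>v v = 0\<^sub>v n"
      using det_0_iff_vec_prod_zero[OF G] by blast
    have "s * scalar_prod v v \<le> 0" using low[OF v(1)] v by simp
    thus False using scalar_prod_self_pos[OF v(1,2)] s by (simp add: mult_le_0_iff)
  qed
  hence "mat_inverse G \<noteq> None"
    using mat_inverse(1)[OF G, of "()"] det_non_zero_imp_unit[OF G, of "()"] by blast
  then obtain B where B: "mat_inverse G = Some B" by blast
  show "minv G \<in> carrier_mat n n" "G * minv G = 1\<^sub>m n" "minv G * G = 1\<^sub>m n"
    using mat_inverse(2)[OF G B] B by (auto simp: minv_def)
qed

text \<open>The smallest eigenvalue \<open>\<mu>\<close> of \<open>G\<close> produces the eigenvalue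
  \<open>1 / \<mu>\<^sup>2\<close> of \<open>transpose_mat A * A\<close>, which bounds
  \<open>opnorm\<close> from below by \<open>1 / \<mu>\<close>; that direction yields the second
  claim. It converts norms by the very factor occurring in the penalty, instead of the cruder
  \<open>1 / s\<close>.\<close>

lemma coercive_opnorm_minv:
  shows "opnorm (minv G) \<le> 1 / s"
    and "x \<in> carrier_vec n \<Longrightarrow> scalar_prod x x \<le> opnorm (minv G) * scalar_prod x (G *\<^sub>v x)"
proof -
  define A where "A = minv G"
  note A = coercive_minv[folded A_def]
  define T where "T = transpose_mat A * A"
  have T: "T \<in> carrier_mat n n" using A by (simp add: T_def)
  have Asym: "transpose_mat A = A"
  proof -
    have "transpose_mat (A * G) = 1\<^sub>m n" using A by simp
    hence 1: "G * transpose_mat A = 1\<^sub>m n" using transpose_mult[OF A(1) G] sym by simp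
    have "transpose_mat A = (A * G) * transpose_mat A" using A by simp
    also have "\<dots> = A * (G * transpose_mat A)" using A G by (intro assoc_mult_mat) auto
    also have "\<dots> = A" using 1 A by simp
    finally show ?thesis .
  qed
  obtain \<mu> v where mv: "\<mu> \<ge> s" "v \<in> carrier_vec n" "v \<noteq> 0\<^sub>v n" "G *\<^sub>v v = \<mu> \<cdot>\<^sub>v v"
    and mulow: "\<And>x. x \<in> carrier_vec n \<Longrightarrow> scalar_prod x (G *\<^sub>v x) \<ge> \<mu> * scalar_prod x x"
    using symmetric_min_eigenvalue[OF G sym n low] by blast
  have mupos: "\<mu> > 0" using mv s by simp
  have AGv: "A *\<^sub>v (G *\<^sub>v x) = x" if "x \<in> carrier_vec n" for x
    using that A G by (simp flip: assoc_mult_mat_vec)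
  have Av: "A *\<^sub>v v = (1/\<mu>) \<cdot>\<^sub>v v"
  proof -
    have "\<mu> \<cdot>\<^sub>v (A *\<^sub>v v) = v"
      using AGv[OF mv(2)] mv A by (simp add: mult_mat_vec)
    hence "(1/\<mu>) \<cdot>\<^sub>v (\<mu> \<cdot>\<^sub>v (A *\<^sub>v v)) = (1/\<mu>) \<cdot>\<^sub>v v" by simp
    thus ?thesis using mupos by (simp add: smult_smult_assoc)
  qed
  have "T *\<^sub>v v = A *\<^sub>v (A *\<^sub>v v)"
    unfolding T_def Asym using A mv by (intro assoc_mult_mat_vec) auto
  also have "\<dots> = (1/\<mu>\<^sup>2) \<cdot>\<^sub>v v"
    using Av A mv by (simp add: mult_mat_vec smult_smult_assoc power2_eq_square)
  finally have ev: "eigenvalue T (1/\<mu>\<^sup>2)"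
    unfolding eigenvalue_def eigenvector_def using mv T by auto
  \<comment> \<open>\<open>Max\<close> in \<open>opnorm\<close> says something only for a finite
    nonempty set; the eigenvalues are roots of the monic characteristic polynomial.\<close>
  have fin: "finite {k. eigenvalue T k}"
  proof -
    have "char_poly T \<noteq> 0" using degree_monic_char_poly[OF T] by auto
    thus ?thesis unfolding eigenvalue_root_char_poly[OF T] by (rule poly_roots_finite)
  qed
  \<comment> \<open>With \<open>y = A w\<close> the eigenvalue equation becomes
    \<open>k |w|^2 = |y|^2\<close>, and \<open>G y = w\<close> with coercivity gives
    \<open>s^2 |y|^2 \<le> |w|^2\<close>.\<close>
  have up: "k \<le> (1/s)\<^sup>2" if k: "eigenvalue T k" for k
  proof -
    obtain w where w: "w \<in> carrier_vec n" "w \<noteq> 0\<^sub>v n" "T *\<^sub>v w = k \<cdot>\<^sub>v w"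
      using k T unfolding eigenvalue_def eigenvector_def by auto
    define y where "y = A *\<^sub>v w"
    have y: "y \<in> carrier_vec n" using A w by (simp add: y_def)
    have Gy: "G *\<^sub>v y = w" unfolding y_def using A G w by (simp flip: assoc_mult_mat_vec)
    have "T *\<^sub>v w = A *\<^sub>v y" unfolding T_def Asym y_def using A w by (intro assoc_mult_mat_vec) auto
    hence "A *\<^sub>v y = k \<cdot>\<^sub>v w" using w by simp
    hence "k * scalar_prod w w = scalar_prod (A *\<^sub>v y) w" using w by simp
    also have "\<dots> = scalar_prod y y"
      using transpose_vec_mult_scalar[OF A(1) w(1) y] Asym y_def y A w
      by (metis comm_scalar_prod mult_mat_vec_carrier)
    finally have 1: "k * scalar_prod w w = scalar_prod y y" .
    have "2 * (s * scalar_prod y y) \<le> 2 * scalar_prod y w"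
      using low[OF y] Gy by simp
    also have "\<dots> \<le> s * scalar_prod y y + scalar_prod w w / s"
      by (rule scalar_prod_2_le[OF y w(1) s])
    finally have "scalar_prod y y \<le> scalar_prod w w * (1/s)\<^sup>2"
      using s by (simp add: field_simps power2_eq_square)
    hence "k * scalar_prod w w \<le> (1/s)\<^sup>2 * scalar_prod w w" using 1 by (simp add: mult.commute)
    thus ?thesis using scalar_prod_self_pos[OF w(1,2)] by (rule mult_right_le_imp_le)
  qed
  have ne: "{k. eigenvalue T k} \<noteq> {}" using ev by blast
  have "Max {k. eigenvalue T k} \<le> (1/s)\<^sup>2" using up Max_in[OF fin ne] by blast
  hence "sqrt (Max {k. eigenvalue T k}) \<le> sqrt ((1/s)\<^sup>2)" by (rule real_sqrt_le_mono)
  thus "opnorm (minv G) \<le> 1/s" using s by (simp add: opnorm_def T_def A_def)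
  have "1/\<mu>\<^sup>2 \<le> Max {k. eigenvalue T k}" using ev fin by simp
  hence "sqrt ((1/\<mu>)\<^sup>2) \<le> sqrt (Max {k. eigenvalue T k})"
    by (intro real_sqrt_le_mono) (simp add: power_divide)
  hence op: "1/\<mu> \<le> opnorm (minv G)" using mupos by (simp add: opnorm_def T_def A_def)
  assume x: "x \<in> carrier_vec n"
  have "scalar_prod x x \<le> 1/\<mu> * scalar_prod x (G *\<^sub>v x)"
    using mulow[OF x] mupos by (simp add: field_simps)
  also have "\<dots> \<le> opnorm (minv G) * scalar_prod x (G *\<^sub>v x)"
  proof (rule mult_right_mono[OF op])
    show "0 \<le> scalar_prod x (G *\<^sub>v x)"
      using mulow[OF x] mupos scalar_prod_self_nonneg[of x] by (meson mult_nonneg_nonneg order.trans less_imp_le)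
  qed
  finally show "scalar_prod x x \<le> opnorm (minv G) * scalar_prod x (G *\<^sub>v x)" .
qed

end

section \<open>Sixth moment of a degenerate quadratic statistic\<close>

text \<open>The linear term stays exact, because it will vanish in the mean; the other mixed terms
  are pushed by AM-GM to the two extremes \<open>M^4 * d^2\<close> and \<open>d^6\<close>. The
  coefficients add up to 39 and 18, rounded up to 40.\<close>

lemma sixth_power_add_le:
  fixes M d :: real
  shows "(M + d)^6 \<le> M^6 + 6 * M^5 * d + 40 * (M^4 * d\<^sup>2 + d^6)"
proof -
  have a: "2 * (M^3 * d^3) \<le> M^4 * d^2 + M^2 * d^4"
  proof -
    have "0 \<le> (M * d * (M - d))\<^sup>2" by simp
    thus ?thesis by (simp add: algebra_simps power2_eq_square power4_eq_xxxx power3_eq_cube)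
  qed
  have b: "2 * (M * d^5) \<le> M^2 * d^4 + d^6"
  proof -
    have "0 \<le> (d^2 * (M - d))\<^sup>2" by simp
    thus ?thesis by (simp add: algebra_simps power2_eq_square eval_nat_numeral)
  qed
  have c: "2 * (M^2 * d^4) \<le> M^4 * d^2 + d^6"
  proof -
    have "0 \<le> (d * (M^2 - d^2))\<^sup>2" by simp
    thus ?thesis by (simp add: algebra_simps power2_eq_square eval_nat_numeral)
  qed
  have "(M + d)^6 = M^6 + 6 * M^5 * d + 15 * (M^4 * d^2) + 20 * (M^3 * d^3) + 15 * (M^2 * d^4) + 6 * (M * d^5) + d^6"
    by (simp add: algebra_simps eval_nat_numeral)
  also have "\<dots> \<le> M^6 + 6 * M^5 * d + 40 * (M^4 * d\<^sup>2 + d^6)"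
  proof -
    have aux: "15 * p + 20 * r + 15 * q + 6 * t + u \<le> 40 * (p + u)"
      if "2 * r \<le> p + q" "2 * t \<le> q + u" "2 * q \<le> p + u" "0 \<le> p" "0 \<le> u" for p q r t u :: real
      using that by simp
    show ?thesis using aux[OF a b c] by simp
  qed
  finally show ?thesis .
qed

lemma square_mult_le_cubes:
  fixes x y :: real
  assumes "x \<ge> 0" "y \<ge> 0"
  shows "x\<^sup>2 * y \<le> x^3 + y^3"
proof (cases "y \<le> x")
  case True
  hence "x\<^sup>2 * y \<le> x\<^sup>2 * x" by (intro mult_left_mono) auto
  also have "\<dots> \<le> x^3 + y^3" using assms by (simp add: power2_eq_square power3_eq_cube[of x])
  finally show ?thesis .
next
  case False
  hence "x\<^sup>2 * y \<le> y\<^sup>2 * y" using assms by (intro mult_right_mono power_mono) auto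
  also have "\<dots> \<le> x^3 + y^3" using assms by (simp add: power2_eq_square power3_eq_cube[of y])
  finally show ?thesis .
qed

lemma cube_add_le:
  fixes x y :: real
  assumes "x \<ge> 0" "y \<ge> 0"
  shows "(x + y)^3 \<le> 4 * (x^3 + y^3)"
proof -
  have "4 * (x^3 + y^3) - (x + y)^3 = 3 * (x + y) * (x - y)\<^sup>2"
    by (simp add: power2_eq_square power3_eq_cube algebra_simps)
  moreover have "\<dots> \<ge> 0" using assms by simp
  ultimately show ?thesis by linarith
qed

text \<open>Meant for \<open>M\<close> the off-diagonal part so far and \<open>q\<close> the squared
  norm of the partial sum so far. The right-hand side is \<open>1 / n\<close> times the very
  quantity being propagated, a gain that stays bounded over n iterations.\<close>

lemma moment_step_fourth:
  fixes M n B q :: real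
  assumes n: "n \<ge> 1" and B: "B \<ge> 1" and q: "q \<le> n * B + \<bar>M\<bar>"
  shows "M^4 * q \<le> 2 / n * (M^6 + n^6 * B^3)"
proof -
  have 1: "M^4 * (n\<^sup>2 * B) \<le> M^6 + n^6 * B^3"
    using square_mult_le_cubes[of "M\<^sup>2" "n\<^sup>2 * B"] n B by (simp add: power_mult_distrib flip: power_mult)
  have 2: "M^4 * (n * \<bar>M\<bar>) \<le> M^6 + n^6 * B^3"
  proof -
    have "2 * (n * \<bar>M\<bar>) \<le> n\<^sup>2 + M\<^sup>2"
      using zero_le_power2[of "n - \<bar>M\<bar>"] by (simp add: power2_diff)
    hence "M^4 * (2 * (n * \<bar>M\<bar>)) \<le> M^4 * (n\<^sup>2 + M\<^sup>2)" by (intro mult_left_mono) auto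
    also have "\<dots> = M^4 * n\<^sup>2 + M^6" by (simp add: algebra_simps flip: power_add)
    also have "M^4 * n\<^sup>2 \<le> M^4 * (n\<^sup>2 * B)" using B n by (intro mult_left_mono) auto
    also note 1
    finally have "M^4 * (2 * (n * \<bar>M\<bar>)) \<le> 2 * M^6 + n^6 * B^3" by simp
    moreover have "0 \<le> n^6 * B^3" using n B by simp
    ultimately show ?thesis by simp
  qed
  have "n * (M^4 * q) \<le> n * (M^4 * (n * B + \<bar>M\<bar>))"
    using q n by (intro mult_left_mono) auto
  also have "\<dots> = M^4 * (n\<^sup>2 * B) + M^4 * (n * \<bar>M\<bar>)" by (simp add: algebra_simps power2_eq_square)
  also have "\<dots> \<le> 2 * (M^6 + n^6 * B^3)" using 1 2 by simp
  finally show ?thesis using n by (simp add: field_simps)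
qed

text \<open>The hypothesis \<open>B \<le> n\<close> absorbs the excess powers of \<open>B\<close>:
  the pure term \<open>n^4 * B^5\<close> is at most \<open>n^6 * B^3\<close>, and the cross term
  splits into \<open>M^6\<close> and \<open>n^2 * B^4\<close>, the latter at most
  \<open>n^3 * B^3\<close>.\<close>

lemma moment_step_sixth:
  fixes M n B q :: real
  assumes n: "n \<ge> 1" and B: "B \<ge> 1" "B \<le> n" and q: "0 \<le> q" "q \<le> n * B + \<bar>M\<bar>"
  shows "B\<^sup>2 * q^3 \<le> 8 / n * (M^6 + n^6 * B^3)"
proof -
  have nB: "0 \<le> n * B" using n B by simp
  have "q^3 \<le> (n * B + \<bar>M\<bar>)^3" using q by (intro power_mono) auto
  also have "\<dots> \<le> 4 * ((n * B)^3 + \<bar>M\<bar>^3)"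
    using nB by (intro cube_add_le) auto
  finally have "n * B\<^sup>2 * q^3 \<le> n * B\<^sup>2 * (4 * ((n * B)^3 + \<bar>M\<bar>^3))"
    using n by (intro mult_left_mono) auto
  also have "\<dots> = 4 * (n^4 * B^3 * B\<^sup>2) + 4 * ((n * B\<^sup>2) * \<bar>M\<bar>^3)"
    by (simp add: algebra_simps power_mult_distrib eval_nat_numeral)
  also have "\<dots> \<le> 4 * (n^4 * B^3 * n\<^sup>2) + 4 * (n^6 * B^3 + M^6)"
  proof (intro add_mono mult_left_mono)
    have "2 * ((n * B\<^sup>2) * \<bar>M\<bar>^3) \<le> (n * B\<^sup>2)\<^sup>2 + (\<bar>M\<bar>^3)\<^sup>2"
      using zero_le_power2[of "n * B\<^sup>2 - \<bar>M\<bar>^3"] by (simp add: power2_diff)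
    also have "(\<bar>M\<bar>^3)\<^sup>2 = M^6" by (simp add: power_even_abs flip: power_mult)
    also have "(n * B\<^sup>2)\<^sup>2 = n\<^sup>2 * B * B^3" by (simp add: power_mult_distrib eval_nat_numeral)
    also have "\<dots> \<le> n\<^sup>2 * n * B^3" using B n by (intro mult_right_mono mult_left_mono) auto
    also have "\<dots> = n^3 * B^3" by (simp add: eval_nat_numeral)
    also have "\<dots> \<le> n^6 * B^3" using B n by (intro mult_right_mono power_increasing) auto
    finally have "2 * (n * B\<^sup>2 * \<bar>M\<bar>^3) \<le> n^6 * B^3 + M^6" by simp
    moreover have "0 \<le> n * B\<^sup>2 * \<bar>M\<bar>^3" using n by simp
    ultimately show "n * B\<^sup>2 * \<bar>M\<bar>^3 \<le> n^6 * B^3 + M^6" by linarith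
  qed (use n B in \<open>auto intro!: power_mono\<close>)
  also have "\<dots> \<le> 8 * (M^6 + n^6 * B^3)"
    by (simp add: algebra_simps flip: power_add)
  finally show ?thesis using n by (simp add: field_simps)
qed

text \<open>Twice the sum of the inner products of \<open>Y (\<omega> i)\<close> and
  \<open>Y (\<omega> j)\<close> over i < j: a degenerate U-statistic when the \<open>Y\<close> are
  centred. Written as a difference, it needs no sum over pairs.\<close>

definition offdiag :: "nat set \<Rightarrow> ('a \<Rightarrow> nat \<Rightarrow> real) \<Rightarrow> nat \<Rightarrow> (nat \<Rightarrow> 'a) \<Rightarrow> real" where
  "offdiag I Y n \<omega> = (\<Sum>l\<in>I. (\<Sum>i<n. Y (\<omega> i) l)\<^sup>2) - (\<Sum>i<n. \<Sum>l\<in>I. (Y (\<omega> i) l)\<^sup>2)"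

text \<open>The increment is linear in the new observation, with the past partial sum as coefficient
  vector; this is the martingale property in algebraic form. The update \<open>fun_upd\<close>
  matches the splitting of a product measure into its last coordinate and the rest.\<close>

lemma offdiag_Suc:
  "offdiag I Y (Suc k) (fun_upd \<omega> k y) =
   offdiag I Y k \<omega> + 2 * (\<Sum>l\<in>I. Y y l * (\<Sum>i<k. Y (\<omega> i) l))"
proof -
  have "(\<Sum>i<Suc k. Y ((fun_upd \<omega> k y) i) l) = (\<Sum>i<k. Y (\<omega> i) l) + Y y l" for l
    by simp
  moreover have "(\<Sum>i<Suc k. \<Sum>l\<in>I. (Y ((fun_upd \<omega> k y) i) l)\<^sup>2) = (\<Sum>i<k. \<Sum>l\<in>I. (Y (\<omega> i) l)\<^sup>2) + (\<Sum>l\<in>I. (Y y l)\<^sup>2)"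
    by simp
  ultimately show ?thesis
    unfolding offdiag_def
    by (simp add: power2_sum sum.distrib algebra_simps sum_distrib_left)
qed

text \<open>This closes the recursion: the squared norm of the past, which sets the size of the next
  increment, is controlled by the statistic itself.\<close>

lemma sum_squares_le_offdiag:
  assumes "\<And>i. i < n \<Longrightarrow> (\<Sum>l\<in>I. (Y (\<omega> i) l)\<^sup>2) \<le> B"
  shows "(\<Sum>l\<in>I. (\<Sum>i<n. Y (\<omega> i) l)\<^sup>2) \<le> real n * B + offdiag I Y n \<omega>"
proof -
  have "(\<Sum>i<n. \<Sum>l\<in>I. (Y (\<omega> i) l)\<^sup>2) \<le> (\<Sum>i<n. B)"
    using assms by (intro sum_mono) auto
  thus ?thesis by (simp add: offdiag_def)
qed

lemma offdiag_measurable: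
  assumes I: "finite I" and Y: "\<And>l. l \<in> I \<Longrightarrow> (\<lambda>y. Y y l) \<in> borel_measurable P"
  shows "offdiag I Y k \<in> borel_measurable (PiM {..<k} (\<lambda>_. P))"
proof -
  have 1: "(\<lambda>\<omega>. Y (\<omega> i) l) \<in> borel_measurable (PiM {..<k} (\<lambda>_. P))" if "i < k" "l \<in> I" for i l
    using that by (intro measurable_compose[OF measurable_component_singleton[of i] Y]) auto
  show ?thesis
    unfolding offdiag_def[abs_def]
    by (intro borel_measurable_diff borel_measurable_sum borel_measurable_power 1) auto
qed

text \<open>The past is frozen in \<open>N\<close> and \<open>r\<close>, and only the new
  observation is integrated. Adding \<open>n^6 * B^3\<close> to the sixth power makes the recursion
  purely multiplicative. The constant is 20800 = 160 * 2 + 2560 * 8.\<close>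

lemma (in prob_space) sixth_moment_step:
  fixes Y :: "'a \<Rightarrow> nat \<Rightarrow> real" and r :: "nat \<Rightarrow> real"
  assumes I: "finite I" and n: "n \<ge> 1" and B: "1 \<le> B" "B \<le> n" and v: "v \<ge> 0"
    and Y [measurable]: "\<And>l. l \<in> I \<Longrightarrow> (\<lambda>y. Y y l) \<in> borel_measurable M"
    and bound: "\<And>y. y \<in> space M \<Longrightarrow> (\<Sum>l\<in>I. (Y y l)\<^sup>2) \<le> B"
    and mean: "\<And>l. l \<in> I \<Longrightarrow> expectation (\<lambda>y. Y y l) = 0"
    and var: "\<And>r. expectation (\<lambda>y. (\<Sum>l\<in>I. Y y l * r l)\<^sup>2) \<le> v * (\<Sum>l\<in>I. (r l)\<^sup>2)"
    and q: "(\<Sum>l\<in>I. (r l)\<^sup>2) \<le> n * B + \<bar>N\<bar>"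
  shows "(\<integral>\<^sup>+y. ennreal ((N + 2 * (\<Sum>l\<in>I. Y y l * r l))^6 + n^6 * B^3) \<partial>M)
    \<le> ennreal ((1 + 20800 * v / n) * (N^6 + n^6 * B^3))"
proof -
  define q where "q = (\<Sum>l\<in>I. (r l)\<^sup>2)"
  define e where "e y = (\<Sum>l\<in>I. Y y l * r l)" for y
  have q0: "q \<ge> 0" unfolding q_def by (intro sum_nonneg) auto
  have e_meas [measurable]: "e \<in> borel_measurable M"
    unfolding e_def[abs_def] by (intro borel_measurable_sum borel_measurable_times Y) auto
  have e2: "(e y)\<^sup>2 \<le> B * q" if "y \<in> space M" for y
  proof -
    have "(e y)\<^sup>2 \<le> (\<Sum>l\<in>I. (Y y l)\<^sup>2) * q"
      unfolding e_def q_def by (rule Cauchy_Schwarz_ineq_sum)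
    also have "\<dots> \<le> B * q" using bound[OF that] q0 by (intro mult_right_mono)
    finally show ?thesis .
  qed
  have Yb: "\<bar>Y y l\<bar> \<le> sqrt B" if "y \<in> space M" "l \<in> I" for y l
  proof -
    have "(Y y l)\<^sup>2 \<le> (\<Sum>l\<in>I. (Y y l)\<^sup>2)" using that I by (intro member_le_sum) auto
    also have "\<dots> \<le> B" by (rule bound[OF that(1)])
    finally show ?thesis using real_le_rsqrt[of "\<bar>Y y l\<bar>" B] by simp
  qed
  have iY: "integrable M (\<lambda>y. Y y l)" if "l \<in> I" for l
    using that Yb by (intro integrable_const_bound[of _ "sqrt B"] AE_I2 Y) auto
  have ie: "integrable M e" unfolding e_def[abs_def] using iY by (intro Bochner_Integration.integrable_sum) auto
  have Ee: "expectation e = 0"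
    unfolding e_def[abs_def] using iY mean by (subst Bochner_Integration.integral_sum) auto
  have ie2: "integrable M (\<lambda>y. (e y)\<^sup>2)"
    using e2 by (intro integrable_const_bound[of _ "B * q"] AE_I2) auto
  have Ee2: "expectation (\<lambda>y. (e y)\<^sup>2) \<le> v * q"
    using var[of r] by (simp add: e_def q_def)
  let ?c = "n^6 * B^3"
  \<comment> \<open>\<open>sixth_power_add_le\<close> with \<open>d = 2 * e y\<close>: 12 = 6 * 2,
    160 = 40 * 2^2 and 2560 = 40 * 2^6.\<close>
  define g where "g y = (N^6 + ?c) + 12 * N^5 * e y + (160 * N^4 + 2560 * (B\<^sup>2 * q\<^sup>2)) * (e y)\<^sup>2" for y
  have pt: "(N + 2 * e y)^6 + ?c \<le> g y" if "y \<in> space M" for y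
  proof -
    \<comment> \<open>Four of the six factors are bounded by the sup norm, two are kept for the
      variance, which carries no dimension.\<close>
    have "(e y)^6 = ((e y)\<^sup>2)\<^sup>2 * (e y)\<^sup>2" by (simp flip: power_mult power_add)
    also have "\<dots> \<le> (B * q)\<^sup>2 * (e y)\<^sup>2" using e2[OF that] by (intro mult_right_mono power_mono) auto
    finally have "(e y)^6 \<le> B\<^sup>2 * q\<^sup>2 * (e y)\<^sup>2" by (simp add: power_mult_distrib)
    thus ?thesis using sixth_power_add_le[of N "2 * e y"] unfolding g_def
      by (simp add: power_mult_distrib algebra_simps)
  qed
  have ig: "integrable M g" unfolding g_def[abs_def] using ie ie2 by auto
  have "(\<integral>\<^sup>+y. ennreal ((N + 2 * e y)^6 + ?c) \<partial>M) \<le> (\<integral>\<^sup>+y. ennreal (g y) \<partial>M)"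
    using pt by (intro nn_integral_mono ennreal_leI) auto
  also have "\<dots> = ennreal (expectation g)"
  proof (rule nn_integral_eq_integral[OF ig AE_I2])
    fix y assume y: "y \<in> space M"
    have "0 \<le> (N + 2 * e y)^6 + ?c" using n B by simp
    thus "0 \<le> g y" using pt[OF y] by simp
  qed
  also have "expectation g = (N^6 + ?c) + (160 * N^4 + 2560 * (B\<^sup>2 * q\<^sup>2)) * expectation (\<lambda>y. (e y)\<^sup>2)"
    unfolding g_def[abs_def] using ie ie2 Ee by (simp add: prob_space)
  also have "\<dots> \<le> (N^6 + ?c) + (160 * N^4 + 2560 * (B\<^sup>2 * q\<^sup>2)) * (v * q)"
    using Ee2 by (intro add_left_mono mult_left_mono) auto
  also have "\<dots> = (N^6 + ?c) + v * (160 * (N^4 * q) + 2560 * (B\<^sup>2 * q^3))"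
    by (simp add: algebra_simps power2_eq_square power3_eq_cube)
  also have "\<dots> \<le> (N^6 + ?c) + v * (160 * (2 / n * (N^6 + ?c)) + 2560 * (8 / n * (N^6 + ?c)))"
    using moment_step_fourth[OF n B(1) q] moment_step_sixth[OF n B q0[unfolded q_def] q] v
    by (intro add_left_mono mult_left_mono add_mono) (auto simp: q_def)
  also have "\<dots> = (1 + 20800 * v / n) * (N^6 + ?c)"
    using n by (simp add: field_simps)
  finally show ?thesis by (simp add: e_def ennreal_leI)
qed

text \<open>Fubini over the last coordinate yields a factor \<open>1 + 20800 * v / n\<close> per
  observation, and n of them multiply to at most \<open>exp (20800 * v)\<close>. The added
  \<open>n^6 * B^3\<close> is the starting value at the empty sample and sets the scale of the
  result.\<close>

lemma (in prob_space) offdiag_sixth_moment: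
  fixes Y :: "'a \<Rightarrow> nat \<Rightarrow> real" and n :: nat
  assumes I: "finite I" and n: "n \<ge> 1" and B: "1 \<le> B" "B \<le> real n" and v: "v \<ge> 0"
    and Y [measurable]: "\<And>l. l \<in> I \<Longrightarrow> (\<lambda>y. Y y l) \<in> borel_measurable M"
    and bound: "\<And>y. y \<in> space M \<Longrightarrow> (\<Sum>l\<in>I. (Y y l)\<^sup>2) \<le> B"
    and mean: "\<And>l. l \<in> I \<Longrightarrow> expectation (\<lambda>y. Y y l) = 0"
    and var: "\<And>r. expectation (\<lambda>y. (\<Sum>l\<in>I. Y y l * r l)\<^sup>2) \<le> v * (\<Sum>l\<in>I. (r l)\<^sup>2)"
  shows "(\<integral>\<^sup>+\<omega>. ennreal ((offdiag I Y n \<omega>)^6) \<partial>PiM {..<n} (\<lambda>_. M)) \<le> ennreal (exp (20800 * v) * real n ^ 6 * B^3)"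
proof -
  interpret PP: product_prob_space "\<lambda>_::nat. M" UNIV by unfold_locales
  let ?c = "real n ^ 6 * B^3"
  let ?a = "1 + 20800 * v / real n"
  have c0: "?c \<ge> 0" using B by simp
  have a0: "?a \<ge> 1" using v by simp
  have rec: "(\<integral>\<^sup>+\<omega>. ennreal ((offdiag I Y k \<omega>)^6 + ?c) \<partial>PiM {..<k} (\<lambda>_. M)) \<le> ennreal (?a^k * ?c)" if "k \<le> n" for k
    using that
  proof (induction k)
    case 0
    show ?case using PP.nn_integral_empty[of "\<lambda>\<omega>. ennreal ((offdiag I Y 0 \<omega>)^6 + ?c)"] by (simp add: offdiag_def)
  next
    case (Suc k)
    have om [measurable]: "offdiag I Y k \<in> borel_measurable (PiM {..<k} (\<lambda>_. M))" for k
      using I Y by (rule offdiag_measurable)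
    have om': "offdiag I Y (Suc k) \<in> borel_measurable (PiM (insert k {..<k}) (\<lambda>_. M))"
      using om[of "Suc k"] by (simp only: lessThan_Suc)
    have "(\<integral>\<^sup>+\<omega>. ennreal ((offdiag I Y (Suc k) \<omega>)^6 + ?c) \<partial>PiM {..<Suc k} (\<lambda>_. M))
      = (\<integral>\<^sup>+\<omega>. (\<integral>\<^sup>+y. ennreal ((offdiag I Y (Suc k) (fun_upd \<omega> k y))^6 + ?c) \<partial>M) \<partial>PiM {..<k} (\<lambda>_. M))"
      unfolding lessThan_Suc using om' by (intro PP.product_nn_integral_insert) auto
    also have "\<dots> \<le> (\<integral>\<^sup>+\<omega>. ennreal (?a * ((offdiag I Y k \<omega>)^6 + ?c)) \<partial>PiM {..<k} (\<lambda>_. M))"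
    proof (rule nn_integral_mono)
      fix \<omega> assume w: "\<omega> \<in> space (PiM {..<k} (\<lambda>_. M))"
      have "(\<Sum>l\<in>I. (\<Sum>i<k. Y (\<omega> i) l)\<^sup>2) \<le> real k * B + offdiag I Y k \<omega>"
        using w by (intro sum_squares_le_offdiag bound) (auto simp: space_PiM PiE_def Pi_def)
      \<comment> \<open>Replacing k by n makes the step constant the same for all k.\<close>
      also have "\<dots> \<le> real n * B + \<bar>offdiag I Y k \<omega>\<bar>"
        using Suc.prems B by (intro add_mono mult_right_mono) auto
      finally show "(\<integral>\<^sup>+y. ennreal ((offdiag I Y (Suc k) (fun_upd \<omega> k y))^6 + ?c) \<partial>M)
          \<le> ennreal (?a * ((offdiag I Y k \<omega>)^6 + ?c))"
        unfolding offdiag_Suc using n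
        by (intro sixth_moment_step[OF I _ B v Y bound mean var]) auto
    qed
    also have "\<dots> = ennreal ?a * (\<integral>\<^sup>+\<omega>. ennreal ((offdiag I Y k \<omega>)^6 + ?c) \<partial>PiM {..<k} (\<lambda>_. M))"
      using a0 c0 by (subst nn_integral_cmult[symmetric]) (auto simp: ennreal_mult)
    also have "\<dots> \<le> ennreal ?a * ennreal (?a^k * ?c)"
      using Suc by (intro mult_left_mono) auto
    also have "\<dots> = ennreal (?a^Suc k * ?c)"
      using a0 c0 by (subst ennreal_mult[symmetric]) (auto simp: mult.assoc)
    finally show ?case .
  qed
  have "(\<integral>\<^sup>+\<omega>. ennreal ((offdiag I Y n \<omega>)^6) \<partial>PiM {..<n} (\<lambda>_. M))
    \<le> (\<integral>\<^sup>+\<omega>. ennreal ((offdiag I Y n \<omega>)^6 + ?c) \<partial>PiM {..<n} (\<lambda>_. M))"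
    using c0 by (intro nn_integral_mono ennreal_leI) auto
  also have "\<dots> \<le> ennreal (?a^n * ?c)" by (rule rec) simp
  also have "\<dots> \<le> ennreal (exp (20800 * v) * ?c)"
  proof (intro ennreal_leI mult_right_mono c0)
    have "?a^n \<le> exp (20800 * v / real n) ^ n"
      using v by (intro power_mono exp_ge_add_one_self) auto
    also have "\<dots> = exp (20800 * v)" using n by (simp flip: exp_of_nat_mult)
    finally show "?a^n \<le> exp (20800 * v)" .
  qed
  finally show ?thesis by (simp add: mult.assoc)
qed

section \<open>Trigonometric polynomials on the circle\<close>

lemma circ_borel [measurable, simp]: "circ \<in> sets borel"
  by (simp add: circ_def)

lemma space_lcirc [simp]: "space lcirc = circ"
  by (simp add: lcirc_def space_restrict_space)

lemma lcirc_measurable: "g \<in> borel_measurable borel \<Longrightarrow> g \<in> borel_measurable lcirc"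
  unfolding lcirc_def by (intro measurable_restrict_space1) simp

lemma emeasure_lcirc: "emeasure lcirc circ = ennreal (2 * pi)"
  unfolding lcirc_def by (subst emeasure_restrict_space) (auto simp: circ_def)

lemma finite_measure_lcirc: "finite_measure lcirc"
  by (intro finite_measureI) (simp add: emeasure_lcirc)

interpretation lcirc: finite_measure lcirc by (rule finite_measure_lcirc)

lemma integral_circ: "(\<integral>x\<in>circ. (g x :: real) \<partial>lborel) = (\<integral>x. g x \<partial>lcirc)"
  unfolding set_lebesgue_integral_def lcirc_def by (subst integral_restrict_space) auto

lemma AE_lcirc: "(AE x in lcirc. P x) \<longleftrightarrow> (AE x in lborel. x \<in> circ \<longrightarrow> P x)"
  unfolding lcirc_def by (subst AE_restrict_space_iff) auto

lemma L2sq_lcirc: "L2sq g = (\<integral>x. (g x)\<^sup>2 \<partial>lcirc)"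
  unfolding L2sq_def by (rule integral_circ)

lemma integrable_lcirc:
  assumes "g \<in> borel_measurable borel" "\<And>x. x \<in> circ \<Longrightarrow> \<bar>g x\<bar> \<le> (B::real)"
  shows "integrable lcirc g"
  using assms by (intro lcirc.integrable_const_bound[of _ B] lcirc_measurable) auto

lemma integral_lcirc_FTC:
  fixes g G :: "real \<Rightarrow> real"
  assumes "\<And>x. (G has_real_derivative g x) (at x)" and g: "continuous_on UNIV g"
  shows "(\<integral>x. g x \<partial>lcirc) = G (2*pi) - G 0"
proof -
  have [measurable]: "g \<in> borel_measurable borel" using g by (rule borel_measurable_continuous_onI)
  have "(\<integral>x. g x \<partial>lcirc) = (\<integral>x. indicator {0..2*pi} x *\<^sub>R g x \<partial>lborel)"
    unfolding integral_circ[symmetric] set_lebesgue_integral_def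
  proof (rule integral_cong_AE)
    \<comment> \<open>The circle is half-open and the fundamental theorem wants a closed interval;
      they differ by the null point \<open>2*pi\<close>.\<close>
    show "AE x in lborel. indicator circ x *\<^sub>R g x = indicator {0..2*pi} x *\<^sub>R g x"
      using AE_lborel_singleton[of "2*pi"] by eventually_elim (auto simp: circ_def indicator_def)
  qed auto
  also have "\<dots> = G (2*pi) - G 0"
    using assms(1) g by (intro integral_FTC_Icc) 
      (auto simp: has_real_derivative_iff_has_vector_derivative intro: has_vector_derivative_at_within continuous_on_subset)
  finally show ?thesis .
qed

text \<open>Integer frequencies, since the product formulas produce differences of natural
  ones.\<close>

lemma integral_cos_lcirc: "(\<integral>x. cos (of_int k * x) \<partial>lcirc) = (if k = 0 then 2 * pi else 0)"
proof (cases "k = 0")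
  case True
  thus ?thesis using integral_lcirc_FTC[of "\<lambda>x. x" "\<lambda>_. 1"] by (simp add: continuous_on_const)
next
  case False
  have "(\<integral>x. cos (of_int k * x) \<partial>lcirc) = sin (of_int k * (2*pi)) / of_int k - sin (of_int k * 0) / of_int k"
    using False by (intro integral_lcirc_FTC) (auto intro!: derivative_eq_intros continuous_intros)
  also have "sin (of_int k * (2*pi)) = 0" by (metis mult.commute sin_int_2pin)
  finally show ?thesis using False by simp
qed

lemma integral_sin_lcirc: "(\<integral>x. sin (of_int k * x) \<partial>lcirc) = 0"
proof (cases "k = 0")
  case False
  have "(\<integral>x. sin (of_int k * x) \<partial>lcirc) = - cos (of_int k * (2*pi)) / of_int k - - cos (of_int k * 0) / of_int k"
    using False by (intro integral_lcirc_FTC) (auto intro!: derivative_eq_intros continuous_intros)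
  also have "cos (of_int k * (2*pi)) = 1" by (metis mult.commute cos_int_2pin)
  finally show ?thesis using False by simp
qed simp

lemma phi_measurable [measurable]: "phi l \<in> borel_measurable borel"
  unfolding phi_def[abs_def] by measurable

lemma phi_bound: "\<bar>phi l x\<bar> \<le> 1"
proof -
  have p: "1 \<le> sqrt pi" "1 \<le> sqrt (2 * pi)" using pi_gt3 by auto
  have "\<bar>y\<bar> / z \<le> 1" if "\<bar>y\<bar> \<le> 1" "1 \<le> z" for y z :: real using that by (simp add: field_simps)
  from this[OF abs_cos_le_one p(1)] this[OF abs_sin_le_one p(1)] this[of 1, OF _ p(2)]
  show ?thesis by (auto simp: phi_def abs_divide)
qed

lemma integrable_cos_lcirc: "integrable lcirc (\<lambda>x. cos (c * x))"
  and integrable_sin_lcirc: "integrable lcirc (\<lambda>x. sin (c * x))"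
  by (auto intro!: integrable_lcirc[of _ 1])

lemma phi_orthonormal: "(\<integral>x. phi l x * phi k x \<partial>lcirc) = (if l = k then 1 else 0)"
proof -
  define C where "C = (\<lambda>j::int. \<integral>x. cos (of_int j * x) \<partial>lcirc)"
  define S where "S = (\<lambda>j::int. \<integral>x. sin (of_int j * x) \<partial>lcirc)"
  have C: "C j = (if j = 0 then 2 * pi else 0)" for j unfolding C_def by (rule integral_cos_lcirc)
  have S: "S j = 0" for j unfolding S_def by (rule integral_sin_lcirc)
  \<comment> \<open>The frequency of the basis function, for both parities: for even l,
    \<open>(l + 1) div 2 = l div 2\<close>.\<close>
  define F where "F l = (l + 1) div 2" for l :: nat
  have ph: "phi l x = (if odd l then cos (real (F l) * x) else sin (real (F l) * x)) / sqrt pi" if "l \<noteq> 0" for l x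
    using that by (auto simp: phi_def F_def elim!: evenE)
  have Fpos: "F l > 0" if "l \<noteq> 0" for l using that by (auto simp: F_def)
  have Feq: "F l = F k \<longleftrightarrow> l = k" if "odd l = odd k" for l k
    using that by (auto simp: F_def elim!: evenE oddE)
  note int = integrable_cos_lcirc integrable_sin_lcirc
  have cc: "(\<integral>x. cos (real a * x) * cos (real b * x) \<partial>lcirc) = (C (int a - int b) + C (int a + int b)) / 2" for a b
  proof -
    have "(\<integral>x. cos (real a * x) * cos (real b * x) \<partial>lcirc)
      = (\<integral>x. (cos (of_int (int a - int b) * x) + cos (of_int (int a + int b) * x)) / 2 \<partial>lcirc)"
      by (simp add: cos_times_cos algebra_simps)
    thus ?thesis unfolding C_def by (simp add: int)
  qed
  have ss: "(\<integral>x. sin (real a * x) * sin (real b * x) \<partial>lcirc) = (C (int a - int b) - C (int a + int b)) / 2" for a b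
  proof -
    have "(\<integral>x. sin (real a * x) * sin (real b * x) \<partial>lcirc)
      = (\<integral>x. (cos (of_int (int a - int b) * x) - cos (of_int (int a + int b) * x)) / 2 \<partial>lcirc)"
      by (simp add: sin_times_sin algebra_simps)
    thus ?thesis unfolding C_def by (simp add: int)
  qed
  have sc: "(\<integral>x. sin (real a * x) * cos (real b * x) \<partial>lcirc) = (S (int a + int b) + S (int a - int b)) / 2" for a b
  proof -
    have "(\<integral>x. sin (real a * x) * cos (real b * x) \<partial>lcirc)
      = (\<integral>x. (sin (of_int (int a + int b) * x) + sin (of_int (int a - int b) * x)) / 2 \<partial>lcirc)"
      by (intro Bochner_Integration.integral_cong refl) (simp add: sin_times_cos distrib_right left_diff_distrib)
    thus ?thesis unfolding S_def by (simp add: int)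
  qed
  have cs: "(\<integral>x. cos (real b * x) * sin (real a * x) \<partial>lcirc) = (S (int a + int b) + S (int a - int b)) / 2" for a b
    using sc[of a b] by (simp add: mult.commute)
  have c0: "(\<integral>x. cos (real a * x) \<partial>lcirc) = C (int a)" and s0: "(\<integral>x. sin (real a * x) \<partial>lcirc) = S (int a)" for a
    by (simp_all add: C_def S_def)
  have one: "(\<integral>x. phi 0 x * phi k x \<partial>lcirc) = (if 0 = k then 1 else 0)" for k
  proof (cases "k = 0")
    case True
    have "(\<integral>x. phi 0 x * phi k x \<partial>lcirc) = 1 / (2 * pi) * C 0"
      using True by (simp add: phi_def C_def flip: real_sqrt_mult)
    thus ?thesis using True by (simp add: C)
  next
    case False
    have "(\<integral>x. phi 0 x * phi k x \<partial>lcirc) = (1 / sqrt (2 * pi) / sqrt pi) * (\<integral>x. (if odd k then cos (real (F k) * x) else sin (real (F k) * x)) \<partial>lcirc)"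
      unfolding ph[OF False] by (subst integral_mult_right_zero[symmetric]) (simp add: phi_def)
    thus ?thesis using False Fpos[OF False] by (cases "odd k") (simp_all add: c0 s0 C S)
  qed
  show ?thesis
  proof (cases "l = 0 \<or> k = 0")
    case True
    thus ?thesis using one[of l] one[of k] by (auto simp: mult.commute)
  next
    case False
    hence lk: "l \<noteq> 0" "k \<noteq> 0" by auto
    have "(\<integral>x. phi l x * phi k x \<partial>lcirc) = 1 / pi * (\<integral>x. (if odd l then cos (real (F l) * x) else sin (real (F l) * x)) *
       (if odd k then cos (real (F k) * x) else sin (real (F k) * x)) \<partial>lcirc)"
      unfolding ph[OF lk(1)] ph[OF lk(2)]
      by (subst integral_mult_right_zero[symmetric]) (simp add: field_simps flip: real_sqrt_mult)
    \<comment> \<open>The sum frequency is never zero, so only the integral at the difference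
      frequency can survive.\<close>
    moreover have "int (F l) + int (F k) \<noteq> 0" using Fpos[OF lk(1)] by linarith
    moreover have "l \<noteq> k" if "odd l \<noteq> odd k" using that by auto
    ultimately show ?thesis using Feq[of l k]
      by (cases "odd l"; cases "odd k") (simp_all add: cc ss sc cs C S)
  qed
qed

text \<open>Each added frequency contributes a sine and a cosine with squares summing to a constant.
  This independence of x is where every \<open>Dim m / (2 * pi)\<close> comes from, the penalty's
  included.\<close>

lemma sum_phi_sq: "(\<Sum>l\<le>2*m. (phi l x)\<^sup>2) = real (Dim m) / (2 * pi)"
proof (induction m)
  case 0
  show ?case by (simp add: phi_def Dim_def power_divide)
next
  case (Suc m)
  have "(\<Sum>l\<le>2 * Suc m. (phi l x)\<^sup>2) = (\<Sum>l\<le>2*m. (phi l x)\<^sup>2) + (phi (Suc (2*m)) x)\<^sup>2 + (phi (Suc (Suc (2*m))) x)\<^sup>2"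
    by simp
  also have "(phi (Suc (2*m)) x)\<^sup>2 = (cos (real (Suc m) * x))\<^sup>2 / pi"
    by (simp add: phi_def power_divide)
  also have "(phi (Suc (Suc (2*m))) x)\<^sup>2 = (sin (real (Suc m) * x))\<^sup>2 / pi"
    by (simp add: phi_def power_divide)
  finally have "(\<Sum>l\<le>2 * Suc m. (phi l x)\<^sup>2) = real (Dim m) / (2 * pi) + ((sin (real (Suc m) * x))\<^sup>2 + (cos (real (Suc m) * x))\<^sup>2) / pi"
    by (simp only: Suc.IH add_divide_distrib)
  thus ?case by (simp add: Dim_def field_simps)
qed

section \<open>Trigonometric polynomials given by their coefficients\<close>

definition trig_poly :: "nat \<Rightarrow> (nat \<Rightarrow> real) \<Rightarrow> real \<Rightarrow> real" where
  "trig_poly m a x = (\<Sum>l\<le>2*m. a l * phi l x)"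

lemma trig_poly_measurable [measurable]: "trig_poly m a \<in> borel_measurable borel"
  unfolding trig_poly_def[abs_def] by measurable

lemma trig_poly_bound: "(trig_poly m a x)\<^sup>2 \<le> real (Dim m) / (2 * pi) * (\<Sum>l\<le>2*m. (a l)\<^sup>2)"
  using Cauchy_Schwarz_ineq_sum[of a "\<lambda>l. phi l x" "{..2*m}"]
  unfolding trig_poly_def sum_phi_sq by (simp only: mult.commute)

lemma trig_poly_bounded: "\<exists>B. \<forall>x. \<bar>trig_poly m a x\<bar> \<le> B"
proof (intro exI allI)
  fix x
  have "\<bar>trig_poly m a x\<bar> \<le> (\<Sum>l\<le>2*m. \<bar>a l * phi l x\<bar>)" unfolding trig_poly_def by (rule sum_abs)
  also have "\<dots> \<le> (\<Sum>l\<le>2*m. \<bar>a l\<bar>)"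
    using phi_bound by (intro sum_mono) (auto simp: abs_mult mult_left_le)
  finally show "\<bar>trig_poly m a x\<bar> \<le> (\<Sum>l\<le>2*m. \<bar>a l\<bar>)" .
qed

text \<open>The weight is left general so that the same rule serves the density, the empirical
  coverage, an arc indicator times the density, and weights that already contain a
  polynomial.\<close>

lemma integral_weighted_trig_poly:
  fixes w :: "real \<Rightarrow> real"
  assumes w: "integrable lcirc w"
  shows "integrable lcirc (\<lambda>x. w x * phi l x)"
    and "integrable lcirc (\<lambda>x. w x * trig_poly m a x)"
    and "(\<integral>x. w x * trig_poly m a x \<partial>lcirc) = (\<Sum>l\<le>2*m. a l * (\<integral>x. w x * phi l x \<partial>lcirc))"
proof -
  have 1: "integrable lcirc (\<lambda>x. w x * phi l x)" for l
  proof (rule Bochner_Integration.integrable_bound[OF w])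
    show "AE x in lcirc. norm (w x * phi l x) \<le> norm (w x)"
      using phi_bound by (auto simp: abs_mult mult_left_le)
  qed (intro borel_measurable_times borel_measurable_integrable[OF w] lcirc_measurable phi_measurable)
  show "integrable lcirc (\<lambda>x. w x * phi l x)" by (rule 1)
  have e: "w x * trig_poly m a x = (\<Sum>l\<le>2*m. a l * (w x * phi l x))" for x
    by (simp add: trig_poly_def sum_distrib_left algebra_simps)
  show "integrable lcirc (\<lambda>x. w x * trig_poly m a x)"
    unfolding e using 1 by (intro Bochner_Integration.integrable_sum) auto
  show "(\<integral>x. w x * trig_poly m a x \<partial>lcirc) = (\<Sum>l\<le>2*m. a l * (\<integral>x. w x * phi l x \<partial>lcirc))"
    unfolding e using 1 by (subst Bochner_Integration.integral_sum) auto
qed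

text \<open>The linear rule applied twice, the first polynomial being absorbed into the
  weight.\<close>

lemma integral_weighted_trig_poly_prod:
  fixes w :: "real \<Rightarrow> real"
  assumes w: "integrable lcirc w"
  shows "integrable lcirc (\<lambda>x. w x * trig_poly m a x * trig_poly m b x)"
    and "(\<integral>x. w x * trig_poly m a x * trig_poly m b x \<partial>lcirc)
      = (\<Sum>l\<le>2*m. \<Sum>k\<le>2*m. a l * b k * (\<integral>x. w x * phi l x * phi k x \<partial>lcirc))"
proof -
  note A = integral_weighted_trig_poly[OF w]
  show "integrable lcirc (\<lambda>x. w x * trig_poly m a x * trig_poly m b x)"
    by (rule integral_weighted_trig_poly(2)[OF A(2)])
  have "(\<integral>x. w x * trig_poly m a x * trig_poly m b x \<partial>lcirc)
      = (\<Sum>k\<le>2*m. b k * (\<integral>x. w x * trig_poly m a x * phi k x \<partial>lcirc))"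
    by (rule integral_weighted_trig_poly(3)[OF A(2)])
  also have "\<dots> = (\<Sum>k\<le>2*m. b k * (\<integral>x. w x * phi k x * trig_poly m a x \<partial>lcirc))"
    by (simp add: mult_ac)
  also have "\<dots> = (\<Sum>k\<le>2*m. b k * (\<Sum>l\<le>2*m. a l * (\<integral>x. w x * phi k x * phi l x \<partial>lcirc)))"
    by (simp add: integral_weighted_trig_poly(3)[OF A(1)])
  also have "\<dots> = (\<Sum>l\<le>2*m. \<Sum>k\<le>2*m. a l * b k * (\<integral>x. w x * phi l x * phi k x \<partial>lcirc))"
    by (subst sum.swap) (simp add: sum_distrib_left mult_ac)
  finally show "(\<integral>x. w x * trig_poly m a x * trig_poly m b x \<partial>lcirc)
      = (\<Sum>l\<le>2*m. \<Sum>k\<le>2*m. a l * b k * (\<integral>x. w x * phi l x * phi k x \<partial>lcirc))" .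
qed

lemma L2sq_trig_poly: "L2sq (trig_poly m a) = (\<Sum>l\<le>2*m. (a l)\<^sup>2)"
proof -
  have "integrable lcirc (\<lambda>_. 1 :: real)" by simp
  from integral_weighted_trig_poly_prod(2)[OF this, of m a a]
  have "L2sq (trig_poly m a) = (\<Sum>l\<le>2*m. \<Sum>k\<le>2*m. a l * a k * (if l = k then 1 else 0))"
    by (simp add: L2sq_lcirc power2_eq_square phi_orthonormal)
  also have "\<dots> = (\<Sum>l\<le>2*m. (a l)\<^sup>2)"
    by (intro sum.cong refl) (simp add: power2_eq_square if_distrib sum.delta cong: if_cong)
  finally show ?thesis .
qed

section \<open>Arcs and their indicators\<close>

lemma arc_mem_iff: "x \<in> arc l u \<longleftrightarrow> (if l \<le> u then l \<le> x \<and> x \<le> u else l \<le> x \<and> x < 2 * pi \<or> 0 \<le> x \<and> x \<le> u)"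
  by (auto simp: arc_def)

lemma arc_borel [measurable, simp]: "arc l u \<in> sets borel"
  by (simp add: arc_def)

lemma arc_subset_circ: "l \<in> circ \<Longrightarrow> u \<in> circ \<Longrightarrow> arc l u \<subseteq> circ"
  by (auto simp: arc_def circ_def)

text \<open>If the arc does not wrap, at least one of the two half-line conditions holds and the sum
  exceeds the indicator by one; if it wraps, they exclude each other and the third indicator cancels
  the one. Writing the condition on \<open>u\<close> as \<open>-u \<le> -x\<close> turns both
  half-lines into distribution functions, so one quantile argument covers both.\<close>

lemma indicator_arc:
  assumes "l \<in> circ" "u \<in> circ" "x \<in> circ"
  shows "indicator (arc l u) x = indicator {..x} l + indicator {..-x} (-u) + indicator {p. snd p < fst p} (l, u) - (1::real)"
  using assms by (auto simp: arc_def circ_def indicator_def)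

lemma arc_measurable_pair [measurable]:
  "(\<lambda>(x, p). indicator (arc (fst p) (snd p)) x :: real) \<in> borel_measurable (borel \<Otimes>\<^sub>M borel)"
proof -
  have "(\<lambda>(x, p). indicator (arc (fst p) (snd p)) x :: real) =
    (\<lambda>z. if (if fst (snd z) \<le> snd (snd z) then fst (snd z) \<le> fst z \<and> fst z \<le> snd (snd z) 
      else fst (snd z) \<le> fst z \<and> fst z < 2 * pi \<or> 0 \<le> fst z \<and> fst z \<le> snd (snd z)) then 1 else 0)"
    by (auto simp: fun_eq_iff indicator_def arc_mem_iff)
  also have "\<dots> \<in> borel_measurable (borel \<Otimes>\<^sub>M borel)"
  proof -
    have [measurable]: "(\<lambda>z. fst (snd z)) \<in> borel_measurable (borel \<Otimes>\<^sub>M (borel :: (real \<times> real) measure))"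
      "(\<lambda>z. snd (snd z)) \<in> borel_measurable (borel \<Otimes>\<^sub>M (borel :: (real \<times> real) measure))"
      unfolding borel_prod[symmetric] by measurable
    show ?thesis by measurable
  qed
  finally show ?thesis .
qed

section \<open>Uniform lower bound for the empirical coverage\<close>

text \<open>The grid consists of the quantiles at the levels
  \<open>\<epsilon>, 2 * \<epsilon>, ...\<close>. Only an approximation from below is required, so
  atoms do no harm: a jump at a quantile merely raises \<open>cdf M q\<close>.\<close>

lemma cdf_quantile_grid:
  assumes "real_distribution M" and e: "\<epsilon> > 0"
  obtains G where "finite G" "card G \<le> nat \<lceil>1/\<epsilon>\<rceil>"
    "\<And>x. cdf M x \<le> \<epsilon> \<or> (\<exists>q\<in>G. q \<le> x \<and> cdf M x - \<epsilon> \<le> cdf M q)"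
proof -
  interpret real_distribution M by fact
  define q where "q j = Inf {x. real j * \<epsilon> \<le> cdf M x}" for j :: nat
  define G where "G = q ` {1..nat \<lceil>1/\<epsilon>\<rceil>}"
  show ?thesis
  proof (rule that[of G])
    show "finite G" by (simp add: G_def)
    show "card G \<le> nat \<lceil>1/\<epsilon>\<rceil>" unfolding G_def by (rule order.trans[OF card_image_le]) auto
    fix x
    show "cdf M x \<le> \<epsilon> \<or> (\<exists>q\<in>G. q \<le> x \<and> cdf M x - \<epsilon> \<le> cdf M q)"
    proof (cases "cdf M x \<le> \<epsilon>")
      case False
      \<comment> \<open>The highest level \<open>j * \<epsilon>\<close> not exceeding the
        distribution function at \<open>x\<close>.\<close>
      define j where "j = nat \<lfloor>cdf M x / \<epsilon>\<rfloor>"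
      have quo: "1 \<le> cdf M x / \<epsilon>" using False e by simp
      have fl: "real j = of_int \<lfloor>cdf M x / \<epsilon>\<rfloor>" using quo by (simp add: j_def)
      have j1: "real j \<le> cdf M x / \<epsilon>" "cdf M x / \<epsilon> < real j + 1" unfolding fl by linarith+
      have jx: "real j * \<epsilon> \<le> cdf M x" "cdf M x - \<epsilon> \<le> real j * \<epsilon>"
        using j1 e by (simp_all add: field_simps)
      have "j \<ge> 1" using j1 quo by linarith
      moreover have "j \<le> nat \<lceil>1/\<epsilon>\<rceil>"
      proof -
        have "cdf M x / \<epsilon> \<le> 1 / \<epsilon>" using cdf_bounded_prob[of x] e by (intro divide_right_mono) auto
        hence "real j \<le> 1/\<epsilon>" using j1 by linarith
        thus ?thesis by linarith
      qed
      ultimately have jG: "q j \<in> G" unfolding G_def by auto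
      let ?A = "{y. real j * \<epsilon> \<le> cdf M y}"
      \<comment> \<open>Without a lower bound the \<open>Inf\<close> defining the quantile would be
        meaningless; the limit 0 at minus infinity supplies it, as the level is positive.\<close>
      have bdd: "bdd_below ?A"
      proof -
        have "eventually (\<lambda>y. cdf M y < real j * \<epsilon>) at_bot"
          using cdf_lim_at_bot \<open>j \<ge> 1\<close> e by (intro order_tendstoD) auto
        then obtain b where b: "cdf M y < real j * \<epsilon>" if "y \<le> b" for y
          by (auto simp: eventually_at_bot_linorder)
        show ?thesis using b by (intro bdd_belowI[of _ b]) (metis linorder_not_le mem_Collect_eq nle_le)
      qed
      have "q j \<le> x" unfolding q_def using jx bdd by (intro cInf_lower) auto
      moreover have "real j * \<epsilon> \<le> cdf M (q j)"
      \<comment> \<open>Every point to the right of the infimum has reached the level, and right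
        continuity carries this over to the infimum itself.\<close>
      proof (rule tendsto_lowerbound)
        show "(cdf M \<longlongrightarrow> cdf M (q j)) (at_right (q j))"
          using cdf_is_right_cont[of "q j"] by (simp add: continuous_within)
        show "\<forall>\<^sub>F y in at_right (q j). real j * \<epsilon> \<le> cdf M y"
          using eventually_at_right_less[of "q j"]
        proof eventually_elim
          case (elim y)
          then obtain z where "z \<in> ?A" "z < y"
            unfolding q_def using jx bdd cInf_less_iff[of ?A y] by blast
          thus ?case using cdf_nondecreasing[of z y] by auto
        qed
      qed auto
      ultimately show ?thesis using jG jx by force
    qed auto
  qed
qed

definition sigma_hat :: "nat \<Rightarrow> (nat \<Rightarrow> obs) \<Rightarrow> real \<Rightarrow> real" where
  "sigma_hat n \<omega> x = (1 / real n) * (\<Sum>i<n. indicator (arc (fst (snd (\<omega> i))) (snd (snd (\<omega> i)))) x)"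

text \<open>Monotonicity turns a bound uniform in \<open>x\<close> into finitely many frequencies:
  one \<open>\<epsilon>\<close> is lost to the grid and one to sampling. The family depends on
  \<open>Q\<close> and \<open>h\<close> alone and is fixed before \<open>n\<close> and
  \<open>\<omega>\<close>.\<close>

lemma quantile_grid_empirical:
  fixes h :: "real \<times> real \<Rightarrow> real" and Q :: "(real \<times> real) measure"
  assumes Q: "prob_space Q" "sets Q = sets borel" and h: "h \<in> borel_measurable borel" and e: "\<epsilon> > 0"
  obtains \<A> where "finite \<A>" "card \<A> \<le> nat \<lceil>1/\<epsilon>\<rceil>" "\<A> \<subseteq> sets borel"
    "\<And>n (\<omega> :: nat \<Rightarrow> obs) x. \<forall>A\<in>\<A>. real n * (measure Q A - \<epsilon>) \<le> (\<Sum>i<n. indicator A (snd (\<omega> i))) \<Longrightarrow>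
       real n * (measure Q {p. h p \<le> x} - 2 * \<epsilon>) \<le> (\<Sum>i<n. indicator {p. h p \<le> x} (snd (\<omega> i)))"
proof -
  interpret prob_space Q by fact
  have hQ [measurable]: "h \<in> borel_measurable Q" using h by (simp cong: measurable_cong_sets add: Q)
  have sp: "space Q = UNIV" using sets_eq_imp_space_eq[OF Q(2)] by simp
  define M where "M = distr Q borel h"
  have M: "real_distribution M" unfolding M_def by (rule real_distribution_distr) simp
  have cdf: "cdf M x = measure Q {p. h p \<le> x}" for x
    unfolding cdf_def M_def by (subst measure_distr) (auto simp: vimage_def sp)
  obtain G where G: "finite G" "card G \<le> nat \<lceil>1/\<epsilon>\<rceil>"
    "\<And>x. cdf M x \<le> \<epsilon> \<or> (\<exists>q\<in>G. q \<le> x \<and> cdf M x - \<epsilon> \<le> cdf M q)"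
    using cdf_quantile_grid[OF M e] by blast
  define \<A> where "\<A> = (\<lambda>q. {p. h p \<le> q}) ` G"
  show ?thesis
  proof (rule that[of \<A>])
    show "finite \<A>" using G by (simp add: \<A>_def)
    show "card \<A> \<le> nat \<lceil>1/\<epsilon>\<rceil>" unfolding \<A>_def by (rule order.trans[OF card_image_le G(2)]) (rule G)
    show "\<A> \<subseteq> sets borel" unfolding \<A>_def using h by auto
    fix n and \<omega> :: "nat \<Rightarrow> obs" and x
    assume A: "\<forall>A\<in>\<A>. real n * (measure Q A - \<epsilon>) \<le> (\<Sum>i<n. indicator A (snd (\<omega> i)))"
    show "real n * (measure Q {p. h p \<le> x} - 2 * \<epsilon>) \<le> (\<Sum>i<n. indicator {p. h p \<le> x} (snd (\<omega> i)))"
      using G(3)[of x]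
    proof
      assume "cdf M x \<le> \<epsilon>"
      hence "real n * (measure Q {p. h p \<le> x} - 2 * \<epsilon>) \<le> 0"
        using e by (intro mult_nonneg_nonpos) (auto simp: cdf)
      also have "0 \<le> (\<Sum>i<n. indicator {p. h p \<le> x} (snd (\<omega> i)) :: real)" by (intro sum_nonneg) auto
      finally show ?thesis .
    next
      assume "\<exists>q\<in>G. q \<le> x \<and> cdf M x - \<epsilon> \<le> cdf M q"
      then obtain q where q: "q \<in> G" "q \<le> x" "cdf M x - \<epsilon> \<le> cdf M q" by blast
      have "real n * (measure Q {p. h p \<le> x} - 2 * \<epsilon>) \<le> real n * (measure Q {p. h p \<le> q} - \<epsilon>)"
        using q by (intro mult_left_mono) (auto simp: cdf)
      also have "\<dots> \<le> (\<Sum>i<n. indicator {p. h p \<le> q} (snd (\<omega> i)))"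
        using A q by (auto simp: \<A>_def)
      also have "\<dots> \<le> (\<Sum>i<n. indicator {p. h p \<le> x} (snd (\<omega> i)))"
        using q by (intro sum_mono) (auto simp: indicator_def)
      finally show ?thesis .
    qed
  qed
qed

text \<open>The half-lines for the two endpoints cost \<open>2 * \<epsilon>\<close> each and the
  wrapping event, a single set independent of \<open>x\<close>, costs \<open>\<epsilon>\<close>:
  together \<open>5 * \<epsilon>\<close>.\<close>

lemma sigma_hat_lower_bound:
  fixes Q :: "(real \<times> real) measure"
  assumes Q: "prob_space Q" "sets Q = sets borel" and e: "\<epsilon> > 0"
    and circ: "AE p in Q. fst p \<in> circ \<and> snd p \<in> circ"
  obtains \<A> where "finite \<A>" "card \<A> \<le> 2 * nat \<lceil>1/\<epsilon>\<rceil> + 1" "\<A> \<subseteq> sets borel"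
    "\<And>n (\<omega> :: nat \<Rightarrow> obs) x. n > 0 \<Longrightarrow> (\<forall>i<n. fst (snd (\<omega> i)) \<in> circ \<and> snd (snd (\<omega> i)) \<in> circ) \<Longrightarrow>
       (\<forall>A\<in>\<A>. real n * (measure Q A - \<epsilon>) \<le> (\<Sum>i<n. indicator A (snd (\<omega> i)))) \<Longrightarrow>
       x \<in> circ \<Longrightarrow> sigmaQ Q x - 5 * \<epsilon> \<le> sigma_hat n \<omega> x"
proof -
  interpret prob_space Q by fact
  have sp: "space Q = UNIV" using sets_eq_imp_space_eq[OF Q(2)] by simp
  have m: "fst \<in> borel_measurable (borel :: (real \<times> real) measure)"
    "(\<lambda>p. - snd p) \<in> borel_measurable (borel :: (real \<times> real) measure)"
    unfolding borel_prod[symmetric] by measurable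
  obtain A1 where A1: "finite A1" "card A1 \<le> nat \<lceil>1/\<epsilon>\<rceil>" "A1 \<subseteq> sets borel"
    "\<And>n (\<omega> :: nat \<Rightarrow> obs) x. \<forall>A\<in>A1. real n * (measure Q A - \<epsilon>) \<le> (\<Sum>i<n. indicator A (snd (\<omega> i))) \<Longrightarrow>
       real n * (measure Q {p. fst p \<le> x} - 2 * \<epsilon>) \<le> (\<Sum>i<n. indicator {p. fst p \<le> x} (snd (\<omega> i)))"
    using quantile_grid_empirical[OF Q m(1) e] by blast
  obtain A2 where A2: "finite A2" "card A2 \<le> nat \<lceil>1/\<epsilon>\<rceil>" "A2 \<subseteq> sets borel"
    "\<And>n (\<omega> :: nat \<Rightarrow> obs) x. \<forall>A\<in>A2. real n * (measure Q A - \<epsilon>) \<le> (\<Sum>i<n. indicator A (snd (\<omega> i))) \<Longrightarrow>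
       real n * (measure Q {p. - snd p \<le> x} - 2 * \<epsilon>) \<le> (\<Sum>i<n. indicator {p. - snd p \<le> x} (snd (\<omega> i)))"
    using quantile_grid_empirical[OF Q m(2) e] by blast
  define W where "W = {p :: real \<times> real. snd p < fst p}"
  have W: "W \<in> sets borel"
  proof -
    have "{p \<in> space borel. snd p < fst p} \<in> sets (borel :: (real \<times> real) measure)"
      unfolding borel_prod[symmetric] by measurable
    thus ?thesis by (simp add: W_def)
  qed
  show ?thesis
  proof (rule that[of "A1 \<union> A2 \<union> {W}"])
    show "finite (A1 \<union> A2 \<union> {W})" using A1 A2 by simp
    have "card (A1 \<union> A2 \<union> {W}) \<le> card A1 + card A2 + card {W}"
      by (meson card_Un_le add_le_mono1 order.trans)
    thus "card (A1 \<union> A2 \<union> {W}) \<le> 2 * nat \<lceil>1/\<epsilon>\<rceil> + 1" using A1 A2 by simp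
    show "A1 \<union> A2 \<union> {W} \<subseteq> sets borel" using A1 A2 W by simp
    fix n and \<omega> :: "nat \<Rightarrow> obs" and x
    assume n: "n > 0" and c: "\<forall>i<n. fst (snd (\<omega> i)) \<in> circ \<and> snd (snd (\<omega> i)) \<in> circ"
      and A: "\<forall>A\<in>A1 \<union> A2 \<union> {W}. real n * (measure Q A - \<epsilon>) \<le> (\<Sum>i<n. indicator A (snd (\<omega> i)))"
      and x: "x \<in> circ"
    let ?L = "{p :: real \<times> real. fst p \<le> x}" and ?U = "{p :: real \<times> real. - snd p \<le> - x}"
    have LU: "?L \<in> sets Q" "?U \<in> sets Q" "W \<in> sets Q"
      using measurable_sets[OF m(1), of "{..x}"] measurable_sets[OF m(2), of "{..-x}"] W
      by (auto simp: Q vimage_def)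
    have ind: "indicator (arc (fst p) (snd p)) x = indicator ?L p + indicator ?U p + indicator W p - (1::real)"
      if "fst p \<in> circ" "snd p \<in> circ" for p
      using indicator_arc[OF that x] by (simp add: W_def indicator_def)
    have "sigmaQ Q x = (\<integral>p. indicator {(l, u). x \<in> arc l u} p \<partial>Q)"
      by (simp add: sigmaQ_def sp)
    also have "\<dots> = (\<integral>p. indicator ?L p + indicator ?U p + indicator W p - (1::real) \<partial>Q)"
    proof (rule integral_cong_AE)
      have "(\<lambda>p. indicator (arc (fst p) (snd p)) x :: real) \<in> borel_measurable borel"
        using measurable_compose[OF measurable_Pair1'[of x borel borel] arc_measurable_pair] by simp
      moreover have "(\<lambda>p. indicator (arc (fst p) (snd p)) x :: real) = indicator {(l, u). x \<in> arc l u}"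
        by (auto simp: fun_eq_iff indicator_def)
      ultimately show "(indicator {(l, u). x \<in> arc l u} :: real \<times> real \<Rightarrow> real) \<in> borel_measurable Q"
        by (simp cong: measurable_cong_sets add: Q)
      show "(\<lambda>p. indicator ?L p + indicator ?U p + indicator W p - (1::real)) \<in> borel_measurable Q"
        using LU by auto
      show "AE p in Q. indicator {(l, u). x \<in> arc l u} p = indicator ?L p + indicator ?U p + indicator W p - (1::real)"
        using circ
      proof eventually_elim
        case (elim p)
        have "(indicator {(l, u). x \<in> arc l u} p :: real) = indicator (arc (fst p) (snd p)) x"
          by (auto simp: indicator_def)
        thus ?case using ind[of p] elim by simp
      qed
    qed
    also have "\<dots> = measure Q ?L + measure Q ?U + measure Q W - 1"
    proof -
      have int: "integrable Q (indicator A :: _ \<Rightarrow> real)" if "A \<in> sets Q" for A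
        using that by (intro integrable_real_indicator) (auto simp: emeasure_eq_measure)
      show ?thesis using int[OF LU(1)] int[OF LU(2)] int[OF LU(3)] prob_space
        by (simp add: sp)
    qed
    finally have sg: "sigmaQ Q x = measure Q ?L + measure Q ?U + measure Q W - 1" .
    have "real n * sigma_hat n \<omega> x = (\<Sum>i<n. indicator ?L (snd (\<omega> i)) + indicator ?U (snd (\<omega> i)) + indicator W (snd (\<omega> i)) - 1)"
      unfolding sigma_hat_def using n c ind by simp
    also have "\<dots> = (\<Sum>i<n. indicator ?L (snd (\<omega> i))) + (\<Sum>i<n. indicator ?U (snd (\<omega> i))) + (\<Sum>i<n. indicator W (snd (\<omega> i))) - real n"
      by (simp add: sum.distrib sum_subtractf)
    \<comment> \<open>The second grid belongs to the negated endpoint, hence its use at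
      \<open>-x\<close>.\<close>
    also have "\<dots> \<ge> real n * (measure Q ?L - 2 * \<epsilon>) + real n * (measure Q ?U - 2 * \<epsilon>) + real n * (measure Q W - \<epsilon>) - real n"
      using A A1(4)[of n \<omega> x] A2(4)[of n \<omega> "-x"] by (intro diff_right_mono add_mono) auto
    also (xtrans) have "real n * (measure Q ?L - 2 * \<epsilon>) + real n * (measure Q ?U - 2 * \<epsilon>) + real n * (measure Q W - \<epsilon>) - real n
      = real n * (sigmaQ Q x - 5 * \<epsilon>)"
      by (simp add: sg algebra_simps)
    finally show "sigmaQ Q x - 5 * \<epsilon> \<le> sigma_hat n \<omega> x" using n by simp
  qed
qed

section \<open>Noise of the contrast\<close>

text \<open>The subtracted integral is the mean of \<open>Delta ob * phi l (fst ob)\<close> when the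
  arc is held fixed and X has density \<open>f\<close>.\<close>

definition noise :: "(real \<Rightarrow> real) \<Rightarrow> obs \<Rightarrow> nat \<Rightarrow> real" where
  "noise f ob l = Delta ob * phi l (fst ob)
     - (\<integral>x. indicator (arc (fst (snd ob)) (snd (snd ob))) x * f x * phi l x \<partial>lcirc)"

text \<open>\<open>v\<close> is any almost sure upper bound of the density; the final theorem takes
  \<open>Linf f\<close>.\<close>

locale arc_model =
  fixes f :: "real \<Rightarrow> real" and Q :: "(real \<times> real) measure" and v :: real
  assumes f_meas [measurable]: "f \<in> borel_measurable borel"
    and f_nonneg: "\<And>x. x \<in> circ \<Longrightarrow> 0 \<le> f x"
    and f_int: "(\<integral>x. f x \<partial>lcirc) = 1"
    and f_le: "AE x in lcirc. f x \<le> v"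
    and Q: "prob_space Q" "sets Q = sets (borel :: (real \<times> real) measure)"
begin

definition X_law :: "real measure" where
  "X_law = density lcirc (\<lambda>x. ennreal (f x))"

lemma f_lcirc [measurable]: "f \<in> borel_measurable lcirc"
  by (rule lcirc_measurable) simp

lemma AE_lcirc_circ: "AE x in lcirc. x \<in> circ"
  by (rule AE_I2) simp

lemma f_range: "AE x in lcirc. 0 \<le> f x \<and> f x \<le> v"
  using f_le AE_lcirc_circ by eventually_elim (auto simp: f_nonneg)

lemma f_integrable: "integrable lcirc f"
  by (rule lcirc.integrable_const_bound[of _ v], rule eventually_mono[OF f_range]) auto

lemma v_nonneg: "0 \<le> v"
proof (rule ccontr)
  assume v: "\<not> 0 \<le> v"
  have "(\<integral>x. f x \<partial>lcirc) \<le> (\<integral>x. v \<partial>lcirc)"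
    using f_le by (intro integral_mono_AE f_integrable) auto
  hence "1 \<le> measure lcirc circ * v" by (simp add: f_int)
  moreover have "measure lcirc circ * v \<le> 0" using v by (intro mult_nonneg_nonpos) auto
  ultimately show False by simp
qed

lemma f_sq_integrable: "integrable lcirc (\<lambda>x. (f x)\<^sup>2)"
  by (rule lcirc.integrable_const_bound[of _ "v\<^sup>2"], rule eventually_mono[OF f_range])
     (auto intro!: power_mono)

text \<open>\<open>f\<^sup>2 \<le> v * f\<close> almost everywhere, and \<open>f\<close> integrates
  to one.\<close>

lemma L2sq_f_le: "L2sq f \<le> v"
proof -
  have "(\<integral>x. (f x)\<^sup>2 \<partial>lcirc) \<le> (\<integral>x. v * f x \<partial>lcirc)"
  proof (intro integral_mono_AE f_sq_integrable integrable_mult_right f_integrable)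
    show "AE x in lcirc. (f x)\<^sup>2 \<le> v * f x"
      using f_range by eventually_elim (auto simp: power2_eq_square intro!: mult_right_mono)
  qed
  thus ?thesis by (simp add: L2sq_lcirc f_int)
qed

lemma integral_X_law:
  assumes "h \<in> borel_measurable borel"
  shows "(\<integral>x. h x \<partial>X_law) = (\<integral>x. f x * (h x :: real) \<partial>lcirc)"
  unfolding X_law_def using assms f_nonneg
  by (subst integral_density) (auto intro: lcirc_measurable)

lemma space_X_law [simp]: "space X_law = circ"
  by (simp add: X_law_def)

lemma X_law_measurable: "h \<in> borel_measurable borel \<Longrightarrow> h \<in> borel_measurable X_law"
  unfolding X_law_def by (simp add: lcirc_measurable)

lemma prob_space_X_law: "prob_space X_law"
proof
  have "emeasure X_law (space X_law) = (\<integral>\<^sup>+x. ennreal (f x) \<partial>lcirc)"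
    unfolding X_law_def by (subst emeasure_density) (use sets.top[of lcirc] in \<open>auto intro!: nn_integral_cong\<close>)
  also have "\<dots> = ennreal (\<integral>x. f x \<partial>lcirc)"
    using f_nonneg by (intro nn_integral_eq_integral f_integrable) auto
  finally show "emeasure X_law (space X_law) = 1" by (simp add: f_int)
qed

sublocale X: prob_space X_law by (rule prob_space_X_law)
sublocale Q: prob_space Q by (rule Q(1))
sublocale XQ: pair_prob_space X_law Q ..

lemma obs_law_eq: "obs_law f Q = X_law \<Otimes>\<^sub>M Q"
  by (simp add: obs_law_def X_law_def)

lemma prob_space_obs_law: "prob_space (obs_law f Q)"
  unfolding obs_law_eq by (rule XQ.prob_space_axioms)

lemma space_Q: "space Q = UNIV" using sets_eq_imp_space_eq[OF Q(2)] by simp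

lemma obs_measurable:
  assumes h: "h \<in> borel_measurable (borel \<Otimes>\<^sub>M borel)"
  shows "h \<in> borel_measurable (obs_law f Q)"
proof -
  have "(\<lambda>z. z) \<in> measurable (obs_law f Q) (borel \<Otimes>\<^sub>M borel)"
    unfolding obs_law_eq
  proof (rule measurable_pair)
    have "fst \<in> measurable (X_law \<Otimes>\<^sub>M Q) X_law" by simp
    moreover have "(\<lambda>x. x) \<in> borel_measurable X_law" by (rule X_law_measurable) simp
    ultimately have "(\<lambda>z. fst z) \<in> borel_measurable (X_law \<Otimes>\<^sub>M Q)" by (rule measurable_compose)
    thus "fst \<circ> (\<lambda>z. z) \<in> borel_measurable (X_law \<Otimes>\<^sub>M Q)" by (simp add: comp_def)
    have "snd \<in> measurable (X_law \<Otimes>\<^sub>M Q) Q" by simp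
    hence "snd \<in> measurable (X_law \<Otimes>\<^sub>M Q) borel" by (simp cong: measurable_cong_sets add: Q)
    thus "snd \<circ> (\<lambda>z. z) \<in> measurable (X_law \<Otimes>\<^sub>M Q) borel" by (simp add: comp_def)
  qed
  from measurable_compose[OF this h] show ?thesis .
qed

lemma arc_f_integrable: "integrable lcirc (\<lambda>x. indicator (arc l u) x * f x)"
  using f_integrable
  by (rule Bochner_Integration.integrable_bound)
     (auto simp: indicator_def intro!: lcirc_measurable)

lemma noise_measurable: "(\<lambda>ob. noise f ob l) \<in> borel_measurable (obs_law f Q)"
proof (rule obs_measurable)
  have 1: "(\<lambda>ob. Delta ob * phi l (fst ob)) \<in> borel_measurable (borel \<Otimes>\<^sub>M borel)"
    using arc_measurable_pair unfolding Delta_def case_prod_beta by measurable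
  have "(\<lambda>(p, x). indicator (arc (fst p) (snd p)) x * f x * phi l x) \<in> borel_measurable (borel \<Otimes>\<^sub>M lcirc)"
  proof -
    have [measurable]: "(\<lambda>z. snd z) \<in> borel_measurable ((borel :: (real \<times> real) measure) \<Otimes>\<^sub>M lcirc)"
      by (rule measurable_compose[OF measurable_snd]) (rule lcirc_measurable, simp)
    have "(\<lambda>z. (snd z, fst z)) \<in> measurable ((borel :: (real \<times> real) measure) \<Otimes>\<^sub>M lcirc) (borel \<Otimes>\<^sub>M borel)"
      by measurable
    from measurable_compose[OF this arc_measurable_pair]
    have [measurable]: "(\<lambda>z. indicator (arc (fst (fst z)) (snd (fst z))) (snd z) :: real) \<in> borel_measurable (borel \<Otimes>\<^sub>M lcirc)"
      by (simp add: case_prod_beta)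
    show ?thesis unfolding case_prod_beta by measurable
  qed
  hence "(\<lambda>p. \<integral>x. indicator (arc (fst p) (snd p)) x * f x * phi l x \<partial>lcirc) \<in> borel_measurable borel"
    by (rule lcirc.borel_measurable_lebesgue_integral)
  from measurable_compose[OF measurable_snd this] 1
  show "(\<lambda>ob. noise f ob l) \<in> borel_measurable (borel \<Otimes>\<^sub>M borel)"
    unfolding noise_def by (intro borel_measurable_diff) auto
qed

text \<open>The noise vector tested in direction \<open>r\<close> is a single polynomial evaluated
  at X and centred given the arc, so bounds in all directions become bounds for one
  function.\<close>

lemma sum_noise:
  "(\<Sum>l\<le>2*m. noise f ob l * r l) = Delta ob * trig_poly m r (fst ob)
     - (\<integral>x. indicator (arc (fst (snd ob)) (snd (snd ob))) x * f x * trig_poly m r x \<partial>lcirc)"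
proof -
  define c where "c l = (\<integral>x. indicator (arc (fst (snd ob)) (snd (snd ob))) x * f x * phi l x \<partial>lcirc)" for l
  have "noise f ob l * r l = Delta ob * (r l * phi l (fst ob)) - r l * c l" for l
    unfolding noise_def c_def[symmetric] by (simp add: algebra_simps)
  thus ?thesis
    unfolding integral_weighted_trig_poly(3)[OF arc_f_integrable] c_def[symmetric]
    by (simp add: trig_poly_def sum_subtractf sum_distrib_left)
qed

text \<open>For the vector \<open>c\<close> of means, the squared norm \<open>N\<close> equals the
  integral of the density on the arc against the polynomial with coefficients \<open>c\<close>. That
  polynomial is at most \<open>sqrt (d * N)\<close> with \<open>d = Dim m / (2 * pi)\<close>, whence
  \<open>N \<le> d\<close>. With \<open>sum_phi_sq\<close> for the observed part this gives
  \<open>2 * d + 2 * d\<close>, for every single observation.\<close>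

lemma sum_noise_sq_le: "(\<Sum>l\<le>2*m. (noise f ob l)\<^sup>2) \<le> 2 * real (Dim m) / pi"
proof -
  let ?w = "\<lambda>x. indicator (arc (fst (snd ob)) (snd (snd ob))) x :: real"
  define c where "c l = (\<integral>x. ?w x * f x * phi l x \<partial>lcirc)" for l
  define N where "N = (\<Sum>l\<le>2*m. (c l)\<^sup>2)"
  let ?d = "real (Dim m) / (2 * pi)"
  have N0: "N \<ge> 0" unfolding N_def by (intro sum_nonneg) auto
  have "N = (\<integral>x. ?w x * f x * trig_poly m c x \<partial>lcirc)"
    unfolding N_def integral_weighted_trig_poly(3)[OF arc_f_integrable] by (simp add: c_def power2_eq_square)
  also have "\<dots> \<le> (\<integral>x. f x * sqrt (?d * N) \<partial>lcirc)"
  proof (intro integral_mono_AE integral_weighted_trig_poly arc_f_integrable integrable_mult_left f_integrable AE_I2)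
    fix x assume "x \<in> space lcirc"
    hence fx: "0 \<le> f x" by (simp add: f_nonneg)
    have "trig_poly m c x \<le> sqrt (?d * N)"
      using trig_poly_bound[of m c x] unfolding N_def by (intro real_le_rsqrt) auto
    moreover have "0 \<le> sqrt (?d * N)" using N0 by simp
    ultimately show "?w x * f x * trig_poly m c x \<le> f x * sqrt (?d * N)"
      using fx by (auto simp: indicator_def intro!: mult_left_mono)
  qed
  also have "\<dots> = sqrt (?d * N)" by (simp add: f_int)
  finally have "N\<^sup>2 \<le> ?d * N" using N0 by (metis real_le_rsqrt real_sqrt_le_iff real_sqrt_unique power_mono real_sqrt_pow2 mult_nonneg_nonneg divide_nonneg_nonneg of_nat_0_le_iff pi_ge_zero zero_le_numeral)
  hence N: "N \<le> ?d" using N0 mult_right_le_imp_le[of N N ?d] by (cases "N = 0") (auto simp: power2_eq_square)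
  have "(\<Sum>l\<le>2*m. (noise f ob l)\<^sup>2) \<le> (\<Sum>l\<le>2*m. 2 * (phi l (fst ob))\<^sup>2 + 2 * (c l)\<^sup>2)"
  proof (rule sum_mono)
    fix l
    let ?a = "Delta ob * phi l (fst ob)"
    have "(?a - c l)\<^sup>2 \<le> 2 * ?a\<^sup>2 + 2 * (c l)\<^sup>2"
      using zero_le_power2[of "?a + c l"] by (simp add: power2_sum power2_diff)
    moreover have "?a\<^sup>2 \<le> (phi l (fst ob))\<^sup>2" by (simp add: Delta_def indicator_def)
    ultimately show "(noise f ob l)\<^sup>2 \<le> 2 * (phi l (fst ob))\<^sup>2 + 2 * (c l)\<^sup>2"
      unfolding noise_def c_def by linarith
  qed
  also have "\<dots> = 2 * ?d + 2 * N"
    by (simp add: sum.distrib N_def sum_phi_sq flip: sum_distrib_left)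
  also have "\<dots> \<le> 2 * ?d + 2 * ?d" using N by simp
  also have "\<dots> = 2 * real (Dim m) / pi" by (simp add: field_simps)
  finally show ?thesis .
qed

lemma noise_bounded: "\<bar>noise f ob l\<bar> \<le> sqrt (2 * real (Dim l) / pi)"
proof -
  \<comment> \<open>The model of index \<open>l\<close> contains the coordinate \<open>l\<close>; a
    crude bound is enough for integrability.\<close>
  have "(noise f ob l)\<^sup>2 \<le> (\<Sum>k\<le>2*l. (noise f ob k)\<^sup>2)" by (intro member_le_sum) auto
  also note sum_noise_sq_le
  finally show ?thesis by (intro real_le_rsqrt) simp
qed

text \<open>Independence as Fubini: X is integrated with the arc \<open>p\<close> held fixed, which
  stands in for conditioning on the arc.\<close>

lemma expectation_obs_law:
  assumes h: "h \<in> borel_measurable (obs_law f Q)" and b: "\<And>ob. \<bar>h ob\<bar> \<le> (B::real)"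
  shows "integrable (obs_law f Q) h"
    and "(\<integral>ob. h ob \<partial>obs_law f Q) = (\<integral>p. (\<integral>x. h (x, p) \<partial>X_law) \<partial>Q)"
    and "integrable Q (\<lambda>p. \<integral>x. h (x, p) \<partial>X_law)"
proof -
  interpret O: prob_space "obs_law f Q" by (rule prob_space_obs_law)
  show i: "integrable (obs_law f Q) h"
    using h b by (intro O.integrable_const_bound[of _ B]) auto
  hence i': "integrable (X_law \<Otimes>\<^sub>M Q) (case_prod (\<lambda>x p. h (x, p)))" by (simp add: obs_law_eq)
  show "(\<integral>ob. h ob \<partial>obs_law f Q) = (\<integral>p. (\<integral>x. h (x, p) \<partial>X_law) \<partial>Q)"
    using XQ.integral_snd[OF i'] by (simp add: obs_law_eq)
  show "integrable Q (\<lambda>p. \<integral>x. h (x, p) \<partial>X_law)"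
    using XQ.integrable_snd[OF i'] .
qed

lemma noise_mean: "(\<integral>ob. noise f ob l \<partial>obs_law f Q) = 0"
proof -
  have "(\<integral>x. noise f (x, p) l \<partial>X_law) = 0" for p
  proof -
    let ?w = "\<lambda>x. indicator (arc (fst p) (snd p)) x :: real"
    have [measurable]: "(\<lambda>x. ?w x * phi l x) \<in> borel_measurable borel" by simp
    have i: "integrable X_law (\<lambda>x. ?w x * phi l x)"
      using phi_bound by (intro X.integrable_const_bound[of _ 1] X_law_measurable) (auto simp: indicator_def)
    have "(\<integral>x. noise f (x, p) l \<partial>X_law) = (\<integral>x. ?w x * phi l x \<partial>X_law) - (\<integral>x. ?w x * f x * phi l x \<partial>lcirc)"
      unfolding noise_def Delta_def using i by (simp add: X.prob_space[simplified])
    also have "(\<integral>x. ?w x * phi l x \<partial>X_law) = (\<integral>x. ?w x * f x * phi l x \<partial>lcirc)"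
      by (subst integral_X_law) (auto simp: mult_ac)
    finally show ?thesis by simp
  qed
  thus ?thesis using expectation_obs_law(2)[OF noise_measurable noise_bounded] by simp
qed

text \<open>Given the arc, a variance is at most a second moment, and the density is at most
  \<open>v\<close>; orthonormality finishes. The absence of \<open>Dim m\<close> is essential, since
  this bound ends up in the exponent of \<open>exp (20800 * v)\<close>.\<close>

lemma noise_variance:
  "(\<integral>ob. (\<Sum>l\<le>2*m. noise f ob l * r l)\<^sup>2 \<partial>obs_law f Q) \<le> v * (\<Sum>l\<le>2*m. (r l)\<^sup>2)"
proof -
  let ?h = "\<lambda>ob. (\<Sum>l\<le>2*m. noise f ob l * r l)\<^sup>2"
  have h: "?h \<in> borel_measurable (obs_law f Q)"
    by (intro borel_measurable_power borel_measurable_sum borel_measurable_times noise_measurable) auto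
  have b: "\<bar>?h ob\<bar> \<le> 2 * real (Dim m) / pi * (\<Sum>l\<le>2*m. (r l)\<^sup>2)" for ob
  proof -
    have "?h ob \<le> (\<Sum>l\<le>2*m. (noise f ob l)\<^sup>2) * (\<Sum>l\<le>2*m. (r l)\<^sup>2)" by (rule Cauchy_Schwarz_ineq_sum)
    also have "\<dots> \<le> 2 * real (Dim m) / pi * (\<Sum>l\<le>2*m. (r l)\<^sup>2)"
      by (intro mult_right_mono sum_noise_sq_le sum_nonneg) auto
    finally show ?thesis by simp
  qed
  obtain T where T: "\<And>x. \<bar>trig_poly m r x\<bar> \<le> T" using trig_poly_bounded by blast
  have inner: "(\<integral>x. ?h (x, p) \<partial>X_law) \<le> v * (\<Sum>l\<le>2*m. (r l)\<^sup>2)" for p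
  proof -
    let ?w = "\<lambda>x. indicator (arc (fst p) (snd p)) x :: real"
    let ?t = "\<lambda>x. ?w x * trig_poly m r x"
    have t [measurable]: "?t \<in> borel_measurable borel" by simp
    have it: "integrable X_law ?t" 
      using T by (intro X.integrable_const_bound[of _ T] X_law_measurable)
        (auto simp: indicator_def intro: order.trans[OF abs_ge_zero T])
    have it2: "integrable X_law (\<lambda>x. (?t x)\<^sup>2)"
    proof (intro X.integrable_const_bound[of _ "T\<^sup>2"] X_law_measurable AE_I2)
      fix x
      have "(trig_poly m r x)\<^sup>2 \<le> T\<^sup>2" using power_mono[OF T[of x], of 2] by simp
      thus "norm ((?t x)\<^sup>2) \<le> T\<^sup>2" by (auto simp: indicator_def)
    qed simp
    have c: "(\<integral>x. ?w x * f x * trig_poly m r x \<partial>lcirc) = X.expectation ?t"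
      by (subst integral_X_law) (auto simp: mult_ac)
    have "(\<integral>x. ?h (x, p) \<partial>X_law) = X.variance ?t"
      unfolding sum_noise by (simp add: c Delta_def)
    also have "\<dots> = X.expectation (\<lambda>x. (?t x)\<^sup>2) - (X.expectation ?t)\<^sup>2"
      by (rule X.variance_eq[OF it it2])
    also have "\<dots> \<le> X.expectation (\<lambda>x. (?t x)\<^sup>2)" by simp
    also have "\<dots> = (\<integral>x. f x * (?t x)\<^sup>2 \<partial>lcirc)" by (subst integral_X_law) auto
    also have "\<dots> \<le> (\<integral>x. v * 1 * trig_poly m r x * trig_poly m r x \<partial>lcirc)"
    proof (rule integral_mono_AE)
      have "integrable lcirc (\<lambda>x. f x * trig_poly m r x * trig_poly m r x)"
        by (rule integral_weighted_trig_poly_prod[OF f_integrable])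
      thus "integrable lcirc (\<lambda>x. f x * (?t x)\<^sup>2)"
        by (rule Bochner_Integration.integrable_bound)
           (auto simp: indicator_def power2_eq_square intro!: lcirc_measurable)
      show "integrable lcirc (\<lambda>x. v * 1 * trig_poly m r x * trig_poly m r x)"
        by (rule integral_weighted_trig_poly_prod) simp
      show "AE x in lcirc. f x * (?t x)\<^sup>2 \<le> v * 1 * trig_poly m r x * trig_poly m r x"
        using f_le AE_lcirc_circ
      proof eventually_elim
        case (elim x)
        have "f x * (?t x)\<^sup>2 \<le> v * (trig_poly m r x)\<^sup>2"
          using elim f_nonneg[of x] by (intro mult_mono) (auto simp: indicator_def)
        thus ?case by (simp add: power2_eq_square)
      qed
    qed
    also have "\<dots> = v * L2sq (trig_poly m r)" by (simp add: L2sq_lcirc power2_eq_square mult.assoc)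
    finally show ?thesis by (simp add: L2sq_trig_poly)
  qed
  have "(\<integral>ob. ?h ob \<partial>obs_law f Q) = (\<integral>p. (\<integral>x. ?h (x, p) \<partial>X_law) \<partial>Q)"
    by (rule expectation_obs_law(2)[OF h b])
  also have "\<dots> \<le> (\<integral>p. v * (\<Sum>l\<le>2*m. (r l)\<^sup>2) \<partial>Q)"
    using inner by (intro integral_mono_AE expectation_obs_law(3)[OF h b]) auto
  also have "\<dots> = v * (\<Sum>l\<le>2*m. (r l)\<^sup>2)" using Q.prob_space by simp
  finally show ?thesis .
qed

text \<open>The range of models supplies the side conditions on \<open>B = 2 * Dim m / pi\<close>:
  \<open>m \<ge> 1\<close> makes it at least 1, and \<open>2 * m + 1 \<le> n\<close> makes it at
  most \<open>n\<close>.\<close>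

lemma noise_sixth_moment:
  assumes "n \<ge> 4" "m \<in> Mset n"
  shows "(\<integral>\<^sup>+\<omega>. ennreal ((offdiag {..2*m} (noise f) n \<omega>)^6) \<partial>sample_law f Q n)
    \<le> ennreal (exp (20800 * v) * real n ^ 6 * (2 * real (Dim m) / pi)^3)"
  unfolding sample_law_def
proof (rule prob_space.offdiag_sixth_moment[OF prob_space_obs_law])
  have m: "1 \<le> m" "2 * m + 1 \<le> n" using assms by (auto simp: Mset_def)
  show "1 \<le> 2 * real (Dim m) / pi" using m pi_less_4 by (simp add: Dim_def field_simps)
  have "2 * real (Dim m) \<le> pi * real n" using m pi_gt3
    by (intro mult_mono) (auto simp: Dim_def)
  thus "2 * real (Dim m) / pi \<le> real n" by (simp add: field_simps)
qed (use assms v_nonneg noise_measurable sum_noise_sq_le noise_mean noise_variance in auto)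

text \<open>The case of a single coordinate, with \<open>B = v = 1\<close>.\<close>

lemma frequency_sixth_moment:
  fixes A :: "(real \<times> real) set"
  assumes n: "n \<ge> 1" and A: "A \<in> sets borel"
  shows "(\<integral>\<^sup>+\<omega>. ennreal ((offdiag {0} (\<lambda>ob _. indicator A (snd ob) - measure Q A) n \<omega>)^6) \<partial>sample_law f Q n)
    \<le> ennreal (exp 20800 * real n ^ 6)"
proof -
  interpret O: prob_space "obs_law f Q" by (rule prob_space_obs_law)
  let ?Y = "\<lambda>ob :: obs. indicator A (snd ob) - measure Q A"
  have Y [measurable]: "?Y \<in> borel_measurable (obs_law f Q)"
    using A by (intro obs_measurable) simp
  have b: "\<bar>?Y ob\<bar> \<le> 1" for ob
  proof -
    have "0 \<le> measure Q A" "measure Q A \<le> 1" "0 \<le> (indicator A (snd ob) :: real)" "(indicator A (snd ob) :: real) \<le> 1"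
      by (auto simp: indicator_def)
    thus ?thesis by linarith
  qed
  have b2: "(?Y ob)\<^sup>2 \<le> 1" for ob using b[of ob] by (simp add: abs_square_le_1)
  have AQ: "A \<in> sets Q" using A Q by simp
  have mean: "(\<integral>ob. ?Y ob \<partial>obs_law f Q) = 0"
  proof -
    have i: "integrable Q (indicator A :: _ \<Rightarrow> real)"
      using AQ by (intro integrable_real_indicator) (auto simp: Q.emeasure_eq_measure)
    have "(\<integral>ob. ?Y ob \<partial>obs_law f Q) = (\<integral>p. indicator A p - measure Q A \<partial>Q)"
      using X.prob_space by (subst expectation_obs_law(2)[OF Y b]) simp
    also have "\<dots> = 0" using i AQ Q.prob_space by (simp add: space_Q)
    finally show ?thesis .
  qed
  have "(\<integral>\<^sup>+\<omega>. ennreal ((offdiag {0} (\<lambda>ob _. ?Y ob) n \<omega>)^6) \<partial>PiM {..<n} (\<lambda>_. obs_law f Q))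
    \<le> ennreal (exp (20800 * 1) * real n ^ 6 * 1^3)"
  proof (rule O.offdiag_sixth_moment)
    fix r :: "nat \<Rightarrow> real"
    have "(\<integral>ob. (\<Sum>l\<in>{0}. ?Y ob * r l)\<^sup>2 \<partial>obs_law f Q) \<le> (\<integral>ob. (r 0)\<^sup>2 \<partial>obs_law f Q)"
    proof (rule integral_mono_AE)
      have le: "(\<Sum>l\<in>{0}. ?Y ob * r l)\<^sup>2 \<le> (r 0)\<^sup>2" for ob
        using mult_right_mono[OF b2[of ob], of "(r 0)\<^sup>2"] by (simp add: power_mult_distrib)
      show "integrable (obs_law f Q) (\<lambda>ob. (\<Sum>l\<in>{0}. ?Y ob * r l)\<^sup>2)"
        using le by (intro O.integrable_const_bound[of _ "(r 0)\<^sup>2"]) auto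
      show "AE ob in obs_law f Q. (\<Sum>l\<in>{0}. ?Y ob * r l)\<^sup>2 \<le> (r 0)\<^sup>2" using le by auto
    qed simp
    thus "(\<integral>ob. (\<Sum>l\<in>{0}. ?Y ob * r l)\<^sup>2 \<partial>obs_law f Q) \<le> 1 * (\<Sum>l\<in>{0}. (r l)\<^sup>2)"
      using O.prob_space by simp
  qed (use n b2 mean in auto)
  thus ?thesis by (simp add: sample_law_def)
qed

end

section \<open>Oracle inequality on good samples\<close>

lemma sigma_hat_measurable [measurable]: "sigma_hat n \<omega> \<in> borel_measurable borel"
  unfolding sigma_hat_def[abs_def] by measurable

lemma sigma_hat_bounds: "0 \<le> sigma_hat n \<omega> x" "sigma_hat n \<omega> x \<le> 1"
proof -
  let ?S = "\<Sum>i<n. indicator (arc (fst (snd (\<omega> i))) (snd (snd (\<omega> i)))) x :: real"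
  have "?S \<le> (\<Sum>i<n. 1)" by (intro sum_mono) (auto simp: indicator_def)
  hence "?S \<le> real n" by simp
  thus "sigma_hat n \<omega> x \<le> 1" unfolding sigma_hat_def by (cases "n = 0") auto
  show "0 \<le> sigma_hat n \<omega> x" unfolding sigma_hat_def by (intro mult_nonneg_nonneg sum_nonneg) auto
qed

lemma sigma_hat_mult_integrable:
  assumes g: "integrable lcirc (g :: real \<Rightarrow> real)"
  shows "integrable lcirc (\<lambda>x. sigma_hat n \<omega> x * g x)"
proof (rule Bochner_Integration.integrable_bound[OF g])
  show "AE x in lcirc. norm (sigma_hat n \<omega> x * g x) \<le> norm (g x)"
    using sigma_hat_bounds[of n \<omega>] by (auto simp: abs_mult mult_left_le_one_le)
qed (intro borel_measurable_times borel_measurable_integrable[OF g] lcirc_measurable sigma_hat_measurable)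

lemma integral_sigma_hat:
  assumes g: "integrable lcirc (g :: real \<Rightarrow> real)"
  shows "(1 / real n) * (\<Sum>i<n. \<integral>x. indicator (arc (fst (snd (\<omega> i))) (snd (snd (\<omega> i)))) x * g x \<partial>lcirc)
    = (\<integral>x. sigma_hat n \<omega> x * g x \<partial>lcirc)"
proof -
  let ?w = "\<lambda>i x. indicator (arc (fst (snd (\<omega> i))) (snd (snd (\<omega> i)))) x :: real"
  have i: "integrable lcirc (\<lambda>x. ?w i x * g x)" for i
  proof (rule Bochner_Integration.integrable_bound[OF g])
    show "(\<lambda>x. ?w i x * g x) \<in> borel_measurable lcirc"
      by (intro borel_measurable_times borel_measurable_integrable[OF g] lcirc_measurable) simp
  qed (auto simp: indicator_def)
  have "(\<integral>x. sigma_hat n \<omega> x * g x \<partial>lcirc) = (\<integral>x. (1 / real n) * (\<Sum>i<n. ?w i x * g x) \<partial>lcirc)"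
    by (simp add: sigma_hat_def sum_distrib_right mult.assoc)
  also have "\<dots> = (1 / real n) * (\<Sum>i<n. \<integral>x. ?w i x * g x \<partial>lcirc)"
    by (simp only: integral_mult_right_zero Bochner_Integration.integral_sum[OF i])
  finally show ?thesis by simp
qed

text \<open>The placeholder \<open>-pi\<close> in \<open>Xp\<close> occurs only where
  \<open>Delta\<close> vanishes.\<close>

lemma Delta_Xp: "Delta ob * t (Xp ob) = Delta ob * t (fst ob)"
  by (auto simp: Xp_def Delta_def indicator_def)

text \<open>Padding with zeros moves nested models into one coefficient space, where their elements
  can be subtracted.\<close>

lemma trig_poly_extend:
  assumes "m \<le> M"
  shows "trig_poly m a = trig_poly M (\<lambda>l. if l \<le> 2*m then a l else 0)"
    and "(\<Sum>l\<le>2*m. a l * (b l :: real)) = (\<Sum>l\<le>2*M. (if l \<le> 2*m then a l else 0) * b l)"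
proof -
  show *: "(\<Sum>l\<le>2*m. a l * (b l :: real)) = (\<Sum>l\<le>2*M. (if l \<le> 2*m then a l else 0) * b l)" for b
    using assms by (intro sum.mono_neutral_cong_left) auto
  show "trig_poly m a = trig_poly M (\<lambda>l. if l \<le> 2*m then a l else 0)"
    unfolding trig_poly_def fun_eq_iff by (intro allI *)
qed

lemma trig_poly_diff: "trig_poly m a x - trig_poly m b x = trig_poly m (\<lambda>l. a l - b l) x"
  by (simp add: trig_poly_def sum_subtractf left_diff_distrib)

lemma integrable_const_lcirc: "integrable lcirc (\<lambda>_. 1 :: real)" by simp

lemmas trig_poly_prod_integrable = integral_weighted_trig_poly_prod(1)[OF integrable_const_lcirc, simplified]

text \<open>One fixed sample whose empirical coverage is at least \<open>s\<close>. Everything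
  inside is deterministic; probability returns only when these samples are shown to be
  typical.\<close>

locale good_sample = arc_model f Q v for f Q v +
  fixes n :: nat and \<omega> :: "nat \<Rightarrow> obs" and s :: real
  assumes n: "n \<ge> 4" and s: "s > 0"
    and arcs: "\<And>i. i < n \<Longrightarrow> fst (snd (\<omega> i)) \<in> circ \<and> snd (snd (\<omega> i)) \<in> circ"
    and low: "\<And>x. x \<in> circ \<Longrightarrow> s \<le> sigma_hat n \<omega> x"
begin

abbreviation "sig \<equiv> sigma_hat n \<omega>"

definition nu :: "nat \<Rightarrow> real" where
  "nu l = (1 / real n) * (\<Sum>i<n. noise f (\<omega> i) l)"

text \<open>\<open>Ghat\<close> integrates over arcs as subsets of the line. Endpoints on the circle
  keep the arcs inside it, and averaging their indicators produces the weight
  \<open>sig\<close>.\<close>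

lemma Ghat_index:
  assumes "l < Dim m" "k < Dim m"
  shows "Ghat n \<omega> m $$ (l, k) = (\<integral>x. sig x * phi l x * phi k x \<partial>lcirc)"
proof -
  have i: "integrable lcirc (\<lambda>x. phi l x * phi k x)"
    using mult_le_one[OF phi_bound _ phi_bound] by (intro integrable_lcirc[of _ 1]) (auto simp: abs_mult)
  have "(\<integral>x\<in>arc a b. phi l x * phi k x \<partial>lborel) = (\<integral>x. indicator (arc a b) x * (phi l x * phi k x) \<partial>lcirc)"
    if "a \<in> circ" "b \<in> circ" for a b
    unfolding integral_circ[symmetric] set_lebesgue_integral_def
    using arc_subset_circ[OF that] by (intro Bochner_Integration.integral_cong) (auto simp: indicator_def)
  hence "Ghat n \<omega> m $$ (l, k) = (1 / real n) * (\<Sum>i<n. \<integral>x. indicator (arc (fst (snd (\<omega> i))) (snd (snd (\<omega> i)))) x * (phi l x * phi k x) \<partial>lcirc)"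
    unfolding Ghat_def using assms arcs by simp
  also have "\<dots> = (\<integral>x. sig x * (phi l x * phi k x) \<partial>lcirc)" by (rule integral_sigma_hat[OF i])
  finally show ?thesis by (simp add: mult.assoc)
qed

lemma sig_integrable: "integrable lcirc sig"
  using sigma_hat_mult_integrable[OF integrable_const_lcirc] by simp

lemma Ghat_carrier: "Ghat n \<omega> m \<in> carrier_mat (Dim m) (Dim m)"
  by (simp add: Ghat_def)

lemma Ghat_sym: "transpose_mat (Ghat n \<omega> m) = Ghat n \<omega> m"
  using Ghat_carrier[of m] by (intro eq_matI) (auto simp: Ghat_index mult_ac)

lemma atLeast0_Dim: "{0..<Dim m} = {..2*m}"
  by (auto simp: Dim_def)

lemma Ghat_form:
  assumes x: "x \<in> carrier_vec (Dim m)" and y: "y \<in> carrier_vec (Dim m)"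
  shows "scalar_prod x (Ghat n \<omega> m *\<^sub>v y) = (\<integral>u. sig u * trig_poly m (($) x) u * trig_poly m (($) y) u \<partial>lcirc)"
proof -
  have "scalar_prod x (Ghat n \<omega> m *\<^sub>v y) = (\<Sum>l\<in>{0..<Dim m}. x $ l * (\<Sum>k\<in>{0..<Dim m}. Ghat n \<omega> m $$ (l, k) * y $ k))"
    unfolding scalar_prod_def using Ghat_carrier[of m] y
    by (intro sum.cong) (auto simp: scalar_prod_def intro!: sum.cong)
  also have "\<dots> = (\<Sum>l\<le>2*m. \<Sum>k\<le>2*m. x $ l * y $ k * (\<integral>u. sig u * phi l u * phi k u \<partial>lcirc))"
    unfolding atLeast0_Dim
    by (intro sum.cong refl) (auto simp: Ghat_index Dim_def sum_distrib_left mult_ac intro!: sum.cong)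
  finally show ?thesis unfolding integral_weighted_trig_poly_prod(2)[OF sig_integrable] .
qed

lemma scalar_prod_L2sq:
  assumes x: "x \<in> carrier_vec (Dim m)"
  shows "scalar_prod x x = L2sq (trig_poly m (($) x))"
  unfolding L2sq_trig_poly scalar_prod_def using x by (simp add: atLeast0_Dim power2_eq_square)

lemma weighted_ge:
  assumes "integrable lcirc (\<lambda>x. (g x)\<^sup>2)"
  shows "s * L2sq g \<le> (\<integral>x. sig x * (g x)\<^sup>2 \<partial>lcirc)"
proof -
  have "(\<integral>x. s * (g x)\<^sup>2 \<partial>lcirc) \<le> (\<integral>x. sig x * (g x)\<^sup>2 \<partial>lcirc)"
    using low assms by (intro integral_mono_AE sigma_hat_mult_integrable) (auto intro!: mult_right_mono)
  thus ?thesis by (simp add: L2sq_lcirc)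
qed

lemma weighted_le:
  assumes "integrable lcirc (\<lambda>x. (g x)\<^sup>2)"
  shows "(\<integral>x. sig x * (g x)\<^sup>2 \<partial>lcirc) \<le> L2sq g"
  unfolding L2sq_lcirc using assms sigma_hat_bounds[of n \<omega>]
  by (intro integral_mono_AE sigma_hat_mult_integrable) (auto intro!: mult_left_le_one_le)

lemma Ghat_coercive:
  assumes x: "x \<in> carrier_vec (Dim m)"
  shows "s * scalar_prod x x \<le> scalar_prod x (Ghat n \<omega> m *\<^sub>v x)"
  unfolding Ghat_form[OF x x] scalar_prod_L2sq[OF x]
  using weighted_ge[of "trig_poly m (($) x)"] trig_poly_prod_integrable[of m "($) x" "($) x"]
  by (simp add: power2_eq_square mult.assoc)

lemma Dim_pos: "Dim m > 0" by (simp add: Dim_def)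

lemma Ghat_minv:
  shows "minv (Ghat n \<omega> m) \<in> carrier_mat (Dim m) (Dim m)" "Ghat n \<omega> m * minv (Ghat n \<omega> m) = 1\<^sub>m (Dim m)"
  by (rule coercive_minv[OF Ghat_carrier Ghat_sym Dim_pos s Ghat_coercive]; assumption)+

lemma Ghat_opnorm:
  shows "opnorm (minv (Ghat n \<omega> m)) \<le> 1 / s"
    and "x \<in> carrier_vec (Dim m) \<Longrightarrow> scalar_prod x x \<le> opnorm (minv (Ghat n \<omega> m)) * scalar_prod x (Ghat n \<omega> m *\<^sub>v x)"
  by (rule coercive_opnorm_minv[OF Ghat_carrier Ghat_sym Dim_pos s Ghat_coercive]; assumption)+

text \<open>The factor is literally the one in \<open>pen\<close>; this is what lets the penalty
  absorb the noise without a constant depending on \<open>s\<close>.\<close>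

lemma L2sq_le_opnorm:
  "L2sq (trig_poly m a) \<le> opnorm (minv (Ghat n \<omega> m)) * (\<integral>x. sig x * (trig_poly m a x)\<^sup>2 \<partial>lcirc)"
proof -
  let ?x = "vec (Dim m) a"
  have x: "?x \<in> carrier_vec (Dim m)" by simp
  have t: "trig_poly m (($) ?x) = trig_poly m a"
    by (auto simp: trig_poly_def fun_eq_iff Dim_def intro!: sum.cong)
  show ?thesis using Ghat_opnorm(2)[OF x] unfolding Ghat_form[OF x x] scalar_prod_L2sq[OF x] t
    by (simp add: power2_eq_square mult.assoc)
qed

lemma opnorm_pos: "opnorm (minv (Ghat n \<omega> m)) > 0"
proof (rule ccontr)
  \<comment> \<open>Any nonzero polynomial would do as a witness.\<close>
  let ?t = "trig_poly m (\<lambda>_. 1)"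
  assume "\<not> ?thesis"
  hence "opnorm (minv (Ghat n \<omega> m)) * (\<integral>x. sig x * (?t x)\<^sup>2 \<partial>lcirc) \<le> 0"
    using sigma_hat_bounds[of n \<omega>] by (intro mult_nonpos_nonneg Bochner_Integration.integral_nonneg) auto
  with L2sq_le_opnorm[of m "\<lambda>_. 1"] have "L2sq ?t \<le> 0" by simp
  thus False by (simp add: L2sq_trig_poly)
qed

lemma pen_nonneg: "\<kappa> \<ge> 0 \<Longrightarrow> pen \<kappa> n \<omega> m \<ge> 0"
  unfolding pen_def using opnorm_pos[of m] by simp

lemma pen_le:
  assumes "\<kappa> \<ge> 0"
  shows "pen \<kappa> n \<omega> m \<le> (\<kappa> * real (Dim m) / real n) / (2 * pi * s)"
proof -
  have "pen \<kappa> n \<omega> m = (\<kappa> * real (Dim m) / real n) / (2 * pi) * opnorm (minv (Ghat n \<omega> m))"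
    by (simp add: pen_def mult_ac)
  also have "\<dots> \<le> (\<kappa> * real (Dim m) / real n) / (2 * pi) * (1 / s)"
    using assms Ghat_opnorm(1)[of m] by (intro mult_left_mono) auto
  finally show ?thesis by simp
qed

lemma fring_trig_poly: "fring n \<omega> m = trig_poly m (($) (ahat n \<omega> m))"
  by (simp add: fun_eq_iff fring_def trig_poly_def)

lemma weighted_trig_poly_integrable:
  "integrable lcirc (\<lambda>x. sig x * (trig_poly m a x)\<^sup>2)"
  "integrable lcirc (\<lambda>x. sig x * f x * trig_poly m a x)"
  "integrable lcirc (\<lambda>x. sig x * (f x)\<^sup>2)"
  "integrable lcirc (\<lambda>x. (trig_poly m a x - f x)\<^sup>2)"
proof -
  show "integrable lcirc (\<lambda>x. sig x * (trig_poly m a x)\<^sup>2)"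
    using integral_weighted_trig_poly_prod(1)[OF sig_integrable] by (simp add: power2_eq_square mult.assoc)
  show "integrable lcirc (\<lambda>x. sig x * f x * trig_poly m a x)"
    by (intro integral_weighted_trig_poly(2) sigma_hat_mult_integrable f_integrable)
  show "integrable lcirc (\<lambda>x. sig x * (f x)\<^sup>2)"
    by (intro sigma_hat_mult_integrable f_sq_integrable)
  have "(\<lambda>x. (trig_poly m a x - f x)\<^sup>2) = (\<lambda>x. trig_poly m a x * trig_poly m a x - 2 * (f x * trig_poly m a x) + (f x)\<^sup>2)"
    by (auto simp: fun_eq_iff power2_eq_square algebra_simps)
  moreover have "integrable lcirc (\<lambda>x. f x * trig_poly m a x)"
    by (rule integral_weighted_trig_poly(2)[OF f_integrable])
  ultimately show "integrable lcirc (\<lambda>x. (trig_poly m a x - f x)\<^sup>2)"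
    using trig_poly_prod_integrable f_sq_integrable by simp
qed

text \<open>Each observed term is its noise plus its mean given the arc; averaging the means brings
  back the weight \<open>sig\<close>.\<close>

lemma Uhat_form:
  "(1 / real n) * (\<Sum>i<n. Delta (\<omega> i) * trig_poly m a (fst (\<omega> i)))
    = (\<Sum>l\<le>2*m. a l * nu l) + (\<integral>x. sig x * f x * trig_poly m a x \<partial>lcirc)"
proof -
  let ?w = "\<lambda>i x. indicator (arc (fst (snd (\<omega> i))) (snd (snd (\<omega> i)))) x :: real"
  have "Delta (\<omega> i) * trig_poly m a (fst (\<omega> i)) = (\<Sum>l\<le>2*m. noise f (\<omega> i) l * a l)
      + (\<integral>x. ?w i x * (f x * trig_poly m a x) \<partial>lcirc)" for i
    unfolding sum_noise by (simp add: mult.assoc)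
  hence "(1 / real n) * (\<Sum>i<n. Delta (\<omega> i) * trig_poly m a (fst (\<omega> i)))
    = (1 / real n) * (\<Sum>i<n. \<Sum>l\<le>2*m. noise f (\<omega> i) l * a l) + (1 / real n) * (\<Sum>i<n. \<integral>x. ?w i x * (f x * trig_poly m a x) \<partial>lcirc)"
    by (simp only: sum.distrib distrib_left)
  also have "(1 / real n) * (\<Sum>i<n. \<integral>x. ?w i x * (f x * trig_poly m a x) \<partial>lcirc) = (\<integral>x. sig x * (f x * trig_poly m a x) \<partial>lcirc)"
    by (intro integral_sigma_hat integral_weighted_trig_poly(2) f_integrable)
  also have "(\<Sum>i<n. \<Sum>l\<le>2*m. noise f (\<omega> i) l * a l) = (\<Sum>l\<le>2*m. a l * (\<Sum>i<n. noise f (\<omega> i) l))"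
    by (subst sum.swap) (simp add: sum_distrib_left mult.commute)
  also have "(1 / real n) * \<dots> = (\<Sum>l\<le>2*m. a l * nu l)"
    by (simp add: nu_def sum_distrib_left)
  finally show ?thesis by (simp add: mult.assoc)
qed

lemma zeta_trig_poly:
  "zeta n \<omega> (trig_poly m a) = (\<integral>x. sig x * (trig_poly m a x)\<^sup>2 \<partial>lcirc)
     - 2 * ((1 / real n) * (\<Sum>i<n. Delta (\<omega> i) * trig_poly m a (fst (\<omega> i))))"
proof -
  let ?t = "trig_poly m a"
  let ?w = "\<lambda>i x. indicator (arc (fst (snd (\<omega> i))) (snd (snd (\<omega> i)))) x :: real"
  have i: "integrable lcirc (\<lambda>x. (?t x)\<^sup>2)"
    using trig_poly_prod_integrable by (simp add: power2_eq_square)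
  have "zeta n \<omega> ?t = (1 / real n) * (\<Sum>i<n. (\<integral>x. ?w i x * (?t x)\<^sup>2 \<partial>lcirc) - 2 * (Delta (\<omega> i) * ?t (fst (\<omega> i))))"
    unfolding zeta_def integral_circ by (simp add: mult.assoc Delta_Xp mult.commute[of "(?t _)\<^sup>2"])
  also have "\<dots> = (1 / real n) * (\<Sum>i<n. \<integral>x. ?w i x * (?t x)\<^sup>2 \<partial>lcirc) - 2 * ((1 / real n) * (\<Sum>i<n. Delta (\<omega> i) * ?t (fst (\<omega> i))))"
    by (simp add: sum_subtractf right_diff_distrib flip: sum_distrib_left)
  finally show ?thesis unfolding integral_sigma_hat[OF i] .
qed

text \<open>Since \<open>fring\<close> solves the normal equations, the gap between the two
  contrasts is the squared empirical norm of the difference of the two polynomials.\<close>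

lemma fring_minimizes: "zeta n \<omega> (fring n \<omega> m) \<le> zeta n \<omega> (trig_poly m a)"
proof -
  define A where "A = ahat n \<omega> m"
  let ?t = "trig_poly m (($) A)"
  have A: "A \<in> carrier_vec (Dim m)"
    unfolding A_def ahat_def using Ghat_minv(1)[of m] by (simp add: Uhat_def)
  have U: "Uhat n \<omega> m \<in> carrier_vec (Dim m)" by (simp add: Uhat_def)
  have GA: "Ghat n \<omega> m *\<^sub>v A = Uhat n \<omega> m"
    unfolding A_def ahat_def using Ghat_minv[of m] Ghat_carrier[of m] U by (simp flip: assoc_mult_mat_vec)
  \<comment> \<open>The normal equations \<open>Ghat *\<^sub>v ahat = Uhat\<close>, tested against
    an arbitrary polynomial.\<close>
  have lin: "(1 / real n) * (\<Sum>i<n. Delta (\<omega> i) * trig_poly m b (fst (\<omega> i))) = (\<integral>x. sig x * trig_poly m b x * ?t x \<partial>lcirc)" for b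
  proof -
    let ?b = "vec (Dim m) b"
    have t: "trig_poly m (($) ?b) = trig_poly m b"
      by (auto simp: trig_poly_def fun_eq_iff Dim_def intro!: sum.cong)
    have "(\<integral>x. sig x * trig_poly m b x * ?t x \<partial>lcirc) = scalar_prod ?b (Uhat n \<omega> m)"
      using Ghat_form[of ?b m A] A GA t by simp
    also have "\<dots> = (\<Sum>l\<le>2*m. b l * ((1 / real n) * (\<Sum>i<n. Delta (\<omega> i) * phi l (fst (\<omega> i)))))"
      unfolding scalar_prod_def using U
      by (auto simp: Uhat_def atLeast0_Dim[symmetric] intro!: sum.cong)
    also have "\<dots> = (1 / real n) * (\<Sum>l\<le>2*m. \<Sum>i<n. Delta (\<omega> i) * (b l * phi l (fst (\<omega> i))))"
      by (simp add: sum_distrib_left mult_ac)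
    also have "\<dots> = (1 / real n) * (\<Sum>i<n. Delta (\<omega> i) * trig_poly m b (fst (\<omega> i)))"
      by (subst sum.swap) (simp add: trig_poly_def sum_distrib_left)
    finally show ?thesis by simp
  qed
  let ?u = "trig_poly m a"
  note i = integral_weighted_trig_poly_prod(1)[OF sig_integrable]
  have "0 \<le> (\<integral>x. sig x * (?u x - ?t x)\<^sup>2 \<partial>lcirc)"
    using sigma_hat_bounds[of n \<omega>] by (intro Bochner_Integration.integral_nonneg) auto
  also have "\<dots> = (\<integral>x. sig x * ?u x * ?u x - 2 * (sig x * ?u x * ?t x) + sig x * ?t x * ?t x \<partial>lcirc)"
    by (intro Bochner_Integration.integral_cong) (auto simp: power2_eq_square algebra_simps)
  also have "\<dots> = (\<integral>x. sig x * ?u x * ?u x \<partial>lcirc) - 2 * (\<integral>x. sig x * ?u x * ?t x \<partial>lcirc) + (\<integral>x. sig x * ?t x * ?t x \<partial>lcirc)"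
    using i by simp
  finally show ?thesis
    unfolding fring_trig_poly A_def[symmetric] zeta_trig_poly lin by (simp add: power2_eq_square mult.assoc)
qed

lemma zeta_excess:
  "zeta n \<omega> (trig_poly m a) = (\<integral>x. sig x * (trig_poly m a x - f x)\<^sup>2 \<partial>lcirc)
     - (\<integral>x. sig x * (f x)\<^sup>2 \<partial>lcirc) - 2 * (\<Sum>l\<le>2*m. a l * nu l)"
proof -
  let ?t = "trig_poly m a"
  have "(\<integral>x. sig x * (?t x - f x)\<^sup>2 \<partial>lcirc)
    = (\<integral>x. sig x * (?t x)\<^sup>2 - 2 * (sig x * f x * ?t x) + sig x * (f x)\<^sup>2 \<partial>lcirc)"
    by (intro Bochner_Integration.integral_cong) (auto simp: power2_eq_square algebra_simps)
  also have "\<dots> = (\<integral>x. sig x * (?t x)\<^sup>2 \<partial>lcirc) - 2 * (\<integral>x. sig x * f x * ?t x \<partial>lcirc) + (\<integral>x. sig x * (f x)\<^sup>2 \<partial>lcirc)"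
    using weighted_trig_poly_integrable by simp
  finally show ?thesis unfolding zeta_trig_poly Uhat_form by simp
qed

text \<open>\<open>LEAST\<close> is meaningful because \<open>n \<ge> 4\<close> makes the finite set
  of models nonempty.\<close>

lemma mhat_props:
  shows "mhat \<kappa> n \<omega> \<in> Mset n"
    and "m \<in> Mset n \<Longrightarrow> zeta n \<omega> (fring n \<omega> (mhat \<kappa> n \<omega>)) + pen \<kappa> n \<omega> (mhat \<kappa> n \<omega>)
           \<le> zeta n \<omega> (fring n \<omega> m) + pen \<kappa> n \<omega> m"
proof -
  let ?c = "\<lambda>m. zeta n \<omega> (fring n \<omega> m) + pen \<kappa> n \<omega> m"
  have fin: "finite (Mset n)" "Mset n \<noteq> {}" using n by (auto simp: Mset_def)
  have "\<exists>m. m \<in> Mset n \<and> (\<forall>m'\<in>Mset n. ?c m \<le> ?c m')"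
    using ex_is_arg_min_if_finite[OF fin, of ?c] by (auto simp: is_arg_min_linorder)
  from LeastI_ex[OF this, folded mhat_def]
  show "mhat \<kappa> n \<omega> \<in> Mset n" and "m \<in> Mset n \<Longrightarrow> ?c (mhat \<kappa> n \<omega>) \<le> ?c m" by auto
qed

text \<open>The difference of the selected estimator and the projection lies in the larger of the
  two models, where the noise has norm at most the square root of \<open>Z\<close>. After Young's
  inequality half of the loss moves to the left-hand side and the penalty of the selected model
  cancels.\<close>

lemma oracle_inequality:
  assumes k: "\<kappa> > 32" and m: "m \<in> Mset n"
  shows "L2sq (\<lambda>x. fring n \<omega> (mhat \<kappa> n \<omega>) x - f x)
    \<le> (3 / s + 1 / s\<^sup>2) * (L2sq (\<lambda>x. f x - proj f m x) + \<kappa> * real (Dim m) / real n)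
      + 8 / s\<^sup>2 * (\<Sum>M\<in>Mset n. max 0 ((\<Sum>l\<le>2*M. (nu l)\<^sup>2) - 5 * real (Dim M) / (2 * pi * real n)))"
proof -
  define mh where "mh = mhat \<kappa> n \<omega>"
  define a where "a = ($) (ahat n \<omega> mh)"
  define c where "c l = (\<integral>y\<in>circ. f y * phi l y \<partial>lborel)" for l
  \<comment> \<open>The models are nested, so this is the smallest one containing both
    polynomials.\<close>
  define M where "M = max m mh"
  define d where "d l = (if l \<le> 2*mh then a l else 0) - (if l \<le> 2*m then c l else 0)" for l
  define \<rho> where "\<rho> = opnorm (minv (Ghat n \<omega> M))"
  define Z where "Z = (\<Sum>l\<le>2*M. (nu l)\<^sup>2)"
  define P where "P M = max 0 ((\<Sum>l\<le>2*M. (nu l)\<^sup>2) - 5 * real (Dim M) / (2 * pi * real n))" for M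
  have mh: "mh \<in> Mset n" unfolding mh_def by (rule mhat_props)
  have M: "M \<in> Mset n" "m \<le> M" "mh \<le> M" using m mh by (auto simp: M_def max_def)
  have fh: "fring n \<omega> mh = trig_poly mh a" unfolding a_def by (rule fring_trig_poly)
  have pr: "proj f m = trig_poly m c" by (simp add: fun_eq_iff proj_def trig_poly_def c_def)
  define A where "A = (\<integral>x. sig x * (trig_poly mh a x - f x)\<^sup>2 \<partial>lcirc)"
  define B where "B = (\<integral>x. sig x * (trig_poly m c x - f x)\<^sup>2 \<partial>lcirc)"
  have rho: "0 < \<rho>" "\<rho> \<le> 1 / s" unfolding \<rho>_def by (rule opnorm_pos, rule Ghat_opnorm(1))
  have diff: "trig_poly mh a x - trig_poly m c x = trig_poly M d x" for x
    unfolding trig_poly_extend(1)[OF M(2), of c] trig_poly_extend(1)[OF M(3), of a] d_def by (rule trig_poly_diff)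
  have nud: "(\<Sum>l\<le>2*mh. a l * nu l) - (\<Sum>l\<le>2*m. c l * nu l) = (\<Sum>l\<le>2*M. d l * nu l)"
    unfolding trig_poly_extend(2)[OF M(2), of c] trig_poly_extend(2)[OF M(3), of a] d_def
    by (simp add: sum_subtractf left_diff_distrib)
  have "zeta n \<omega> (trig_poly mh a) + pen \<kappa> n \<omega> mh \<le> zeta n \<omega> (trig_poly m c) + pen \<kappa> n \<omega> m"
    using mhat_props(2)[OF m, of \<kappa>] fring_minimizes[of m c] unfolding mh_def[symmetric] fh by linarith
  hence main: "A + pen \<kappa> n \<omega> mh \<le> B + 2 * (\<Sum>l\<le>2*M. d l * nu l) + pen \<kappa> n \<omega> m"
    unfolding zeta_excess A_def[symmetric] B_def[symmetric] nud[symmetric] by simp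
  \<comment> \<open>The weight \<open>4 * \<rho>\<close> is chosen so that
    \<open>L2sq_le_opnorm\<close> turns the first term into a quarter of the squared empirical norm,
    at most \<open>A / 2 + B / 2\<close>.\<close>
  have "2 * (\<Sum>l\<le>2*M. d l * nu l) \<le> (\<Sum>l\<le>2*M. (d l)\<^sup>2 / (4 * \<rho>) + 4 * \<rho> * (nu l)\<^sup>2)"
    unfolding sum_distrib_left
  proof (rule sum_mono)
    fix l
    have "0 \<le> (d l / (2 * sqrt \<rho>) - 2 * sqrt \<rho> * nu l)\<^sup>2" by simp
    also have "\<dots> = (d l)\<^sup>2 / (4 * \<rho>) + 4 * \<rho> * (nu l)\<^sup>2 - 2 * (d l * nu l)"
      using rho by (simp add: power2_diff power_divide power_mult_distrib)
    finally show "2 * (d l * nu l) \<le> (d l)\<^sup>2 / (4 * \<rho>) + 4 * \<rho> * (nu l)\<^sup>2" by simp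
  qed
  also have "\<dots> = L2sq (trig_poly M d) / (4 * \<rho>) + 4 * \<rho> * Z"
    by (simp add: L2sq_trig_poly Z_def sum.distrib sum_divide_distrib sum_distrib_left)
  also have "L2sq (trig_poly M d) / (4 * \<rho>) \<le> 1 / 4 * (\<integral>x. sig x * (trig_poly M d x)\<^sup>2 \<partial>lcirc)"
    using L2sq_le_opnorm[of M d] rho unfolding \<rho>_def[symmetric] by (simp add: field_simps)
  also have "(\<integral>x. sig x * (trig_poly M d x)\<^sup>2 \<partial>lcirc)
    \<le> (\<integral>x. 2 * (sig x * (trig_poly mh a x - f x)\<^sup>2) + 2 * (sig x * (trig_poly m c x - f x)\<^sup>2) \<partial>lcirc)"
  proof (intro integral_mono_AE AE_I2)
    show "integrable lcirc (\<lambda>x. sig x * (trig_poly M d x)\<^sup>2)" by (rule weighted_trig_poly_integrable)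
    show "integrable lcirc (\<lambda>x. 2 * (sig x * (trig_poly mh a x - f x)\<^sup>2) + 2 * (sig x * (trig_poly m c x - f x)\<^sup>2))"
      using sigma_hat_mult_integrable weighted_trig_poly_integrable(4) by simp
    fix x
    have "(trig_poly M d x)\<^sup>2 \<le> 2 * (trig_poly mh a x - f x)\<^sup>2 + 2 * (trig_poly m c x - f x)\<^sup>2"
      unfolding diff[symmetric]
      using zero_le_power2[of "(trig_poly mh a x - f x) + (trig_poly m c x - f x)"]
      by (simp add: power2_eq_square algebra_simps)
    from mult_left_mono[OF this sigma_hat_bounds(1)[of n \<omega> x]]
    show "sig x * (trig_poly M d x)\<^sup>2 \<le> 2 * (sig x * (trig_poly mh a x - f x)\<^sup>2) + 2 * (sig x * (trig_poly m c x - f x)\<^sup>2)"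
      by (simp add: distrib_left mult.left_commute)
  qed
  also have "\<dots> = 2 * A + 2 * B"
    unfolding A_def B_def using sigma_hat_mult_integrable[OF weighted_trig_poly_integrable(4)] by simp
  finally have dn: "2 * (\<Sum>l\<le>2*M. d l * nu l) \<le> A / 2 + B / 2 + 4 * \<rho> * Z" by (simp add: add_divide_distrib)
  \<comment> \<open>The threshold contributes \<open>20 * \<rho> * Dim M / (2 * pi * n)\<close>,
    which \<open>pen\<close> covers because \<open>\<kappa>\<close> exceeds 20; only the excess over
    the threshold pays the crude \<open>\<rho> \<le> 1 / s\<close>.\<close>
  have "4 * \<rho> * Z \<le> pen \<kappa> n \<omega> M + 4 / s * P M"
  proof -
    have "Z \<le> 5 * real (Dim M) / (2 * pi * real n) + P M" by (simp add: P_def Z_def)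
    hence "4 * \<rho> * Z \<le> 4 * \<rho> * (5 * real (Dim M) / (2 * pi * real n) + P M)"
      using rho by (intro mult_left_mono) auto
    also have "\<dots> = 20 * (\<rho> * real (Dim M) / (2 * pi * real n)) + 4 * \<rho> * P M" by (simp add: algebra_simps)
    also have "\<dots> \<le> \<kappa> * (\<rho> * real (Dim M) / (2 * pi * real n)) + 4 * (1 / s) * P M"
      using rho k by (intro add_mono mult_right_mono mult_left_mono) (auto simp: P_def)
    also have "\<kappa> * (\<rho> * real (Dim M) / (2 * pi * real n)) = pen \<kappa> n \<omega> M"
      by (simp add: pen_def \<rho>_def)
    finally show ?thesis by simp
  qed
  \<comment> \<open>\<open>M\<close> is one of the two indices and penalties are nonnegative; no
    monotonicity of \<open>opnorm\<close> in the model is involved.\<close>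
  moreover have "pen \<kappa> n \<omega> M \<le> pen \<kappa> n \<omega> m + pen \<kappa> n \<omega> mh"
    using pen_nonneg[of \<kappa> m] pen_nonneg[of \<kappa> mh] k by (auto simp: M_def max_def)
  moreover have "8 / s * P M = 2 * (4 / s * P M)" by simp
  ultimately have half: "A \<le> 3 * B + 4 * pen \<kappa> n \<omega> m + 8 / s * P M"
    using main dn by linarith
  have "s * L2sq (\<lambda>x. trig_poly mh a x - f x) \<le> A"
    unfolding A_def by (intro weighted_ge weighted_trig_poly_integrable)
  also note half
  also have "B \<le> L2sq (\<lambda>x. f x - proj f m x)"
    using weighted_le[OF weighted_trig_poly_integrable(4)[of m c]]
    by (simp add: B_def pr L2sq_lcirc power2_commute)
  also have "pen \<kappa> n \<omega> m \<le> (\<kappa> * real (Dim m) / real n) / (2 * pi * s)"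
    using k by (intro pen_le) simp
  \<comment> \<open>\<open>M\<close> depends on the sample through the selected index; summing over
    all models removes this dependence.\<close>
  also have "P M \<le> (\<Sum>M\<in>Mset n. P M)"
    using M by (intro member_le_sum) (auto simp: P_def Mset_def)
  finally have "s * L2sq (\<lambda>x. trig_poly mh a x - f x)
     \<le> 3 * L2sq (\<lambda>x. f x - proj f m x) + 4 * ((\<kappa> * real (Dim m) / real n) / (2 * pi * s)) + 8 / s * (\<Sum>M\<in>Mset n. P M)"
    using s by (simp add: divide_right_mono)
  hence "L2sq (\<lambda>x. trig_poly mh a x - f x)
     \<le> 3 / s * L2sq (\<lambda>x. f x - proj f m x) + (2 / pi) * (1 / s\<^sup>2 * (\<kappa> * real (Dim m) / real n)) + 8 / s\<^sup>2 * (\<Sum>M\<in>Mset n. P M)"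
    using s by (simp add: field_simps power2_eq_square)
  also have "(2 / pi) * (1 / s\<^sup>2 * (\<kappa> * real (Dim m) / real n)) \<le> 1 * (1 / s\<^sup>2 * (\<kappa> * real (Dim m) / real n))"
    using k pi_gt3 by (intro mult_right_mono) auto
  also have "3 / s * L2sq (\<lambda>x. f x - proj f m x) + 1 * (1 / s\<^sup>2 * (\<kappa> * real (Dim m) / real n))
    \<le> (3 / s + 1 / s\<^sup>2) * (L2sq (\<lambda>x. f x - proj f m x) + \<kappa> * real (Dim m) / real n)"
  proof -
    have "0 \<le> L2sq (\<lambda>x. f x - proj f m x)" unfolding L2sq_lcirc by (intro Bochner_Integration.integral_nonneg) auto
    hence "0 \<le> 1 / s\<^sup>2 * L2sq (\<lambda>x. f x - proj f m x)" by simp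
    moreover have "0 \<le> 3 / s * (\<kappa> * real (Dim m) / real n)" using s k by simp
    ultimately show ?thesis by (simp only: distrib_left distrib_right)
  qed
  finally show ?thesis unfolding mh_def[symmetric] fh P_def by simp
qed

end

section \<open>Risk bound\<close>

lemma L2sq_nonneg: "0 \<le> L2sq g"
  unfolding L2sq_lcirc by (intro Bochner_Integration.integral_nonneg) auto

lemma sixth_power_sum_le: "(x + y)^6 \<le> 32 * (x^6 + (y::real)^6)"
proof -
  have "(x + y)\<^sup>2 \<le> 2 * (x\<^sup>2 + y\<^sup>2)"
    using zero_le_power2[of "x - y"] by (simp add: power2_sum power2_diff)
  from power_mono[OF this, of 3] have "(x + y)^6 \<le> (2 * (x\<^sup>2 + y\<^sup>2))^3" by (simp flip: power_mult)
  also have "\<dots> = 8 * (x\<^sup>2 + y\<^sup>2)^3" by (subst power_mult_distrib) simp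
  also have "\<dots> \<le> 8 * (4 * ((x\<^sup>2)^3 + (y\<^sup>2)^3))" by (intro mult_left_mono cube_add_le) auto
  finally show ?thesis by (simp flip: power_mult)
qed

text \<open>Markov's inequality before integration: above the threshold,
  \<open>x \<le> x * (x / b)^5\<close>.\<close>

lemma max_diff_le_sixth_power:
  fixes x b :: real
  assumes "b > 0"
  shows "max 0 (x - b) \<le> x^6 / b^5"
proof (cases "x \<le> b")
  case False
  hence "x * b^5 \<le> x * x^5" using assms by (intro mult_left_mono power_mono) auto
  hence "x \<le> x^6 / b^5" using assms by (simp add: field_simps eval_nat_numeral)
  thus ?thesis using False assms by simp
qed (use assms in simp)

text \<open>Telescoping. For \<open>k = 0\<close> the convention \<open>1 / 0 = 0\<close> makes the
  right-hand side 2.\<close>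

lemma sum_inverse_squares_le: "(\<Sum>j\<in>{1..k}. 1 / (real j)\<^sup>2) \<le> 2 - 1 / real k"
proof (induction k)
  case (Suc k)
  have "1 / (real (Suc k))\<^sup>2 \<le> 1 / real k - 1 / real (Suc k)" if k: "k > 0"
  proof -
    have "1 / (real (Suc k))\<^sup>2 \<le> 1 / (real k * real (Suc k))"
      unfolding power2_eq_square using k by (intro divide_left_mono mult_right_mono) auto
    also have "\<dots> = 1 / real k - 1 / real (Suc k)" using k by (simp add: field_simps)
    finally show ?thesis .
  qed
  with Suc show ?case by (cases "k = 0") auto
qed simp

text \<open>That the infimum defining \<open>Linf\<close> is itself a bound takes a countable
  intersection: each \<open>Linf f + 1 / (k + 1)\<close> is an almost sure bound.\<close>

lemma AE_le_Linf:
  assumes "\<exists>B. AE x in lborel. x \<in> circ \<longrightarrow> \<bar>f x\<bar> \<le> B"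
  shows "AE x in lcirc. f x \<le> Linf f"
proof -
  let ?S = "{B. AE x in lborel. x \<in> circ \<longrightarrow> \<bar>f x\<bar> \<le> B}"
  have ne: "?S \<noteq> {}" using assms by blast
  have "AE x in lcirc. f x \<le> Linf f + 1 / real (Suc k)" for k
  proof -
    obtain B where B: "B \<in> ?S" "B < Linf f + 1 / real (Suc k)"
      using cInf_lessD[OF ne, of "Linf f + 1 / real (Suc k)"] by (auto simp: Linf_def)
    have "AE x in lcirc. \<bar>f x\<bar> \<le> B" using B(1) by (simp add: AE_lcirc)
    thus ?thesis by (rule eventually_mono) (use B(2) in linarith)
  qed
  hence "AE x in lcirc. \<forall>k. f x \<le> Linf f + 1 / real (Suc k)" by (simp add: AE_all_countable)
  thus ?thesis
  proof eventually_elim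
    case (elim x)
    have "(\<lambda>k. Linf f + 1 / real (Suc k)) \<longlonglongrightarrow> Linf f + 0"
      by (intro tendsto_add tendsto_const LIMSEQ_Suc[OF lim_1_over_n])
    thus ?case using elim by (intro LIMSEQ_le_const[of _ "Linf f"]) auto
  qed
qed

section \<open>Truncation, exceptional samples and the risk\<close>

context arc_model
begin

lemma L2sq_diff_le:
  shows "L2sq (\<lambda>x. trig_poly m a x - f x) \<le> 2 * L2sq (trig_poly m a) + 2 * L2sq f"
    and "L2sq (trig_poly m a) \<le> 2 * L2sq (\<lambda>x. trig_poly m a x - f x) + 2 * L2sq f"
proof -
  let ?t = "trig_poly m a"
  have it: "integrable lcirc (\<lambda>x. (?t x)\<^sup>2)"
    using trig_poly_prod_integrable by (simp add: power2_eq_square)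
  have "integrable lcirc (\<lambda>x. (?t x)\<^sup>2 - 2 * (f x * ?t x) + (f x)\<^sup>2)"
    using it f_sq_integrable integral_weighted_trig_poly(2)[OF f_integrable] by simp
  moreover have "(\<lambda>x. (?t x)\<^sup>2 - 2 * (f x * ?t x) + (f x)\<^sup>2) = (\<lambda>x. (?t x - f x)\<^sup>2)"
    by (auto simp: fun_eq_iff power2_eq_square algebra_simps)
  ultimately have id: "integrable lcirc (\<lambda>x. (?t x - f x)\<^sup>2)" by simp
  have "L2sq (\<lambda>x. ?t x - f x) \<le> (\<integral>x. 2 * (?t x)\<^sup>2 + 2 * (f x)\<^sup>2 \<partial>lcirc)"
    unfolding L2sq_lcirc
  proof (intro integral_mono_AE id AE_I2)
    fix x show "(?t x - f x)\<^sup>2 \<le> 2 * (?t x)\<^sup>2 + 2 * (f x)\<^sup>2"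
      using zero_le_power2[of "?t x + f x"] by (simp add: power2_sum power2_diff)
  qed (use it f_sq_integrable in simp)
  thus "L2sq (\<lambda>x. ?t x - f x) \<le> 2 * L2sq ?t + 2 * L2sq f"
    using it f_sq_integrable by (simp add: L2sq_lcirc)
  have "L2sq ?t \<le> (\<integral>x. 2 * (?t x - f x)\<^sup>2 + 2 * (f x)\<^sup>2 \<partial>lcirc)"
    unfolding L2sq_lcirc
  proof (intro integral_mono_AE it AE_I2)
    fix x show "(?t x)\<^sup>2 \<le> 2 * (?t x - f x)\<^sup>2 + 2 * (f x)\<^sup>2"
      using zero_le_power2[of "?t x - 2 * f x"] by (simp add: power2_diff power_mult_distrib algebra_simps)
  qed (use id f_sq_integrable in simp)
  thus "L2sq ?t \<le> 2 * L2sq (\<lambda>x. ?t x - f x) + 2 * L2sq f"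
    using id f_sq_integrable by (simp add: L2sq_lcirc)
qed

text \<open>The first bound holds on every sample and is kept for the exceptional ones. In the
  second, truncation harms only if zero is farther from \<open>f\<close> than the estimator; then
  \<open>n^2\<close> is below \<open>4 * v\<close>, so \<open>n\<close> is, and the loss, at most
  \<open>v\<close>, is below \<open>4 * v\<^sup>2 / n\<close>.\<close>

lemma ftilde_loss_le:
  assumes n: "n \<ge> 1"
  shows "L2sq (\<lambda>x. ftilde \<kappa> n \<omega> x - f x) \<le> 2 * (real n)\<^sup>2 + 2 * v" (is ?A)
    and "L2sq (\<lambda>x. ftilde \<kappa> n \<omega> x - f x)
      \<le> L2sq (\<lambda>x. fring n \<omega> (mhat \<kappa> n \<omega>) x - f x) + 4 * v\<^sup>2 / real n" (is ?B)
proof -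
  define g where "g = fring n \<omega> (mhat \<kappa> n \<omega>)"
  have gt: "g = trig_poly (mhat \<kappa> n \<omega>) (($) (ahat n \<omega> (mhat \<kappa> n \<omega>)))"
    by (simp add: g_def fun_eq_iff fring_def trig_poly_def)
  note d = L2sq_diff_le[of "mhat \<kappa> n \<omega>" "($) (ahat n \<omega> (mhat \<kappa> n \<omega>))", folded gt]
  note fv = L2sq_f_le
  have nn: "0 \<le> L2sq (\<lambda>x. g x - f x)" "0 \<le> 4 * v\<^sup>2 / real n" by (auto simp: L2sq_nonneg)
  show ?A
  proof (cases "L2sq g \<le> (real n)\<^sup>2")
    case True
    thus ?thesis using d(1) fv by (simp add: ftilde_def Let_def g_def[symmetric])
  next
    case False
    hence "L2sq (\<lambda>x. ftilde \<kappa> n \<omega> x - f x) = L2sq f"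
      by (simp add: ftilde_def Let_def g_def[symmetric] L2sq_def)
    moreover have "0 \<le> (real n)\<^sup>2" by simp
    ultimately show ?thesis using fv v_nonneg by linarith
  qed
  show ?B
  proof (cases "L2sq g \<le> (real n)\<^sup>2")
    case True
    thus ?thesis using nn by (simp add: ftilde_def Let_def g_def[symmetric])
  next
    case False
    hence e: "L2sq (\<lambda>x. ftilde \<kappa> n \<omega> x - f x) = L2sq f"
      by (simp add: ftilde_def Let_def g_def[symmetric] L2sq_def)
    show ?thesis
    proof (cases "L2sq f \<le> L2sq (\<lambda>x. g x - f x)")
      case True
      thus ?thesis using e nn unfolding g_def by linarith
    next
      case F2: False
      have "(real n)\<^sup>2 \<le> 4 * v" using False F2 d(2) fv by linarith
      moreover have "real n \<le> (real n)\<^sup>2" using n by (simp add: power2_eq_square)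
      ultimately have "real n \<le> 4 * v" by linarith
      hence "v * real n \<le> v * (4 * v)" using v_nonneg by (intro mult_left_mono) auto
      hence "v \<le> 4 * v\<^sup>2 / real n" using n by (simp add: field_simps power2_eq_square)
      thus ?thesis using e fv nn unfolding g_def by linarith
    qed
  qed
qed

text \<open>With \<open>b = Dim M / (2 * pi)\<close>, four of the five units \<open>b / n\<close>
  cancel the diagonal part and the fifth is the threshold of \<open>max_diff_le_sixth_power\<close>.
  The power \<open>n^7\<close> is the factor \<open>1 / n\<close> times the \<open>n^6\<close> under
  the off-diagonal part.\<close>

lemma noise_excess_le:
  assumes n: "n \<ge> 1"
  shows "max 0 ((\<Sum>l\<le>2*M. ((1 / real n) * (\<Sum>i<n. noise f (\<omega> i) l))\<^sup>2) - 5 * real (Dim M) / (2 * pi * real n))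
    \<le> (1 / (real n ^ 7 * (real (Dim M) / (2 * pi)) ^ 5)) * (offdiag {..2*M} (noise f) n \<omega>)^6"
proof -
  define b where "b = real (Dim M) / (2 * pi)"
  let ?O = "offdiag {..2*M} (noise f) n \<omega>"
  have b: "b > 0" by (simp add: b_def Dim_def)
  have "(\<Sum>l\<le>2*M. (\<Sum>i<n. noise f (\<omega> i) l)\<^sup>2) \<le> real n * (4 * b) + ?O"
    using sum_noise_sq_le[of _ M] by (intro sum_squares_le_offdiag) (simp add: b_def)
  hence "(1 / real n)\<^sup>2 * (\<Sum>l\<le>2*M. (\<Sum>i<n. noise f (\<omega> i) l)\<^sup>2) \<le> (1 / real n)\<^sup>2 * (real n * (4 * b) + ?O)"
    by (intro mult_left_mono) auto
  also have "\<dots> = 5 * b / real n + (1 / real n) * (?O / real n - b)"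
    using n by (simp add: field_simps power2_eq_square)
  finally have "(\<Sum>l\<le>2*M. ((1 / real n) * (\<Sum>i<n. noise f (\<omega> i) l))\<^sup>2) - 5 * b / real n \<le> (1 / real n) * (?O / real n - b)"
    unfolding power_mult_distrib sum_distrib_left[symmetric] by linarith
  also have "\<dots> \<le> (1 / real n) * max 0 (?O / real n - b)"
    by (intro mult_left_mono) auto
  finally have "max 0 ((\<Sum>l\<le>2*M. ((1 / real n) * (\<Sum>i<n. noise f (\<omega> i) l))\<^sup>2) - 5 * b / real n)
    \<le> (1 / real n) * max 0 (?O / real n - b)" by simp
  also have "\<dots> \<le> (1 / real n) * ((?O / real n)^6 / b^5)"
    by (intro mult_left_mono max_diff_le_sixth_power b) auto
  also have "\<dots> = (1 / (real n ^ 7 * b ^ 5)) * ?O^6"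
    by (simp add: power_divide eval_nat_numeral)
  finally show ?thesis by (simp add: b_def mult.assoc)
qed

text \<open>A pointwise bound of one by the statistic on the bad event, replacing a probability
  estimate: the deviation gives \<open>(n * \<epsilon>)\<^sup>2 \<le> n + O\<close>, with
  \<open>O\<close> the off-diagonal part, and the sixth power is taken.\<close>

lemma frequency_deviation_le:
  fixes A :: "(real \<times> real) set" and \<omega> :: "nat \<Rightarrow> obs"
  assumes n: "n \<ge> 1" and e: "\<epsilon> > 0"
    and bad: "(\<Sum>i<n. indicator A (snd (\<omega> i))) < real n * (measure Q A - \<epsilon>)"
  shows "1 \<le> 32 / (real n * \<epsilon>)^12 * (real n ^ 6 + (offdiag {0} (\<lambda>ob _. indicator A (snd ob) - measure Q A) n \<omega>)^6)"
proof -
  let ?Y = "\<lambda>ob :: obs. indicator A (snd ob) - measure Q A"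
  let ?O = "offdiag {0} (\<lambda>ob _. ?Y ob) n \<omega>"
  define S where "S = (\<Sum>i<n. ?Y (\<omega> i))"
  have ne: "0 < real n * \<epsilon>" using n e by simp
  have "S < - (real n * \<epsilon>)" using bad by (simp add: S_def sum_subtractf algebra_simps)
  hence "(real n * \<epsilon>)\<^sup>2 \<le> (- S)\<^sup>2" using ne by (intro power_mono) auto
  moreover have "(\<Sum>l\<in>{0::nat}. (\<Sum>i<n. ?Y (\<omega> i))\<^sup>2) \<le> real n * 1 + ?O"
  proof (rule sum_squares_le_offdiag[where I = "{0}" and Y = "\<lambda>ob _. ?Y ob"])
    fix i
    have "\<bar>?Y (\<omega> i)\<bar> \<le> 1"
    proof -
      have "0 \<le> measure Q A" "measure Q A \<le> 1" "0 \<le> (indicator A (snd (\<omega> i)) :: real)" "(indicator A (snd (\<omega> i)) :: real) \<le> 1"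
        by (auto simp: indicator_def)
      thus ?thesis by linarith
    qed
    thus "(\<Sum>l\<in>{0::nat}. (?Y (\<omega> i))\<^sup>2) \<le> 1" by (simp add: abs_square_le_1)
  qed
  ultimately have "(real n * \<epsilon>)\<^sup>2 \<le> real n + ?O" by (simp add: S_def)
  hence "((real n * \<epsilon>)\<^sup>2)^6 \<le> (real n + ?O)^6" by (intro power_mono) auto
  also have "\<dots> \<le> 32 * (real n ^ 6 + ?O^6)" by (rule sixth_power_sum_le)
  finally have "(real n * \<epsilon>)^12 \<le> 32 * (real n ^ 6 + ?O^6)" by (simp flip: power_mult)
  hence "1 \<le> 32 * (real n ^ 6 + ?O^6) / (real n * \<epsilon>)^12" using ne by (subst le_divide_eq_1_pos) (auto simp: zero_less_mult_iff)
  thus ?thesis by simp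
qed

lemma AE_sample_arcs:
  assumes "AE p in Q. fst p \<in> circ \<and> snd p \<in> circ"
  shows "AE \<omega> in sample_law f Q n. \<forall>i<n. fst (snd (\<omega> i)) \<in> circ \<and> snd (snd (\<omega> i)) \<in> circ"
proof -
  obtain N where N: "{p \<in> space Q. \<not> (fst p \<in> circ \<and> snd p \<in> circ)} \<subseteq> N" "N \<in> null_sets Q"
    using assms by (rule AE_E) auto
  have "circ \<in> sets X_law" using sets.top[of X_law] by simp
  hence "circ \<times> N \<in> null_sets (X_law \<Otimes>\<^sub>M Q)"
    using N(2) by (intro Q.times_in_null_sets2)
  hence ae: "AE ob in obs_law f Q. fst (snd ob) \<in> circ \<and> snd (snd ob) \<in> circ"
    unfolding obs_law_eq using N(1)
    by (intro AE_I'[of "circ \<times> N"]) (auto simp: space_pair_measure space_Q)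
  have "AE \<omega> in PiM {..<n} (\<lambda>_. obs_law f Q). \<forall>i\<in>{..<n}. fst (snd (\<omega> i)) \<in> circ \<and> snd (snd (\<omega> i)) \<in> circ"
  proof (rule AE_finite_allI)
    fix i assume "i \<in> {..<n}"
    thus "AE \<omega> in PiM {..<n} (\<lambda>_. obs_law f Q). fst (snd (\<omega> i)) \<in> circ \<and> snd (snd (\<omega> i)) \<in> circ"
      using ae by (intro AE_PiM_component prob_space_obs_law) auto
  qed simp
  thus ?thesis unfolding sample_law_def by (rule eventually_mono) auto
qed

lemma offdiag_noise_measurable:
  "offdiag {..2*M} (noise f) n \<in> borel_measurable (sample_law f Q n)"
  unfolding sample_law_def by (intro offdiag_measurable noise_measurable) auto

lemma offdiag_frequency_measurable:
  assumes "A \<in> sets borel"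
  shows "offdiag {0} (\<lambda>ob _. indicator A (snd ob) - measure Q A) n \<in> borel_measurable (sample_law f Q n)"
  unfolding sample_law_def using assms by (intro offdiag_measurable obs_measurable) auto

lemma prob_space_sample_law: "prob_space (sample_law f Q n)"
  unfolding sample_law_def by (intro prob_space_PiM prob_space_obs_law)

text \<open>The loss is dominated almost surely by an explicit measurable statistic, so
  measurability of the selected index never comes up. The choice
  \<open>\<epsilon> = \<sigma>0 / 10\<close> makes the coverage loss \<open>5 * \<epsilon>\<close>
  equal to \<open>\<sigma>0 / 2\<close>, which leaves \<open>s\<close>.\<close>

lemma risk_bound:
  assumes k: "\<kappa> > 32" and s0: "\<sigma>0 > 0" and n: "n \<ge> 4" and m: "m \<in> Mset n"
    and circ: "AE p in Q. fst p \<in> circ \<and> snd p \<in> circ"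
    and sig: "\<And>x. x \<in> circ \<Longrightarrow> \<sigma>0 \<le> sigmaQ Q x"
  defines "s \<equiv> \<sigma>0 / 2" and "\<epsilon> \<equiv> \<sigma>0 / 10"
  shows "(\<integral>\<^sup>+\<omega>. ennreal (L2sq (\<lambda>x. ftilde \<kappa> n \<omega> x - f x)) \<partial>sample_law f Q n)
    \<le> ennreal ((3 / s + 1 / s\<^sup>2) * (L2sq (\<lambda>x. f x - proj f m x) + \<kappa> * real (Dim m) / real n)
      + (4 * v\<^sup>2 + 16384 / s\<^sup>2 * exp (20800 * v)
         + (2 + 2 * v) * (32 * real (2 * nat \<lceil>1/\<epsilon>\<rceil> + 1) * (1 + exp 20800) / \<epsilon>^12)) / real n)"
proof -
  have s: "s > 0" and e: "\<epsilon> > 0" using s0 by (auto simp: s_def \<epsilon>_def)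
  obtain \<A> where A: "finite \<A>" "card \<A> \<le> 2 * nat \<lceil>1/\<epsilon>\<rceil> + 1" "\<A> \<subseteq> sets borel"
    and Alow: "\<And>n (\<omega> :: nat \<Rightarrow> obs) x. n > 0 \<Longrightarrow> (\<forall>i<n. fst (snd (\<omega> i)) \<in> circ \<and> snd (snd (\<omega> i)) \<in> circ) \<Longrightarrow>
       (\<forall>A\<in>\<A>. real n * (measure Q A - \<epsilon>) \<le> (\<Sum>i<n. indicator A (snd (\<omega> i)))) \<Longrightarrow>
       x \<in> circ \<Longrightarrow> sigmaQ Q x - 5 * \<epsilon> \<le> sigma_hat n \<omega> x"
    using sigma_hat_lower_bound[OF Q e circ] by blast
  interpret S: prob_space "sample_law f Q n" by (rule prob_space_sample_law)
  define H where "H = (3 / s + 1 / s\<^sup>2) * (L2sq (\<lambda>x. f x - proj f m x) + \<kappa> * real (Dim m) / real n) + 4 * v\<^sup>2 / real n"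
  have H0: "H \<ge> 0" unfolding H_def using s k L2sq_nonneg by (intro add_nonneg_nonneg mult_nonneg_nonneg) auto
  define b where "b M = real (Dim M) / (2 * pi)" for M
  have b0: "b M > 0" for M by (simp add: b_def Dim_def)
  define p where "p M = 8 / s\<^sup>2 * (1 / (real n ^ 7 * b M ^ 5))" for M
  have p0: "p M \<ge> 0" for M unfolding p_def using b0[of M] by simp
  define q where "q = (2 * (real n)\<^sup>2 + 2 * v) * (32 / (real n * \<epsilon>)^12)"
  have q0: "q \<ge> 0" unfolding q_def using v_nonneg e by simp
  define O1 where "O1 M \<omega> = (offdiag {..2*M} (noise f) n \<omega>)^6" for M \<omega>
  define O2 where "O2 A \<omega> = (offdiag {0} (\<lambda>ob _. indicator A (snd ob) - measure Q A) n \<omega>)^6" for A and \<omega> :: "nat \<Rightarrow> obs"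
  have O1m: "O1 M \<in> borel_measurable (sample_law f Q n)" for M
    unfolding O1_def[abs_def] by (intro borel_measurable_power offdiag_noise_measurable)
  have O2m: "O2 A \<in> borel_measurable (sample_law f Q n)" if "A \<in> \<A>" for A
    unfolding O2_def[abs_def] using that A(3) by (intro borel_measurable_power offdiag_frequency_measurable) auto
  have O0: "O1 M \<omega> \<ge> 0" "O2 A \<omega> \<ge> 0" for M A \<omega> by (auto simp: O1_def O2_def)
  have AEb: "AE \<omega> in sample_law f Q n. L2sq (\<lambda>x. ftilde \<kappa> n \<omega> x - f x)
     \<le> H + ((\<Sum>M\<in>Mset n. p M * O1 M \<omega>) + (\<Sum>A\<in>\<A>. q * (real n ^ 6 + O2 A \<omega>)))"
    using AE_sample_arcs[OF circ]
  proof eventually_elim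
    case (elim \<omega>)
    have S1: "0 \<le> (\<Sum>M\<in>Mset n. p M * O1 M \<omega>)" using p0 O0 by (intro sum_nonneg mult_nonneg_nonneg)
    have S2: "0 \<le> (\<Sum>A\<in>\<A>. q * (real n ^ 6 + O2 A \<omega>))" using q0 O0 by (intro sum_nonneg mult_nonneg_nonneg add_nonneg_nonneg) auto
    show ?case
    proof (cases "\<forall>A\<in>\<A>. real n * (measure Q A - \<epsilon>) \<le> (\<Sum>i<n. indicator A (snd (\<omega> i)))")
      \<comment> \<open>All selected frequencies are nearly right, so the coverage is at least
        \<open>s\<close> and the oracle inequality applies.\<close>
      case True
      interpret good_sample f Q v n \<omega> s
      proof unfold_locales
        fix x assume x: "x \<in> circ"
        show "s \<le> sigma_hat n \<omega> x"
          using Alow[OF _ elim True x] sig[OF x] n by (simp add: s_def \<epsilon>_def)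
      qed (use n s elim in auto)
      have "L2sq (\<lambda>x. ftilde \<kappa> n \<omega> x - f x) \<le> L2sq (\<lambda>x. fring n \<omega> (mhat \<kappa> n \<omega>) x - f x) + 4 * v\<^sup>2 / real n"
        using n by (intro ftilde_loss_le) simp
      also have "\<dots> \<le> H + 8 / s\<^sup>2 * (\<Sum>M\<in>Mset n. max 0 ((\<Sum>l\<le>2*M. (nu l)\<^sup>2) - 5 * real (Dim M) / (2 * pi * real n)))"
        using oracle_inequality[OF k m] by (simp add: H_def)
      also have "8 / s\<^sup>2 * (\<Sum>M\<in>Mset n. max 0 ((\<Sum>l\<le>2*M. (nu l)\<^sup>2) - 5 * real (Dim M) / (2 * pi * real n)))
        \<le> 8 / s\<^sup>2 * (\<Sum>M\<in>Mset n. (1 / (real n ^ 7 * b M ^ 5)) * O1 M \<omega>)"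
        using noise_excess_le[where \<omega> = \<omega>] n unfolding nu_def b_def O1_def
        by (intro mult_left_mono sum_mono) auto
      also have "\<dots> = (\<Sum>M\<in>Mset n. p M * O1 M \<omega>)"
        by (simp add: p_def sum_distrib_left mult.assoc)
      finally show ?thesis using S2 by simp
    next
      \<comment> \<open>One frequency is too low. The cap on the loss is multiplied by a quantity at
        least 1 on this event.\<close>
      case False
      then obtain A where AA: "A \<in> \<A>" "(\<Sum>i<n. indicator A (snd (\<omega> i))) < real n * (measure Q A - \<epsilon>)" by force
      have "L2sq (\<lambda>x. ftilde \<kappa> n \<omega> x - f x) \<le> (2 * (real n)\<^sup>2 + 2 * v) * 1"
        using ftilde_loss_le(1)[of n \<kappa> \<omega>] n by simp
      also have "\<dots> \<le> (2 * (real n)\<^sup>2 + 2 * v) * (32 / (real n * \<epsilon>)^12 * (real n ^ 6 + O2 A \<omega>))"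
        unfolding O2_def using frequency_deviation_le[OF _ e AA(2)] n v_nonneg by (intro mult_left_mono) auto
      also have "\<dots> = q * (real n ^ 6 + O2 A \<omega>)" by (simp only: q_def mult.assoc)
      also have "\<dots> \<le> (\<Sum>A\<in>\<A>. q * (real n ^ 6 + O2 A \<omega>))"
        using AA(1) A(1) q0 O0 by (intro member_le_sum mult_nonneg_nonneg add_nonneg_nonneg) auto
      finally show ?thesis using S1 H0 by simp
    qed
  qed
  have E1: "(\<integral>\<^sup>+\<omega>. ennreal (p M * O1 M \<omega>) \<partial>sample_law f Q n) \<le> ennreal (8192 / s\<^sup>2 * exp (20800 * v) / real n * (1 / (real M)\<^sup>2))"
    if M: "M \<in> Mset n" for M
  proof -
    have "(\<integral>\<^sup>+\<omega>. ennreal (p M * O1 M \<omega>) \<partial>sample_law f Q n) = ennreal (p M) * (\<integral>\<^sup>+\<omega>. ennreal (O1 M \<omega>) \<partial>sample_law f Q n)"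
      using p0 O0 O1m by (simp add: ennreal_mult nn_integral_cmult)
    also have "\<dots> \<le> ennreal (p M) * ennreal (exp (20800 * v) * real n ^ 6 * (2 * real (Dim M) / pi)^3)"
      unfolding O1_def by (intro mult_left_mono noise_sixth_moment n M) simp
    also have "\<dots> = ennreal (p M * (exp (20800 * v) * real n ^ 6 * (4 * b M)^3))"
      using p0 by (simp add: ennreal_mult b_def)
    \<comment> \<open>\<open>b^3 / b^5\<close> leaves \<open>1 / b^2\<close> and
      \<open>n^6 / n^7\<close> leaves \<open>1 / n\<close>; 512 = 8 * 4^3.\<close>
    also have "p M * (exp (20800 * v) * real n ^ 6 * (4 * b M)^3) = 512 / s\<^sup>2 * exp (20800 * v) / real n * (1 / (b M)\<^sup>2)"
    proof -
      have "8 / S * (1 / (N * N6 * (B2 * B3))) * (E * N6 * (64 * B3)) = 512 / S * E / N * (1 / B2)"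
        if "N6 \<noteq> 0" "B3 \<noteq> 0" for S N N6 B2 B3 E :: real using that by simp
      from this[of "real n ^ 6" "b M ^ 3" "s\<^sup>2" "real n" "(b M)\<^sup>2" "exp (20800 * v)"] b0[of M] n
      show ?thesis by (simp add: p_def power_mult_distrib flip: power_add power_Suc)
    qed
    also have "\<dots> \<le> 512 / s\<^sup>2 * exp (20800 * v) / real n * (16 / (real M)\<^sup>2)"
    proof (intro mult_left_mono)
      have M1: "real M > 0" using M by (simp add: Mset_def)
      \<comment> \<open>\<open>pi < 4\<close> and \<open>Dim M \<ge> 2 * M\<close>; squaring costs
        the factor 16 in 8192 = 512 * 16.\<close>
      have "real M / 4 \<le> b M"
      proof -
        have "real M * (2 * pi) \<le> real M * 8" using pi_less_4 by (intro mult_left_mono) auto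
        thus ?thesis by (simp add: b_def Dim_def field_simps)
      qed
      hence "(real M / 4)\<^sup>2 \<le> (b M)\<^sup>2" by (intro power_mono) auto
      hence "1 / (b M)\<^sup>2 \<le> 1 / (real M / 4)\<^sup>2" using M1 b0[of M] by (intro divide_left_mono) auto
      thus "1 / (b M)\<^sup>2 \<le> 16 / (real M)\<^sup>2" by (simp add: power_divide)
    qed simp
    also have "\<dots> = 8192 / s\<^sup>2 * exp (20800 * v) / real n * (1 / (real M)\<^sup>2)" by simp
    finally show ?thesis by (simp add: ennreal_leI)
  qed
  have E2: "(\<integral>\<^sup>+\<omega>. ennreal (q * (real n ^ 6 + O2 a \<omega>)) \<partial>sample_law f Q n) \<le> ennreal (q * ((1 + exp 20800) * real n ^ 6))"
    if a: "a \<in> \<A>" for a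
  proof -
    have "(\<integral>\<^sup>+\<omega>. ennreal (q * (real n ^ 6 + O2 a \<omega>)) \<partial>sample_law f Q n)
      = ennreal q * (ennreal (real n ^ 6) + (\<integral>\<^sup>+\<omega>. ennreal (O2 a \<omega>) \<partial>sample_law f Q n))"
      using q0 O0 O2m[OF a] S.emeasure_space_1 by (simp add: ennreal_mult nn_integral_cmult nn_integral_add)
    also have "\<dots> \<le> ennreal q * (ennreal (real n ^ 6) + ennreal (exp 20800 * real n ^ 6))"
      unfolding O2_def using n a A(3) by (intro mult_left_mono add_left_mono frequency_sixth_moment) auto
    also have "\<dots> = ennreal (q * ((1 + exp 20800) * real n ^ 6))"
    proof -
      have "ennreal q * (ennreal a + ennreal b) = ennreal (q * (a + b))" if "0 \<le> a" "0 \<le> b" for a b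
        using q0 that by (simp add: ennreal_mult flip: ennreal_plus)
      from this[of "real n ^ 6" "exp 20800 * real n ^ 6"] show ?thesis by (simp add: distrib_right)
    qed
    finally show ?thesis .
  qed
  define C1 where "C1 = 8192 / s\<^sup>2 * exp (20800 * v) / real n"
  define C2 where "C2 = q * ((1 + exp 20800) * real n ^ 6)"
  have C0: "C1 \<ge> 0" "C2 \<ge> 0" using q0 by (auto simp: C1_def C2_def)
  have "(\<integral>\<^sup>+\<omega>. ennreal (L2sq (\<lambda>x. ftilde \<kappa> n \<omega> x - f x)) \<partial>sample_law f Q n)
    \<le> (\<integral>\<^sup>+\<omega>. ennreal (H + ((\<Sum>M\<in>Mset n. p M * O1 M \<omega>) + (\<Sum>A\<in>\<A>. q * (real n ^ 6 + O2 A \<omega>)))) \<partial>sample_law f Q n)"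
    using AEb by (intro nn_integral_mono_AE) (auto elim!: eventually_mono intro!: ennreal_leI)
  also have "\<dots> = (\<integral>\<^sup>+\<omega>. ennreal H + ((\<Sum>M\<in>Mset n. ennreal (p M * O1 M \<omega>)) + (\<Sum>A\<in>\<A>. ennreal (q * (real n ^ 6 + O2 A \<omega>)))) \<partial>sample_law f Q n)"
    using H0 p0 q0 O0 by (intro nn_integral_cong) (simp add: ennreal_plus sum_nonneg flip: sum_ennreal)
  also have "\<dots> = ennreal H + ((\<Sum>M\<in>Mset n. \<integral>\<^sup>+\<omega>. ennreal (p M * O1 M \<omega>) \<partial>sample_law f Q n)
      + (\<Sum>A\<in>\<A>. \<integral>\<^sup>+\<omega>. ennreal (q * (real n ^ 6 + O2 A \<omega>)) \<partial>sample_law f Q n))"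
    using O1m O2m S.emeasure_space_1 by (simp add: nn_integral_add nn_integral_sum)
  also have "\<dots> \<le> ennreal H + ((\<Sum>M\<in>Mset n. ennreal (C1 * (1 / (real M)\<^sup>2))) + (\<Sum>A\<in>\<A>. ennreal C2))"
    unfolding C1_def C2_def by (intro add_left_mono add_mono sum_mono E1 E2)
  also have "\<dots> = ennreal (H + (C1 * (\<Sum>M\<in>Mset n. 1 / (real M)\<^sup>2) + real (card \<A>) * C2))"
  proof -
    have "(\<Sum>M\<in>Mset n. ennreal (C1 * (1 / (real M)\<^sup>2))) = ennreal (C1 * (\<Sum>M\<in>Mset n. 1 / (real M)\<^sup>2))"
      using C0 by (subst sum_ennreal) (auto simp: sum_distrib_left)
    moreover have "(\<Sum>A\<in>\<A>. ennreal C2) = ennreal (real (card \<A>) * C2)"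
      using C0 by (subst sum_ennreal) auto
    moreover have "0 \<le> C1 * (\<Sum>M\<in>Mset n. 1 / (real M)\<^sup>2)" "0 \<le> real (card \<A>) * C2"
      using C0 by (auto intro!: mult_nonneg_nonneg sum_nonneg)
    ultimately show ?thesis using H0 by (simp only: ennreal_plus add_nonneg_nonneg)
  qed
  also have "\<dots> \<le> ennreal (H + (C1 * 2 + real (2 * nat \<lceil>1/\<epsilon>\<rceil> + 1) * C2))"
  proof (intro ennreal_leI add_left_mono add_mono mult_left_mono mult_right_mono C0)
    have "(\<Sum>M\<in>Mset n. 1 / (real M)\<^sup>2) \<le> 2 - 1 / real (n div 2 - 1)"
      unfolding Mset_def by (rule sum_inverse_squares_le)
    also have "\<dots> \<le> 2" by simp
    finally show "(\<Sum>M\<in>Mset n. 1 / (real M)\<^sup>2) \<le> 2" .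
    show "real (card \<A>) \<le> real (2 * nat \<lceil>1/\<epsilon>\<rceil> + 1)" using A(2) by linarith
  qed
  also have "\<dots> \<le> ennreal (H + (C1 * 2 + real (2 * nat \<lceil>1/\<epsilon>\<rceil> + 1) * ((2 + 2 * v) * (32 * (1 + exp 20800) / \<epsilon>^12) / real n)))"
  proof (intro ennreal_leI add_left_mono mult_left_mono)
    have n1: "real n \<ge> 1" using n by simp
    have "2 * (real n)\<^sup>2 + 2 * v \<le> (2 + 2 * v) * (real n)\<^sup>2"
      using v_nonneg n1 mult_left_mono[of 1 "(real n)\<^sup>2" "2 * v"] by (simp add: algebra_simps)
    hence "C2 \<le> (2 + 2 * v) * (real n)\<^sup>2 * (32 / (real n * \<epsilon>)^12) * ((1 + exp 20800) * real n ^ 6)"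
      unfolding C2_def q_def using e by (intro mult_right_mono) auto
    also have "\<dots> = (2 + 2 * v) * (32 * (1 + exp 20800) / \<epsilon>^12) * (1 / real n ^ 4)"
    proof -
      have pw: "(real n * \<epsilon>)^12 = real n ^ 2 * real n ^ 6 * real n ^ 4 * \<epsilon>^12"
        by (simp add: power_mult_distrib flip: power_add)
      have frac: "a * N2 * (32 / (N2 * N6 * N4 * T)) * (E * N6) = a * (32 * E / T) * (1 / N4)"
        if "N2 \<noteq> 0" "N6 \<noteq> 0" for a N2 N4 N6 T E :: real using that by simp
      show ?thesis unfolding pw by (rule frac) (use n in auto)
    qed
    \<comment> \<open>The loss \<open>n^2\<close> times the probability \<open>n^6 / n^12\<close> is
      of order \<open>n^(-4)\<close>, smaller than the \<open>1 / n\<close> asked for.\<close>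
    also have "\<dots> \<le> (2 + 2 * v) * (32 * (1 + exp 20800) / \<epsilon>^12) * (1 / real n)"
    proof (intro mult_left_mono)
      have "real n \<le> real n ^ 4" using n1 self_le_power[of "real n" 4] by simp
      thus "1 / real n ^ 4 \<le> 1 / real n" using n1 by (intro divide_left_mono) auto
      show "0 \<le> (2 + 2 * v) * (32 * (1 + exp 20800) / \<epsilon>^12)" using v_nonneg e by (intro mult_nonneg_nonneg divide_nonneg_nonneg add_nonneg_nonneg) auto
    qed
    finally show "C2 \<le> (2 + 2 * v) * (32 * (1 + exp 20800) / \<epsilon>^12) / real n" by simp
  qed simp
  also have "H + (C1 * 2 + real (2 * nat \<lceil>1/\<epsilon>\<rceil> + 1) * ((2 + 2 * v) * (32 * (1 + exp 20800) / \<epsilon>^12) / real n))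
    = (3 / s + 1 / s\<^sup>2) * (L2sq (\<lambda>x. f x - proj f m x) + \<kappa> * real (Dim m) / real n)
      + (4 * v\<^sup>2 + 16384 / s\<^sup>2 * exp (20800 * v)
         + (2 + 2 * v) * (32 * real (2 * nat \<lceil>1/\<epsilon>\<rceil> + 1) * (1 + exp 20800) / \<epsilon>^12)) / real n"
  proof -
    define N E T where "N = real (2 * nat \<lceil>1/\<epsilon>\<rceil> + 1)" and "E = 1 + exp (20800 :: real)" and "T = \<epsilon>^12"
    show ?thesis unfolding H_def C1_def N_def[symmetric] E_def[symmetric] T_def[symmetric]
      by (simp add: add_divide_distrib mult_ac)
  qed
  finally show ?thesis .
qed

end

theorem theorem3:
  fixes \<kappa> \<sigma>0 :: real
  assumes "\<kappa> > 32" and "\<sigma>0 > 0"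
  shows "\<exists>K :: real. \<exists>Kt :: real \<Rightarrow> real.
    \<forall>(f :: real \<Rightarrow> real) (Q :: (real \<times> real) measure) (n :: nat).
      f \<in> borel_measurable borel \<longrightarrow>
      (\<forall>x\<in>circ. f x \<ge> 0) \<longrightarrow>
      (\<integral>x\<in>circ. f x \<partial>lborel) = 1 \<longrightarrow>
      (\<exists>B. AE x in lborel. x \<in> circ \<longrightarrow> \<bar>f x\<bar> \<le> B) \<longrightarrow>
      prob_space Q \<longrightarrow> sets Q = sets (borel :: (real \<times> real) measure) \<longrightarrow>
      (AE p in Q. fst p \<in> circ \<and> snd p \<in> circ \<and> fst p \<noteq> snd p) \<longrightarrow>
      (\<forall>x\<in>circ. sigmaQ Q x \<ge> \<sigma>0) \<longrightarrow>
      n \<ge> 4 \<longrightarrow>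
      (\<integral>\<^sup>+ \<omega>. ennreal (L2sq (\<lambda>x. ftilde \<kappa> n \<omega> x - f x)) \<partial>sample_law f Q n)
        \<le> ennreal (K * (INF m\<in>Mset n. L2sq (\<lambda>x. f x - proj f m x) + \<kappa> * real (Dim m) / real n)
                   + Kt (Linf f) / real n)"
proof -
  define s where "s = \<sigma>0 / 2"
  define \<epsilon> where "\<epsilon> = \<sigma>0 / 10"
  define Kt where "Kt v = 4 * v\<^sup>2 + 16384 / s\<^sup>2 * exp (20800 * v)
         + (2 + 2 * v) * (32 * real (2 * nat \<lceil>1/\<epsilon>\<rceil> + 1) * (1 + exp 20800) / \<epsilon>^12)" for v
  show ?thesis
  proof (intro exI[of _ "3 / s + 1 / s\<^sup>2"] exI[of _ Kt] allI impI)
    fix f :: "real \<Rightarrow> real" and Q :: "(real \<times> real) measure" and n :: nat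
    assume f: "f \<in> borel_measurable borel" "\<forall>x\<in>circ. f x \<ge> 0" "(\<integral>x\<in>circ. f x \<partial>lborel) = 1"
        "\<exists>B. AE x in lborel. x \<in> circ \<longrightarrow> \<bar>f x\<bar> \<le> B"
      and Q: "prob_space Q" "sets Q = sets (borel :: (real \<times> real) measure)"
        "AE p in Q. fst p \<in> circ \<and> snd p \<in> circ \<and> fst p \<noteq> snd p"
      and sig: "\<forall>x\<in>circ. sigmaQ Q x \<ge> \<sigma>0" and n: "n \<ge> 4"
    have circ: "AE p in Q. fst p \<in> circ \<and> snd p \<in> circ" using Q(3) by eventually_elim auto
    interpret arc_model f Q "Linf f"
    proof (rule arc_model.intro)
      show "(\<integral>x. f x \<partial>lcirc) = 1" using f(3) by (simp add: integral_circ)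
    qed (use f(1,2) in blast, use f(2) in blast, rule AE_le_Linf[OF f(4)], rule Q(1), rule Q(2))
    let ?h = "\<lambda>m. L2sq (\<lambda>x. f x - proj f m x) + \<kappa> * real (Dim m) / real n"
    have fin: "finite (Mset n)" "Mset n \<noteq> {}" using n by (auto simp: Mset_def)
    \<comment> \<open>The infimum over finitely many models is attained, so the bound at a single
      \<open>m\<close> is enough.\<close>
    have "(INF m\<in>Mset n. ?h m) \<in> ?h ` Mset n"
      using fin by (subst cInf_eq_Min) (auto intro: Min_in)
    then obtain m where m: "m \<in> Mset n" "(INF m\<in>Mset n. ?h m) = ?h m" by blast
    show "(\<integral>\<^sup>+ \<omega>. ennreal (L2sq (\<lambda>x. ftilde \<kappa> n \<omega> x - f x)) \<partial>sample_law f Q n)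
        \<le> ennreal ((3 / s + 1 / s\<^sup>2) * (INF m\<in>Mset n. ?h m) + Kt (Linf f) / real n)"
      unfolding m(2) Kt_def s_def \<epsilon>_def
      by (rule risk_bound[OF assms n m(1) circ]) (use sig in blast)
  qed
qed

end
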